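(* Let $X$ be a two-sided shift space on a finite alphabet and $\varphi\colon X\to\mathbb R$ be continuous. Suppose that $\mathcal R$ is an $\mathcal L$-invariant family of rectangles on which the families of leaf measures $m^{\mathrm u}_x$ and $m^{\mathrm s}_x$ both have uniformly continuous holonomies and are positive. For $R\in\mathcal R$ and $q\in R$ define a measure on $R$ by $$\lambda_{R}(Z)=\int_{W^{\mathrm u}_R(q)}\int_{W^{\mathrm s}_R(q)}e^{\Delta^u([y,z],y)}e^{\Delta^s([y,z],z)}\mathbf 1_Z([y,z])\,dm^{\mathrm s}_q(y)\,dm^{\mathrm u}_q(z).$$ Then for every $R\in\mathcal R$ the measure $\lambda_R$ is independent of the choice of $q\in R$, and is nonzero.
   Context: Let $A$ be a finite set and $\sigma\colon A^{\mathbb Z}\to A^{\mathbb Z}$ the shift $(\sigma x)_n=x_{n+1}$; $A^{\mathbb Z}$ has the metric $d(x,y)=2^{-\min\{|n|:x_n\ne y_n\}}$. A two-sided shift space is a (nonempty) closed $\sigma$-invariant set $X\subset A^{\mathbb Z}$. For $w\in A^n$ (length $|w|=n$) let $[w]^+=\{x\in X:x_{[0,n)}=w\}$ and $[w]^-=\{x\in X:x_{(-n,0]}=w\}$; $\mathcal L_n=\{w\in A^n:[w]^+\ne\emptyset\}$, $\mathcal L=\bigcup_{n\ge0}\mathcal L_n$, $\mathcal L_{\ge N}=\{w\in\mathcal L:|w|\ge N\}$. Let $S_n\varphi(x)=\sum_{k=0}^{n-1}\varphi(\sigma^kx)$, $\Phi(w)=\sup_{x\in[w]^+}S_{|w|}\varphi(x)$,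 $\Lambda_n=\sum_{w\in\mathcal L_n}e^{\Phi(w)}$, $P=\lim_n\frac1n\log\Lambda_n$. Leaves: $W^{\mathrm u}_{\mathrm{loc}}(x)=\{y\in X:y_k=x_k\ \forall k\le0\}$, $W^{\mathrm s}_{\mathrm{loc}}(x)=\{y\in X:y_k=x_k\ \forall k\ge0\}$. Weights: $\Phi^+_x(w)=\sup\{S_{|w|}\varphi(y):y\in W^{\mathrm u}_{\mathrm{loc}}(x)\cap[w]^+\}$, $\Phi^-_x(w)=\sup\{\sum_{k=0}^{|w|-1}\varphi(\sigma^{-k}y):y\in W^{\mathrm s}_{\mathrm{loc}}(x)\cap[w]^-\}$ ($\sup\emptyset=-\infty$, $e^{-\infty}=0$). Covers: $\mathbb E^{\pm}(Z,N)=\{\mathcal E\subset\mathcal L_{\ge N}:Z\subset\bigcup_{w\in\mathcal E}[w]^{\pm}\}$. Leaf measures (Borel measures on the leaves): $m^{\mathrm u}_x(Z)=\lim_{N\to\infty}\inf\{\sum_{w\in\mathcal E}e^{\Phi^+_x(w)-|w|P}:\mathcal E\in\mathbb E^+(Z,N)\}$ for $Z\subset W^{\mathrm u}_{\mathrm{loc}}(x)$, and $m^{\mathrm s}_x(Z)=\lim_{N\to\infty}\inf\{\sum_{w\in\mathcal E}e^{\Phi^-_x(w)-|w|P}:\mathcal E\in\mathbb E^-(Z,N)\}$ for $Z\subset W^{\mathrm s}_{\mathrm{loc}}(x)$. Rectangles and holonomies: for $x,y\in X$ with $x_0=y_0$, $[x,y]$ is the sequence with $[x,y]_n=x_n$ for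 $n\le0$ and $[x,y]_n=y_n$ for $n\ge0$. $R\subset X$ is a rectangle if for all $x,y\in R$ the bracket $[x,y]$ is defined (so $x_0=y_0$) and lies in $R$. For $x\in R$, $W^{\mathrm{u}}_R(x)=W^{\mathrm{u}}_{\mathrm{loc}}(x)\cap R$, $W^{\mathrm{s}}_R(x)=W^{\mathrm{s}}_{\mathrm{loc}}(x)\cap R$. For $z,y\in R$: $\pi^s_{z,y}\colon W^{\mathrm u}_R(z)\to W^{\mathrm u}_R(y)$, $\pi^s_{z,y}(x)=[y,x]$, and $\pi^u_{z,y}\colon W^{\mathrm s}_R(z)\to W^{\mathrm s}_R(y)$, $\pi^u_{z,y}(x)=[x,y]$. $\mathcal R$ is $\mathcal L$-invariant if for all $R\in\mathcal R$, $n\in\mathbb N$, $w\in\mathcal L_{n+1}$, the rectangles $\sigma^n(R\cap[w]^+)$ and $\sigma^{-n}(R\cap[w]^-)$ belong to $\mathcal R$ (nonempty ones being understood). $m^{\mathrm u}_x$ is positive on $\mathcal R$ if every $R\in\mathcal R$ contains some $x$ with $m^{\mathrm u}_x(W^{\mathrm u}_R(x))>0$; likewise for $m^{\mathrm s}_x$ with $W^{\mathrm s}_R(x)$. $m^{\mathrm u}_x$ has uniformly continuous holonomies on $\mathcal R$ if for every $\epsilon>0$ there is $\delta>0$ such that for all $R\in\mathcal R$ and $y,z\in R$ with $d(y,z)<\delta$, $e^{-\epsilon}m^{\mathrm u}_z(\pi^s_{y,z}(Y))\le m^{\mathrm u}_y(Y)\le e^\epsilon m^{\mathrm u}_z(\pi^s_{y,z}(Y))$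 for all measurable $Y\subset W^{\mathrm u}_R(y)$; likewise for $m^{\mathrm s}_x$ with $\pi^u_{y,z}$ and $Y\subset W^{\mathrm s}_R(y)$. For $R\in\mathcal R$: $\Delta^s(x',x)=\sum_{n=0}^\infty(\varphi(\sigma^nx')-\varphi(\sigma^nx))$ for $x\in R,\ x'\in W^{\mathrm s}_R(x)$, and $\Delta^u(x',x)=\sum_{n=0}^\infty(\varphi(\sigma^{-n}x')-\varphi(\sigma^{-n}x))$ for $x\in R,\ x'\in W^{\mathrm u}_R(x)$; under the hypotheses of the claim these series converge and are uniformly bounded.
   Formalization: The formal theorem additionally assumes that the leaf measures on W^u_R(q) and W^s_R(q) are sigma-finite for all R in the family and q in R; without this, purely infinite leaf measures can make the series for Delta diverge, so that lambda_R is undefined. *)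

theory Defs
  imports "HOL-Analysis.Analysis"
begin

section \<open>Two-sided sequences over a finite alphabet\<close>

text \<open>The finite alphabet is a type \<open>'a::finite\<close>, so the full shift is the type \<open>int \<Rightarrow> 'a\<close>.
  A point of a proper shift space is distinguished by membership in a set \<open>X\<close>.\<close>

definition seq_dist :: "(int \<Rightarrow> 'a) \<Rightarrow> (int \<Rightarrow> 'a) \<Rightarrow> real" where
  "seq_dist x y =
     (if x = y then 0 else (1/2) ^ (LEAST k. \<exists>n. nat \<bar>n\<bar> = k \<and> x n \<noteq> y n))"

lemma seq_dist_less_iff:
  "seq_dist x y < (1/2) ^ k \<longleftrightarrow> (\<forall>n. nat \<bar>n\<bar> \<le> k \<longrightarrow> x n = y n)"
proof (cases "x = y")
  case True
  then show ?thesis by (simp add: seq_dist_def)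
next
  case False
  define m where "m = (LEAST k. \<exists>n. nat \<bar>n\<bar> = k \<and> x n \<noteq> y n)"
  obtain n where "x n \<noteq> y n" using False by blast
  then have "\<exists>n. nat \<bar>n\<bar> = m \<and> x n \<noteq> y n"
    unfolding m_def by (intro LeastI[of "\<lambda>k. \<exists>n. nat \<bar>n\<bar> = k \<and> x n \<noteq> y n" "nat \<bar>n\<bar>"]) blast
  then obtain n0 where n0: "nat \<bar>n0\<bar> = m" "x n0 \<noteq> y n0" by blast
  have least: "m \<le> nat \<bar>n\<bar>" if "x n \<noteq> y n" for n
    unfolding m_def using that by (intro Least_le) blast
  have "seq_dist x y = (1/2) ^ m" using False unfolding seq_dist_def m_def by (simp only: if_False)
  then have "seq_dist x y < (1/2) ^ k \<longleftrightarrow> k < m"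
    by simp
  also have "\<dots> \<longleftrightarrow> (\<forall>n. nat \<bar>n\<bar> \<le> k \<longrightarrow> x n = y n)"
    using n0 least by (meson leD leI le_less_trans)
  finally show ?thesis .
qed

lemma seq_dist_ultra: "seq_dist x z \<le> max (seq_dist x y) (seq_dist y z)"
proof (cases "x = z")
  case True
  have "0 \<le> seq_dist x y" by (simp add: seq_dist_def)
  moreover have "seq_dist x z = 0" using True by (simp add: seq_dist_def)
  ultimately show ?thesis by linarith
next
  case False
  then obtain k where k: "seq_dist x z = (1/2) ^ k" by (simp only: seq_dist_def if_False)
  show ?thesis
  proof (rule ccontr)
    assume "\<not> ?thesis"
    then have "seq_dist x y < (1/2) ^ k" "seq_dist y z < (1/2) ^ k" unfolding k by linarith+
    then have "seq_dist x z < (1/2) ^ k" unfolding seq_dist_less_iff by metis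
    with k show False by linarith
  qed
qed

lemma seq_dist_nonneg: "0 \<le> seq_dist x y"
  by (simp add: seq_dist_def)

lemma Metric_space_seq_dist: "Metric_space UNIV seq_dist"
proof
  fix x y z :: "int \<Rightarrow> 'a"
  show "seq_dist x y = seq_dist y x"
    unfolding seq_dist_def eq_commute[of x y] eq_commute[of "x _" "y _"] by (rule refl)
  show "seq_dist x y = 0 \<longleftrightarrow> x = y" by (simp add: seq_dist_def)
  show "seq_dist x z \<le> seq_dist x y + seq_dist y z"
    using seq_dist_ultra[of x z y] seq_dist_nonneg[of x y] seq_dist_nonneg[of y z] by linarith
qed (rule seq_dist_nonneg)

definition seq_topology :: "(int \<Rightarrow> 'a) topology" where
  "seq_topology = Metric_space.mtopology UNIV seq_dist"

definition seq_borel :: "(int \<Rightarrow> 'a) measure" where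
  "seq_borel = sigma UNIV {U. openin seq_topology U}"

text \<open>\<open>shift k\<close> is the \<open>k\<close>-th iterate of the shift map, for any integer \<open>k\<close>.\<close>

definition shift :: "int \<Rightarrow> (int \<Rightarrow> 'a) \<Rightarrow> (int \<Rightarrow> 'a)" where
  "shift k x = (\<lambda>n. x (n + k))"

definition shift_space :: "(int \<Rightarrow> 'a) set \<Rightarrow> bool" where
  "shift_space X \<longleftrightarrow> X \<noteq> {} \<and> closedin seq_topology X \<and> shift 1 ` X = X"

section \<open>Language, cylinders and pressure\<close>

definition cyl_plus :: "(int \<Rightarrow> 'a) set \<Rightarrow> 'a list \<Rightarrow> (int \<Rightarrow> 'a) set" where
  "cyl_plus X w = {x \<in> X. \<forall>i<length w. x (int i) = w ! i}"

text \<open>The word \<open>w\<close> is read, from left to right, at the positions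
  \<open>- length w + 1, \<dots>, 0\<close>.\<close>

definition cyl_minus :: "(int \<Rightarrow> 'a) set \<Rightarrow> 'a list \<Rightarrow> (int \<Rightarrow> 'a) set" where
  "cyl_minus X w = {x \<in> X. \<forall>i<length w. x (int i - int (length w) + 1) = w ! i}"

definition lang :: "(int \<Rightarrow> 'a) set \<Rightarrow> 'a list set" where
  "lang X = {w. cyl_plus X w \<noteq> {}}"

definition birkhoff_plus :: "((int \<Rightarrow> 'a) \<Rightarrow> real) \<Rightarrow> nat \<Rightarrow> (int \<Rightarrow> 'a) \<Rightarrow> real" where
  "birkhoff_plus \<phi> n x = (\<Sum>k<n. \<phi> (shift (int k) x))"

definition birkhoff_minus :: "((int \<Rightarrow> 'a) \<Rightarrow> real) \<Rightarrow> nat \<Rightarrow> (int \<Rightarrow> 'a) \<Rightarrow> real" where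
  "birkhoff_minus \<phi> n x = (\<Sum>k<n. \<phi> (shift (- int k) x))"

definition word_weight :: "(int \<Rightarrow> 'a) set \<Rightarrow> ((int \<Rightarrow> 'a) \<Rightarrow> real) \<Rightarrow> 'a list \<Rightarrow> real" where
  "word_weight X \<phi> w = (SUP x\<in>cyl_plus X w. birkhoff_plus \<phi> (length w) x)"

definition partition_sum ::
    "(int \<Rightarrow> 'a::finite) set \<Rightarrow> ((int \<Rightarrow> 'a) \<Rightarrow> real) \<Rightarrow> nat \<Rightarrow> real" where
  "partition_sum X \<phi> n = (\<Sum>w\<in>{w \<in> lang X. length w = n}. exp (word_weight X \<phi> w))"

definition pressure :: "(int \<Rightarrow> 'a::finite) set \<Rightarrow> ((int \<Rightarrow> 'a) \<Rightarrow> real) \<Rightarrow> real" where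
  "pressure X \<phi> = lim (\<lambda>n. 1 / real n * ln (partition_sum X \<phi> n))"

section \<open>Leaves and leaf measures\<close>

definition Wu_loc :: "(int \<Rightarrow> 'a) set \<Rightarrow> (int \<Rightarrow> 'a) \<Rightarrow> (int \<Rightarrow> 'a) set" where
  "Wu_loc X x = {y \<in> X. \<forall>k\<le>0. y k = x k}"

definition Ws_loc :: "(int \<Rightarrow> 'a) set \<Rightarrow> (int \<Rightarrow> 'a) \<Rightarrow> (int \<Rightarrow> 'a) set" where
  "Ws_loc X x = {y \<in> X. \<forall>k\<ge>0. y k = x k}"

text \<open>The weights are extended reals, so that the supremum of the empty set is \<open>-\<infinity>\<close>.\<close>

definition weight_plus ::
    "(int \<Rightarrow> 'a) set \<Rightarrow> ((int \<Rightarrow> 'a) \<Rightarrow> real) \<Rightarrow> (int \<Rightarrow> 'a) \<Rightarrow> 'a list \<Rightarrow> ereal" where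
  "weight_plus X \<phi> x w =
     (SUP y\<in>Wu_loc X x \<inter> cyl_plus X w. ereal (birkhoff_plus \<phi> (length w) y))"

definition weight_minus ::
    "(int \<Rightarrow> 'a) set \<Rightarrow> ((int \<Rightarrow> 'a) \<Rightarrow> real) \<Rightarrow> (int \<Rightarrow> 'a) \<Rightarrow> 'a list \<Rightarrow> ereal" where
  "weight_minus X \<phi> x w =
     (SUP y\<in>Ws_loc X x \<inter> cyl_minus X w. ereal (birkhoff_minus \<phi> (length w) y))"

definition exp_ereal :: "ereal \<Rightarrow> ennreal" where
  "exp_ereal a = (case a of ereal r \<Rightarrow> ennreal (exp r) | PInfty \<Rightarrow> \<infinity> | MInfty \<Rightarrow> 0)"

definition covers_plus :: "(int \<Rightarrow> 'a) set \<Rightarrow> (int \<Rightarrow> 'a) set \<Rightarrow> nat \<Rightarrow> 'a list set set" where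
  "covers_plus X Z N =
     {\<E>. \<E> \<subseteq> {w \<in> lang X. N \<le> length w} \<and> Z \<subseteq> (\<Union>w\<in>\<E>. cyl_plus X w)}"

definition covers_minus :: "(int \<Rightarrow> 'a) set \<Rightarrow> (int \<Rightarrow> 'a) set \<Rightarrow> nat \<Rightarrow> 'a list set set" where
  "covers_minus X Z N =
     {\<E>. \<E> \<subseteq> {w \<in> lang X. N \<le> length w} \<and> Z \<subseteq> (\<Union>w\<in>\<E>. cyl_minus X w)}"

definition mu ::
    "(int \<Rightarrow> 'a::finite) set \<Rightarrow> ((int \<Rightarrow> 'a) \<Rightarrow> real) \<Rightarrow> (int \<Rightarrow> 'a) \<Rightarrow> (int \<Rightarrow> 'a) set \<Rightarrow> ennreal" where
  "mu X \<phi> x Z = lim (\<lambda>N. INF \<E>\<in>covers_plus X Z N.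
     infsum (\<lambda>w. exp_ereal (weight_plus X \<phi> x w - ereal (real (length w) * pressure X \<phi>))) \<E>)"

definition ms ::
    "(int \<Rightarrow> 'a::finite) set \<Rightarrow> ((int \<Rightarrow> 'a) \<Rightarrow> real) \<Rightarrow> (int \<Rightarrow> 'a) \<Rightarrow> (int \<Rightarrow> 'a) set \<Rightarrow> ennreal" where
  "ms X \<phi> x Z = lim (\<lambda>N. INF \<E>\<in>covers_minus X Z N.
     infsum (\<lambda>w. exp_ereal (weight_minus X \<phi> x w - ereal (real (length w) * pressure X \<phi>))) \<E>)"

text \<open>\<open>borel_subsets D\<close> are the Borel subsets of the subspace \<open>D\<close>, which need not itself be Borel.
  On these sets the outer measures \<open>mu X \<phi> x\<close> (if \<open>D \<subseteq> Wu_loc X x\<close>) and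
  \<open>ms X \<phi> x\<close> (if \<open>D \<subseteq> Ws_loc X x\<close>) are countably additive.\<close>

definition borel_subsets :: "(int \<Rightarrow> 'a) set \<Rightarrow> (int \<Rightarrow> 'a) set set" where
  "borel_subsets D = sets (restrict_space seq_borel D)"

definition mu_measure ::
    "(int \<Rightarrow> 'a::finite) set \<Rightarrow> ((int \<Rightarrow> 'a) \<Rightarrow> real) \<Rightarrow> (int \<Rightarrow> 'a) \<Rightarrow> (int \<Rightarrow> 'a) set
      \<Rightarrow> (int \<Rightarrow> 'a) measure" where
  "mu_measure X \<phi> x D = measure_of D (borel_subsets D) (mu X \<phi> x)"

definition ms_measure ::
    "(int \<Rightarrow> 'a::finite) set \<Rightarrow> ((int \<Rightarrow> 'a) \<Rightarrow> real) \<Rightarrow> (int \<Rightarrow> 'a) \<Rightarrow> (int \<Rightarrow> 'a) set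
      \<Rightarrow> (int \<Rightarrow> 'a) measure" where
  "ms_measure X \<phi> x D = measure_of D (borel_subsets D) (ms X \<phi> x)"

section \<open>Rectangles and holonomies\<close>

text \<open>The bracket is meaningful only when \<open>x 0 = y 0\<close>.\<close>

definition bracket :: "(int \<Rightarrow> 'a) \<Rightarrow> (int \<Rightarrow> 'a) \<Rightarrow> (int \<Rightarrow> 'a)" where
  "bracket x y = (\<lambda>n. if n \<le> 0 then x n else y n)"

definition rectangle :: "(int \<Rightarrow> 'a) set \<Rightarrow> (int \<Rightarrow> 'a) set \<Rightarrow> bool" where
  "rectangle X R \<longleftrightarrow> R \<subseteq> X \<and> (\<forall>x\<in>R. \<forall>y\<in>R. x 0 = y 0 \<and> bracket x y \<in> R)"

definition Wu_rect ::
    "(int \<Rightarrow> 'a) set \<Rightarrow> (int \<Rightarrow> 'a) set \<Rightarrow> (int \<Rightarrow> 'a) \<Rightarrow> (int \<Rightarrow> 'a) set" where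
  "Wu_rect X R x = Wu_loc X x \<inter> R"

definition Ws_rect ::
    "(int \<Rightarrow> 'a) set \<Rightarrow> (int \<Rightarrow> 'a) set \<Rightarrow> (int \<Rightarrow> 'a) \<Rightarrow> (int \<Rightarrow> 'a) set" where
  "Ws_rect X R x = Ws_loc X x \<inter> R"

text \<open>\<open>hol_s z y\<close> maps the unstable leaf of \<open>z\<close> to that of \<open>y\<close>, and
  \<open>hol_u z y\<close> maps the stable leaf of \<open>z\<close> to that of \<open>y\<close>; the first
  argument only indicates the domain.\<close>

definition hol_s :: "(int \<Rightarrow> 'a) \<Rightarrow> (int \<Rightarrow> 'a) \<Rightarrow> (int \<Rightarrow> 'a) \<Rightarrow> (int \<Rightarrow> 'a)" where
  "hol_s z y x = bracket y x"

definition hol_u :: "(int \<Rightarrow> 'a) \<Rightarrow> (int \<Rightarrow> 'a) \<Rightarrow> (int \<Rightarrow> 'a) \<Rightarrow> (int \<Rightarrow> 'a)" where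
  "hol_u z y x = bracket x y"

definition L_invariant :: "(int \<Rightarrow> 'a) set \<Rightarrow> (int \<Rightarrow> 'a) set set \<Rightarrow> bool" where
  "L_invariant X \<R> \<longleftrightarrow>
     (\<forall>R\<in>\<R>. \<forall>n::nat. \<forall>w\<in>lang X. length w = n + 1 \<longrightarrow>
        (R \<inter> cyl_plus X w \<noteq> {} \<longrightarrow> shift (int n) ` (R \<inter> cyl_plus X w) \<in> \<R>) \<and>
        (R \<inter> cyl_minus X w \<noteq> {} \<longrightarrow> shift (- int n) ` (R \<inter> cyl_minus X w) \<in> \<R>))"

definition positive_u ::
    "(int \<Rightarrow> 'a::finite) set \<Rightarrow> ((int \<Rightarrow> 'a) \<Rightarrow> real) \<Rightarrow> (int \<Rightarrow> 'a) set set \<Rightarrow> bool" where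
  "positive_u X \<phi> \<R> \<longleftrightarrow> (\<forall>R\<in>\<R>. \<exists>x\<in>R. mu X \<phi> x (Wu_rect X R x) > 0)"

definition positive_s ::
    "(int \<Rightarrow> 'a::finite) set \<Rightarrow> ((int \<Rightarrow> 'a) \<Rightarrow> real) \<Rightarrow> (int \<Rightarrow> 'a) set set \<Rightarrow> bool" where
  "positive_s X \<phi> \<R> \<longleftrightarrow> (\<forall>R\<in>\<R>. \<exists>x\<in>R. ms X \<phi> x (Ws_rect X R x) > 0)"

definition uniform_holonomies_u ::
    "(int \<Rightarrow> 'a::finite) set \<Rightarrow> ((int \<Rightarrow> 'a) \<Rightarrow> real) \<Rightarrow> (int \<Rightarrow> 'a) set set \<Rightarrow> bool" where
  "uniform_holonomies_u X \<phi> \<R> \<longleftrightarrow>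
     (\<forall>\<epsilon>::real. \<epsilon> > 0 \<longrightarrow> (\<exists>\<delta>::real. \<delta> > 0 \<and>
       (\<forall>R\<in>\<R>. \<forall>y\<in>R. \<forall>z\<in>R. seq_dist y z < \<delta> \<longrightarrow>
         (\<forall>Y\<in>borel_subsets (Wu_rect X R y).
            ennreal (exp (- \<epsilon>)) * mu X \<phi> z (hol_s y z ` Y) \<le> mu X \<phi> y Y \<and>
            mu X \<phi> y Y \<le> ennreal (exp \<epsilon>) * mu X \<phi> z (hol_s y z ` Y)))))"

definition uniform_holonomies_s ::
    "(int \<Rightarrow> 'a::finite) set \<Rightarrow> ((int \<Rightarrow> 'a) \<Rightarrow> real) \<Rightarrow> (int \<Rightarrow> 'a) set set \<Rightarrow> bool" where
  "uniform_holonomies_s X \<phi> \<R> \<longleftrightarrow>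
     (\<forall>\<epsilon>::real. \<epsilon> > 0 \<longrightarrow> (\<exists>\<delta>::real. \<delta> > 0 \<and>
       (\<forall>R\<in>\<R>. \<forall>y\<in>R. \<forall>z\<in>R. seq_dist y z < \<delta> \<longrightarrow>
         (\<forall>Y\<in>borel_subsets (Ws_rect X R y).
            ennreal (exp (- \<epsilon>)) * ms X \<phi> z (hol_u y z ` Y) \<le> ms X \<phi> y Y \<and>
            ms X \<phi> y Y \<le> ennreal (exp \<epsilon>) * ms X \<phi> z (hol_u y z ` Y)))))"

section \<open>The product measure on a rectangle\<close>

text \<open>These are sums of convergent series when \<open>x'\<close>, \<open>x\<close> lie in the same stable
  (resp. unstable) leaf of a rectangle in a family as in the theorem; that they converge is part of what
  has to be proved there.\<close>

definition Delta_s :: "((int \<Rightarrow> 'a) \<Rightarrow> real) \<Rightarrow> (int \<Rightarrow> 'a) \<Rightarrow> (int \<Rightarrow> 'a) \<Rightarrow> real" where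
  "Delta_s \<phi> x' x = (\<Sum>n. \<phi> (shift (int n) x') - \<phi> (shift (int n) x))"

definition Delta_u :: "((int \<Rightarrow> 'a) \<Rightarrow> real) \<Rightarrow> (int \<Rightarrow> 'a) \<Rightarrow> (int \<Rightarrow> 'a) \<Rightarrow> real" where
  "Delta_u \<phi> x' x = (\<Sum>n. \<phi> (shift (- int n) x') - \<phi> (shift (- int n) x))"

definition lambda_fun ::
    "(int \<Rightarrow> 'a::finite) set \<Rightarrow> ((int \<Rightarrow> 'a) \<Rightarrow> real) \<Rightarrow> (int \<Rightarrow> 'a) set \<Rightarrow> (int \<Rightarrow> 'a)
      \<Rightarrow> (int \<Rightarrow> 'a) set \<Rightarrow> ennreal" where
  "lambda_fun X \<phi> R q Z =
     (\<integral>\<^sup>+ z. (\<integral>\<^sup>+ y. ennreal (exp (Delta_u \<phi> (bracket y z) y)) *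
                    ennreal (exp (Delta_s \<phi> (bracket y z) z)) * indicator Z (bracket y z)
              \<partial>ms_measure X \<phi> q (Ws_rect X R q)) \<partial>mu_measure X \<phi> q (Wu_rect X R q))"

text \<open>\<open>measure_of\<close> returns the zero measure if \<open>lambda_fun X \<phi> R q\<close> is not countably
  additive, so that \<open>lambda_measure\<close> agrees with the formula on the Borel subsets of
  \<open>R\<close> whenever the formula defines a measure.\<close>

definition lambda_measure ::
    "(int \<Rightarrow> 'a::finite) set \<Rightarrow> ((int \<Rightarrow> 'a) \<Rightarrow> real) \<Rightarrow> (int \<Rightarrow> 'a) set \<Rightarrow> (int \<Rightarrow> 'a)
      \<Rightarrow> (int \<Rightarrow> 'a) measure" where
  "lambda_measure X \<phi> R q = measure_of R (borel_subsets R) (lambda_fun X \<phi> R q)"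

end

(*
  Fix R and n. A holonomy between unstable leaves of R is conjugated by sigma^n to a holonomy of an
  image rectangle whose leaves are 2^-n-close, so it preserves the leaf measures up to a factor
  close to 1; the conformal scaling of the leaf measures under sigma^n contributes exp of the
  difference of the n-th Birkhoff sums. Comparing two values of n on a small set of positive finite
  measure shows that these differences converge uniformly to Delta^s, and then exp(Delta^s) is the
  Radon-Nikodym derivative of the holonomy. Reversing time gives the same for stable leaves.
  Substituting z -> [q,z] and y -> [y,q] in the double integral, the cocycle identities for Delta^s
  and Delta^u cancel every trace of the base point q. Positivity spreads from one point of a
  rectangle to all leaves by the same conjugation, so the integral of the positive density is not 0.
*)
theory Submission
  imports Defs
begin

section \<open>Topology of the full shift\<close>

text \<open>The potential is merely continuous, so the convergence of the series Delta^s and Delta^u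
  cannot be read off from \<phi>; it has to be extracted from the measures. The \<open>n\<close>-th
  Birkhoff sum is almost constant only on pieces of a leaf whose size depends on \<open>n\<close>.
  Hence every estimate fixes \<open>n\<close> first and a depth \<open>M\<close> of the pieces
  afterwards; this is harmless, since two measures are compared by cutting a leaf into finitely many
  cylinders and adding up. The estimates must be uniform over the family, because the holonomy
  hypothesis is always applied to image rectangles and not to the one under study. Rectangles need
  not be Borel sets, so all measures live on the trace sigma-algebra of a leaf and are built there
  by Caratheodory's method. Sigma-finiteness enters twice: it supplies Borel sets of positive finite
  measure, by which the convergence argument divides, and it makes the inner integral measurable in
  the outer variable, on which the countable additivity of lambda rests.\<close>

lemma openin_seq_topology_iff:
  "openin seq_topology U \<longleftrightarrow> (\<forall>x\<in>U. \<exists>k::nat. \<forall>y. (\<forall>n. nat \<bar>n\<bar> \<le> k \<longrightarrow> y n = x n) \<longrightarrow> y \<in> U)"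
    (is "?L \<longleftrightarrow> ?R")
proof -
  interpret Metric_space UNIV seq_dist by (rule Metric_space_seq_dist)
  have mball: "mball x ((1/2)^k) = {y. \<forall>n. nat \<bar>n\<bar> \<le> k \<longrightarrow> y n = x n}" for x :: "int \<Rightarrow> 'a" and k
    by (auto simp: mball_def seq_dist_less_iff)
  have "?L \<longleftrightarrow> (\<forall>x\<in>U. \<exists>r>0. mball x r \<subseteq> U)"
    unfolding seq_topology_def openin_mtopology by auto
  also have "\<dots> \<longleftrightarrow> (\<forall>x\<in>U. \<exists>k::nat. mball x ((1/2)^k) \<subseteq> U)"
  proof (intro ball_cong refl iffI)
    fix x assume "\<exists>r>0. mball x r \<subseteq> U"
    then obtain r where r: "r > 0" "mball x r \<subseteq> U" by blast
    obtain k :: nat where "(1/2)^k < r" using real_arch_pow_inv[OF r(1), of "1/2"] by auto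
    then have "mball x ((1/2)^k) \<subseteq> mball x r" by (auto simp: mball_def)
    with r show "\<exists>k::nat. mball x ((1/2)^k) \<subseteq> U" by blast
  next
    fix x assume "\<exists>k::nat. mball x ((1/2)^k) \<subseteq> U"
    then show "\<exists>r>0. mball x r \<subseteq> U" by (metis half_gt_zero_iff zero_less_one zero_less_power)
  qed
  also have "\<dots> \<longleftrightarrow> ?R" unfolding mball by (simp add: subset_iff)
  finally show ?thesis .
qed

lemma openin_seq_cylinder: "openin seq_topology {y. \<forall>n. nat \<bar>n\<bar> \<le> k \<longrightarrow> y n = x n}"
  unfolding openin_seq_topology_iff by (intro ballI exI[of _ k]) simp

lemma topspace_seq_topology [simp]: "topspace seq_topology = UNIV"
  by (metis Metric_space.topspace_mtopology Metric_space_seq_dist seq_topology_def)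

text \<open>Gives access to Tychonoff's theorem, and thereby to the compactness of the full
  shift.\<close>

lemma seq_topology_eq_product:
  "seq_topology = product_topology (\<lambda>_. discrete_topology (UNIV :: 'a set)) (UNIV :: int set)"
proof (rule topology_eq[THEN iffD2], intro allI iffI)
  fix U :: "(int \<Rightarrow> 'a) set"
  assume U: "openin seq_topology U"
  show "openin (product_topology (\<lambda>_. discrete_topology UNIV) UNIV) U"
    unfolding openin_product_topology_alt
  proof
    fix x assume "x \<in> U"
    then obtain k :: nat where k: "\<And>y. (\<forall>n. nat \<bar>n\<bar> \<le> k \<longrightarrow> y n = x n) \<Longrightarrow> y \<in> U"
      using U unfolding openin_seq_topology_iff by blast
    have "{i. nat \<bar>i\<bar> \<le> k} \<subseteq> {- int k..int k}" by auto
    then have "finite {i. nat \<bar>i\<bar> \<le> k}" by (rule finite_subset) simp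
    then show "\<exists>V. finite {i \<in> UNIV. V i \<noteq> topspace (discrete_topology (UNIV :: 'a set))} \<and>
        (\<forall>i\<in>UNIV. openin (discrete_topology UNIV) (V i)) \<and> x \<in> Pi\<^sub>E UNIV V \<and> Pi\<^sub>E UNIV V \<subseteq> U"
      by (intro exI[of _ "\<lambda>i. if nat \<bar>i\<bar> \<le> k then {x i} else UNIV"] conjI)
        (auto elim: rev_finite_subset intro!: k simp: PiE_iff split: if_splits)
  qed
next
  fix U :: "(int \<Rightarrow> 'a) set"
  assume U: "openin (product_topology (\<lambda>_. discrete_topology UNIV) UNIV) U"
  show "openin seq_topology U"
    unfolding openin_seq_topology_iff
  proof
    fix x assume "x \<in> U"
    then obtain V where V: "finite {i. V i \<noteq> (UNIV :: 'a set)}" "x \<in> Pi\<^sub>E UNIV V" "Pi\<^sub>E UNIV V \<subseteq> U"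
      using U unfolding openin_product_topology_alt by fastforce
    have "\<exists>k. \<forall>i\<in>{i. V i \<noteq> UNIV}. nat \<bar>i\<bar> \<le> k"
      using V(1) by (intro exI[of _ "Max ((\<lambda>i. nat \<bar>i\<bar>) ` {i. V i \<noteq> UNIV})"]) auto
    then obtain k where k: "\<And>i. V i \<noteq> UNIV \<Longrightarrow> nat \<bar>i\<bar> \<le> k" by blast
    show "\<exists>k::nat. \<forall>y. (\<forall>n. nat \<bar>n\<bar> \<le> k \<longrightarrow> y n = x n) \<longrightarrow> y \<in> U"
    proof (intro exI[of _ k] allI impI)
      fix y assume y: "\<forall>n. nat \<bar>n\<bar> \<le> k \<longrightarrow> y n = x n"
      have "y n \<in> V n" for n using V(2) k[of n] y by (cases "V n = UNIV") (auto simp: PiE_iff)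
      then show "y \<in> U" using V(3) by (auto simp: PiE_iff)
    qed
  qed
qed

lemma compact_space_seq_topology: "compact_space (seq_topology :: (int \<Rightarrow> 'a::finite) topology)"
  unfolding seq_topology_eq_product by (simp add: compact_space_product_topology compact_space_discrete_topology)

text \<open>Uniform continuity on a compact set, in the form used later: a modulus of continuity is
  a number of coordinates.\<close>

lemma continuous_map_seq_uniform:
  fixes X :: "(int \<Rightarrow> 'a::finite) set" and f :: "(int \<Rightarrow> 'a) \<Rightarrow> real"
  assumes X: "closedin seq_topology X"
    and f: "continuous_map (subtopology seq_topology X) euclideanreal f" and e: "\<epsilon> > 0"
  obtains k :: nat where
    "\<And>x y. x \<in> X \<Longrightarrow> y \<in> X \<Longrightarrow> (\<forall>n. nat \<bar>n\<bar> \<le> k \<longrightarrow> x n = y n) \<Longrightarrow> \<bar>f x - f y\<bar> < \<epsilon>"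
proof -
  define C where "C x k = {y. \<forall>n. nat \<bar>n\<bar> \<le> k \<longrightarrow> y n = x n}" for x :: "int \<Rightarrow> 'a" and k :: nat
  have "\<exists>k. \<forall>y\<in>X \<inter> C x k. \<bar>f y - f x\<bar> < \<epsilon>/2" if x: "x \<in> X" for x
  proof -
    have "openin (subtopology seq_topology X) {y \<in> topspace (subtopology seq_topology X). f y \<in> ball (f x) (\<epsilon>/2)}"
      using f by (rule openin_continuous_map_preimage) auto
    then obtain V where V: "openin seq_topology V" "{y \<in> X. f y \<in> ball (f x) (\<epsilon>/2)} = V \<inter> X"
      unfolding openin_subtopology by auto
    have "x \<in> {y \<in> X. f y \<in> ball (f x) (\<epsilon>/2)}" using x e by simp
    then have "x \<in> V" unfolding V(2) by simp
    then obtain k where "C x k \<subseteq> V" using V(1) unfolding openin_seq_topology_iff C_def by blast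
    then have "X \<inter> C x k \<subseteq> {y \<in> X. f y \<in> ball (f x) (\<epsilon>/2)}" unfolding V(2) by blast
    then show ?thesis by (intro exI[of _ k]) (auto simp: dist_real_def abs_minus_commute)
  qed
  then have "\<forall>x\<in>X. \<exists>k. \<forall>y\<in>X \<inter> C x k. \<bar>f y - f x\<bar> < \<epsilon>/2" by blast
  then obtain K where "\<forall>x\<in>X. \<forall>y\<in>X \<inter> C x (K x). \<bar>f y - f x\<bar> < \<epsilon>/2"
    unfolding bchoice_iff by blast
  then have K: "\<And>x y. x \<in> X \<Longrightarrow> y \<in> X \<Longrightarrow> y \<in> C x (K x) \<Longrightarrow> \<bar>f y - f x\<bar> < \<epsilon>/2" by blast
  have "compactin seq_topology X" using closedin_compact_space[OF compact_space_seq_topology X] .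
  moreover have "openin seq_topology (C x k)" for x k unfolding C_def by (rule openin_seq_cylinder)
  moreover have "X \<subseteq> \<Union> ((\<lambda>x. C x (K x)) ` X)" by (auto simp: C_def)
  ultimately have "\<exists>F. finite F \<and> F \<subseteq> (\<lambda>x. C x (K x)) ` X \<and> X \<subseteq> \<Union>F"
    unfolding compactin_def by (elim conjE allE[of _ "(\<lambda>x. C x (K x)) ` X"]) blast
  then obtain F where F: "finite F" "F \<subseteq> (\<lambda>x. C x (K x)) ` X" "X \<subseteq> \<Union>F" by blast
  obtain G where G: "G \<subseteq> X" "finite G" "F = (\<lambda>x. C x (K x)) ` G"
    using F by (meson finite_subset_image)
  \<comment> \<open>Agreement up to the largest of the finitely many radii puts both points into the
    same cylinder around \<open>g\<close>. As \<open>seq_dist\<close> is an ultrametric, no halving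
    of radii is required.\<close>
  define k where "k = Max (insert 0 (K ` G))"
  have kK: "K g \<le> k" if "g \<in> G" for g unfolding k_def using G that by (intro Max_ge) auto
  show ?thesis
  proof (rule that[of k])
    fix x y assume xy: "x \<in> X" "y \<in> X" "\<forall>n. nat \<bar>n\<bar> \<le> k \<longrightarrow> x n = y n"
    then obtain g where g: "g \<in> G" "x \<in> C g (K g)" using F(3) G(3) by blast
    have "y \<in> C g (K g)" using g(2) kK[OF g(1)] xy(3) unfolding C_def by (auto dest: order_trans)
    with g have "\<bar>f x - f g\<bar> < \<epsilon>/2" "\<bar>f y - f g\<bar> < \<epsilon>/2" using K G(1) xy by blast+
    then show "\<bar>f x - f y\<bar> < \<epsilon>" by linarith
  qed
qed

section \<open>The Borel structure\<close>

lemma space_seq_borel [simp]: "space seq_borel = UNIV"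
  unfolding seq_borel_def by (simp add: space_measure_of_conv)

lemma sets_seq_borel: "sets seq_borel = sigma_sets UNIV {U. openin seq_topology U}"
  unfolding seq_borel_def by simp

lemma openin_seq_borel: "openin seq_topology U \<Longrightarrow> U \<in> sets seq_borel"
  by (simp add: sets_seq_borel sigma_sets.Basic)

text \<open>Used for the countable base below, and again to cut a leaf into finitely many pieces
  when a holonomy is compared with its density.\<close>

lemma finite_seq_cylinders:
  "finite (range (\<lambda>x :: int \<Rightarrow> 'a::finite. {y. \<forall>n. nat \<bar>n\<bar> \<le> k \<longrightarrow> y n = x n}))"
proof -
  have "range (\<lambda>x :: int \<Rightarrow> 'a. {y. \<forall>n. nat \<bar>n\<bar> \<le> k \<longrightarrow> y n = x n}) \<subseteq>
      (\<lambda>g. {y. \<forall>n. nat \<bar>n\<bar> \<le> k \<longrightarrow> y n = g n}) ` ({- int k..int k} \<rightarrow>\<^sub>E UNIV)"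
  proof (intro image_subsetI)
    fix x :: "int \<Rightarrow> 'a"
    show "{y. \<forall>n. nat \<bar>n\<bar> \<le> k \<longrightarrow> y n = x n} \<in>
        (\<lambda>g. {y. \<forall>n. nat \<bar>n\<bar> \<le> k \<longrightarrow> y n = g n}) ` ({- int k..int k} \<rightarrow>\<^sub>E UNIV)"
      by (rule image_eqI[of _ _ "restrict x {- int k..int k}"]) auto
  qed
  then show ?thesis by (rule finite_subset) (simp add: finite_PiE)
qed

lemma openin_seq_countable_Union:
  fixes U :: "(int \<Rightarrow> 'a::finite) set"
  assumes "openin seq_topology U"
  obtains \<C> where "countable \<C>" "U = \<Union>\<C>"
    "\<And>C. C \<in> \<C> \<Longrightarrow> \<exists>x k. C = {y. \<forall>n. nat \<bar>n\<bar> \<le> k \<longrightarrow> y n = x n}"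
proof -
  define \<A> where "\<A> = (\<Union>k. range (\<lambda>x :: int \<Rightarrow> 'a. {y. \<forall>n. nat \<bar>n\<bar> \<le> k \<longrightarrow> y n = x n}))"
  show ?thesis
  proof (rule that[of "{C \<in> \<A>. C \<subseteq> U}"])
    have "countable \<A>"
      unfolding \<A>_def by (intro countable_UN countableI_type countable_finite finite_seq_cylinders)
    then show "countable {C \<in> \<A>. C \<subseteq> U}" by (rule countable_subset[rotated]) auto
    show "U = \<Union>{C \<in> \<A>. C \<subseteq> U}"
    proof (intro equalityI subsetI)
      fix x assume "x \<in> U"
      then obtain k where "{y. \<forall>n. nat \<bar>n\<bar> \<le> k \<longrightarrow> y n = x n} \<subseteq> U"
        using assms unfolding openin_seq_topology_iff by blast
      then show "x \<in> \<Union>{C \<in> \<A>. C \<subseteq> U}" unfolding \<A>_def by blast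
    qed auto
  qed (auto simp: \<A>_def)
qed

text \<open>Coordinates suffice because every open set is a countable union of cylinders, each given
  by finitely many coordinates.\<close>

lemma seq_borel_measurableI:
  fixes f :: "'b \<Rightarrow> int \<Rightarrow> 'a::finite"
  assumes f: "\<And>n. (\<lambda>x. f x n) \<in> measurable M (count_space UNIV)"
  shows "f \<in> measurable M seq_borel"
  unfolding seq_borel_def
proof (rule measurable_measure_of)
  fix U :: "(int \<Rightarrow> 'a) set" assume "U \<in> {U. openin seq_topology U}"
  then have U: "openin seq_topology U" by simp
  obtain \<C> where C: "countable \<C>" "U = \<Union>\<C>"
    "\<And>C. C \<in> \<C> \<Longrightarrow> \<exists>x k. C = {y. \<forall>n. nat \<bar>n\<bar> \<le> k \<longrightarrow> y n = x n}"
    by (rule openin_seq_countable_Union[OF U]) blast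
  have "f -` C \<inter> space M \<in> sets M" if CC: "C \<in> \<C>" for C
  proof -
    obtain x k where C': "C = {y. \<forall>n. nat \<bar>n\<bar> \<le> k \<longrightarrow> y n = x n}" using C(3)[OF CC] by blast
    have "f -` C \<inter> space M = {\<omega> \<in> space M. \<forall>n\<in>{- int k..int k}. f \<omega> n = x n}"
      unfolding C' by (auto simp: nat_le_iff abs_le_iff)
    moreover have "{\<omega> \<in> space M. f \<omega> n = x n} \<in> sets M" for n
      using measurable_sets[OF f[of n], of "{x n}"] by (simp add: vimage_def Int_def conj_commute)
    then have "{\<omega> \<in> space M. \<forall>n\<in>{- int k..int k}. f \<omega> n = x n} \<in> sets M"
      by (intro sets.sets_Collect_finite_All') auto
    ultimately show ?thesis by simp
  qed
  then have "(\<Union>C\<in>\<C>. f -` C \<inter> space M) \<in> sets M"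
    by (intro sets.countable_UN'[OF C(1)]) auto
  also have "(\<Union>C\<in>\<C>. f -` C \<inter> space M) = f -` U \<inter> space M" unfolding C(2) by blast
  finally show "f -` U \<inter> space M \<in> sets M" .
qed auto

lemma measurable_seq_coord [measurable]:
  "(\<lambda>x. x n) \<in> measurable (seq_borel :: (int \<Rightarrow> 'a::finite) measure) (count_space UNIV)"
proof (rule measurableI)
  fix A :: "'a set"
  have "openin seq_topology {x :: int \<Rightarrow> 'a. x n \<in> A}"
    unfolding openin_seq_topology_iff by (metis mem_Collect_eq order_refl)
  then show "(\<lambda>x. x n) -` A \<inter> space (seq_borel :: (int \<Rightarrow> 'a) measure) \<in> sets seq_borel"
    by (simp add: openin_seq_borel vimage_def)
qed simp

lemma measurable_seq_coord_compose:
  fixes f :: "'b \<Rightarrow> int \<Rightarrow> 'a::finite"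
  shows "f \<in> measurable M seq_borel \<Longrightarrow> (\<lambda>x. f x n) \<in> measurable M (count_space UNIV)"
  by (rule measurable_compose[OF _ measurable_seq_coord])

lemma measurable_shift [measurable]:
  "shift k \<in> measurable (seq_borel :: (int \<Rightarrow> 'a::finite) measure) seq_borel"
  by (rule seq_borel_measurableI) (simp add: shift_def)

lemma measurable_bracket [measurable (raw)]:
  fixes f g :: "'b \<Rightarrow> int \<Rightarrow> 'a::finite"
  assumes [measurable]: "f \<in> measurable M seq_borel" "g \<in> measurable M seq_borel"
  shows "(\<lambda>x. bracket (f x) (g x)) \<in> measurable M seq_borel"
  by (rule seq_borel_measurableI) (auto simp: bracket_def measurable_seq_coord_compose)

lemma borel_subsets_eq: "borel_subsets D = (\<lambda>B. B \<inter> D) ` sets seq_borel"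
  unfolding borel_subsets_def sets_restrict_space by (simp add: Int_commute image_def)

lemma sets_into_borel_subsets: "B \<in> sets seq_borel \<Longrightarrow> B \<inter> D \<in> borel_subsets D"
  by (simp add: borel_subsets_eq)

lemma borel_subsets_subset: "A \<in> borel_subsets D \<Longrightarrow> A \<subseteq> D"
  by (auto simp: borel_subsets_eq)

lemma self_in_borel_subsets [simp]: "D \<in> borel_subsets D"
  using sets_into_borel_subsets[of UNIV D] by (simp add: sets.top[of seq_borel, simplified])

lemma sigma_algebra_borel_subsets: "sigma_algebra D (borel_subsets D)"
  unfolding borel_subsets_def
  using sets.sigma_algebra_axioms[of "restrict_space seq_borel D"] by (simp add: space_restrict_space)

lemma sets_measure_of_borel_subsets [simp]:
  "sets (measure_of D (borel_subsets D) \<mu>) = borel_subsets D"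
  by (simp add: sigma_algebra.sets_measure_of_eq sigma_algebra_borel_subsets)

lemma space_measure_of_borel_subsets [simp]: "space (measure_of D (borel_subsets D) \<mu>) = D"
  by (simp add: space_measure_of_conv)

lemma sets_restrict_seq_borel: "sets (restrict_space seq_borel D) = borel_subsets D"
  by (simp add: borel_subsets_def)

lemma emeasure_measure_of_borel_subsets:
  assumes "measure_space D (borel_subsets D) \<mu>" "A \<in> borel_subsets D"
  shows "emeasure (measure_of D (borel_subsets D) \<mu>) A = \<mu> A"
  using assms emeasure_measure_of_sigma[of D "borel_subsets D" \<mu> A] by (simp add: measure_space_def)

lemma shift_shift [simp]: "shift m (shift n x) = shift (m + n) x"
  by (simp add: shift_def ac_simps)

lemma shift_0 [simp]: "shift 0 x = x"
  by (simp add: shift_def)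

lemma shift_apply: "shift k x n = x (n + k)"
  by (simp add: shift_def)

section \<open>Sums over countable covers\<close>

lemma infsum_ennreal_eq_SUP:
  fixes f :: "'b \<Rightarrow> ennreal"
  shows "infsum f A = (SUP F\<in>{F. finite F \<and> F \<subseteq> A}. sum f F)"
  by (rule nonneg_infsum_complete) simp

lemma sum_le_infsum_ennreal:
  fixes f :: "'b \<Rightarrow> ennreal"
  shows "finite F \<Longrightarrow> F \<subseteq> A \<Longrightarrow> sum f F \<le> infsum f A"
  unfolding infsum_ennreal_eq_SUP by (rule SUP_upper) simp

lemma infsum_ennreal_mono:
  fixes f g :: "'b \<Rightarrow> ennreal"
  assumes "A \<subseteq> B" "\<And>x. x \<in> A \<Longrightarrow> f x \<le> g x"
  shows "infsum f A \<le> infsum g B"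
  by (intro infsum_mono_neutral nonneg_summable_on_complete) (use assms in auto)

lemma infsum_ennreal_cmult:
  fixes f :: "'b \<Rightarrow> ennreal"
  shows "infsum (\<lambda>x. K * f x) A = K * infsum f A"
  unfolding infsum_ennreal_eq_SUP sum_distrib_left[symmetric]
  by (rule SUP_mult_left_ennreal[symmetric])

text \<open>A word lying in several of the sets is charged to one chosen index, hence only an
  inequality.\<close>

lemma infsum_ennreal_UN_le:
  fixes f :: "'b \<Rightarrow> ennreal" and E :: "nat \<Rightarrow> 'b set"
  shows "infsum f (\<Union>i. E i) \<le> (\<Sum>i. infsum f (E i))"
  unfolding infsum_ennreal_eq_SUP[of f "\<Union>i. E i"]
proof (rule SUP_least)
  fix F assume "F \<in> {F. finite F \<and> F \<subseteq> (\<Union>i. E i)}"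
  then have F: "finite F" "F \<subseteq> (\<Union>i. E i)" by auto
  then have "\<forall>w\<in>F. \<exists>i. w \<in> E i" by blast
  then obtain i where i: "\<And>w. w \<in> F \<Longrightarrow> w \<in> E (i w)" by metis
  have "sum f F = (\<Sum>j\<in>i ` F. sum f {w \<in> F. i w = j})"
    using F(1) by (rule sum.image_gen)
  also have "\<dots> \<le> (\<Sum>j\<in>i ` F. infsum f (E j))"
    using F(1) by (intro sum_mono sum_le_infsum_ennreal) (auto dest!: i)
  also have "\<dots> \<le> (\<Sum>j. infsum f (E j))"
    using F(1) by (intro sum_le_suminf) auto
  finally show "sum f F \<le> (\<Sum>j. infsum f (E j))" .
qed

text \<open>Turns a cost into a supremum of exponentials in \<open>ennreal\<close>, so that costs
  can be compared point by point. For empty \<open>S\<close> both sides are 0.\<close>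

lemma exp_ereal_SUP:
  fixes f :: "'b \<Rightarrow> real"
  shows "exp_ereal ((SUP y\<in>S. ereal (f y)) - ereal r) = (SUP y\<in>S. ennreal (exp (f y - r)))"
    (is "exp_ereal (?W - _) = ?T")
proof (rule antisym)
  show "?T \<le> exp_ereal (?W - ereal r)"
  proof (rule SUP_least)
    fix y assume "y \<in> S"
    then have "ereal (f y) \<le> ?W" by (rule SUP_upper)
    then show "ennreal (exp (f y - r)) \<le> exp_ereal (?W - ereal r)"
      by (cases ?W) (auto simp: exp_ereal_def)
  qed
next
  show "exp_ereal (?W - ereal r) \<le> ?T"
  proof (cases ?T)
    case top
    then show ?thesis by (simp only: top_greatest)
  next
    case (real t)
    show ?thesis
    proof (cases "S = {}")
      case True
      then show ?thesis by (simp add: exp_ereal_def bot_ereal_def)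
    next
      case False
      have le: "exp (f y - r) \<le> t" if "y \<in> S" for y
        using SUP_upper[OF that, of "\<lambda>y. ennreal (exp (f y - r))"] real by simp
      obtain y0 where y0: "y0 \<in> S" using False by blast
      \<comment> \<open>Positivity of \<open>t\<close> makes \<open>ln t\<close> available as a real
        upper bound, which rules out an infinite supremum on the left.\<close>
      have t: "t > 0" using le[OF y0] exp_gt_zero[of "f y0 - r"] by linarith
      have "?W \<le> ereal (ln t + r)"
      proof (rule SUP_least)
        fix y assume "y \<in> S"
        then have "f y - r \<le> ln t" using le t by (simp add: ln_ge_iff)
        then show "ereal (f y) \<le> ereal (ln t + r)" by simp
      qed
      moreover have "ereal (f y0) \<le> ?W" using y0 by (rule SUP_upper)
      ultimately obtain v where v: "?W = ereal v" "v \<le> ln t + r" by (cases ?W) auto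
      have "exp (v - r) \<le> exp (ln t)" using v(2) by simp
      then have "exp (v - r) \<le> t" using t by simp
      then show ?thesis using real v(1) by (simp add: exp_ereal_def)
    qed
  qed
qed

section \<open>The outer measure on an unstable leaf\<close>

text \<open>The normalising constant \<open>P\<close> is arbitrary, so that the stable leaf measures of a system, which
  involve its pressure, are unstable ones of the time-reversed system.\<close>

definition leaf_cost ::
    "(int \<Rightarrow> 'a) set \<Rightarrow> ((int \<Rightarrow> 'a) \<Rightarrow> real) \<Rightarrow> real \<Rightarrow> (int \<Rightarrow> 'a) \<Rightarrow> 'a list \<Rightarrow> ennreal" where
  "leaf_cost X \<phi> P x w = exp_ereal (weight_plus X \<phi> x w - ereal (real (length w) * P))"

definition leaf_premeasure ::
    "(int \<Rightarrow> 'a) set \<Rightarrow> ((int \<Rightarrow> 'a) \<Rightarrow> real) \<Rightarrow> real \<Rightarrow> (int \<Rightarrow> 'a) \<Rightarrow> nat \<Rightarrow> (int \<Rightarrow> 'a) set \<Rightarrow> ennreal" where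
  "leaf_premeasure X \<phi> P x N Z = (INF \<E>\<in>covers_plus X Z N. infsum (leaf_cost X \<phi> P x) \<E>)"

definition leaf_outer ::
    "(int \<Rightarrow> 'a) set \<Rightarrow> ((int \<Rightarrow> 'a) \<Rightarrow> real) \<Rightarrow> real \<Rightarrow> (int \<Rightarrow> 'a) \<Rightarrow> (int \<Rightarrow> 'a) set \<Rightarrow> ennreal" where
  "leaf_outer X \<phi> P x Z = (SUP N. leaf_premeasure X \<phi> P x N Z)"

lemma leaf_cost_eq_SUP:
  "leaf_cost X \<phi> P x w = (SUP y\<in>Wu_loc X x \<inter> cyl_plus X w.
     ennreal (exp (birkhoff_plus \<phi> (length w) y - real (length w) * P)))"
  unfolding leaf_cost_def weight_plus_def by (rule exp_ereal_SUP)

text \<open>Raising \<open>N\<close> leaves fewer admissible covers. Hence the limit in the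
  definition of \<open>mu\<close> exists and is a supremum.\<close>

lemma incseq_leaf_premeasure: "incseq (\<lambda>N. leaf_premeasure X \<phi> P x N Z)"
  unfolding incseq_def leaf_premeasure_def
  by (intro allI impI INF_superset_mono order_refl) (auto simp: covers_plus_def)

lemma lim_leaf_premeasure: "lim (\<lambda>N. leaf_premeasure X \<phi> P x N Z) = leaf_outer X \<phi> P x Z"
  unfolding leaf_outer_def by (intro limI LIMSEQ_SUP incseq_leaf_premeasure)

lemma mu_eq_leaf_outer: "mu X \<phi> = leaf_outer X \<phi> (pressure X \<phi>)"
  by (intro ext) (simp add: mu_def leaf_cost_def[abs_def] leaf_premeasure_def flip: lim_leaf_premeasure)

lemma Wu_loc_eq: "(\<And>k. k \<le> 0 \<Longrightarrow> y k = x k) \<Longrightarrow> Wu_loc X y = Wu_loc X x"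
  by (auto simp: Wu_loc_def)

text \<open>The base point enters only through its leaf. This permits moving it to a convenient
  point of the piece under consideration.\<close>

lemma leaf_outer_leaf_eq:
  assumes "\<And>k. k \<le> 0 \<Longrightarrow> y k = x k"
  shows "leaf_outer X \<phi> P y = leaf_outer X \<phi> P x"
  unfolding leaf_outer_def leaf_premeasure_def leaf_cost_def[abs_def] weight_plus_def
  using Wu_loc_eq[OF assms] by simp

lemma leaf_premeasure_le:
  "\<E> \<in> covers_plus X Z N \<Longrightarrow> leaf_premeasure X \<phi> P x N Z \<le> infsum (leaf_cost X \<phi> P x) \<E>"
  unfolding leaf_premeasure_def by (rule INF_lower)

lemma leaf_premeasure_le_outer: "leaf_premeasure X \<phi> P x N Z \<le> leaf_outer X \<phi> P x Z"
  unfolding leaf_outer_def by (rule SUP_upper) simp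

lemma leaf_outer_mono: "A \<subseteq> B \<Longrightarrow> leaf_outer X \<phi> P x A \<le> leaf_outer X \<phi> P x B"
  unfolding leaf_outer_def leaf_premeasure_def
  by (intro SUP_subset_mono INF_superset_mono order_refl) (auto simp: covers_plus_def)

lemma leaf_outer_empty [simp]: "leaf_outer X \<phi> P x {} = 0"
proof -
  have "leaf_premeasure X \<phi> P x N {} \<le> infsum (leaf_cost X \<phi> P x) {}" for N
    by (rule leaf_premeasure_le) (simp add: covers_plus_def)
  then show ?thesis by (simp add: leaf_outer_def)
qed

lemma leaf_premeasure_UN_le:
  fixes A :: "nat \<Rightarrow> (int \<Rightarrow> 'a) set"
  shows "leaf_premeasure X \<phi> P x N (\<Union>i. A i) \<le> (\<Sum>i. leaf_premeasure X \<phi> P x N (A i))"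
proof (rule ennreal_le_epsilon)
  fix e :: real assume top: "(\<Sum>i. leaf_premeasure X \<phi> P x N (A i)) < top" and e: "0 < e"
  have "\<exists>\<E>\<in>covers_plus X (A i) N. infsum (leaf_cost X \<phi> P x) \<E> \<le>
      leaf_premeasure X \<phi> P x N (A i) + ennreal (e * (1/2)^Suc i)" for i
  proof -
    have "leaf_premeasure X \<phi> P x N (A i) \<le> (\<Sum>i. leaf_premeasure X \<phi> P x N (A i))"
      using sum_le_suminf[of "\<lambda>i. leaf_premeasure X \<phi> P x N (A i)" "{i}"] by simp
    then have "leaf_premeasure X \<phi> P x N (A i) < top" using top by (rule le_less_trans)
    \<comment> \<open>Finiteness is what makes adding the error a strict increase; strictness then
      yields a cover below the new bound.\<close>
    then have "leaf_premeasure X \<phi> P x N (A i) < leaf_premeasure X \<phi> P x N (A i) + ennreal (e * (1/2)^Suc i)"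
      using e by (cases "leaf_premeasure X \<phi> P x N (A i)")
        (auto simp: ennreal_less_iff simp del: ennreal_plus power_Suc simp flip: ennreal_plus)
    then show ?thesis
      unfolding leaf_premeasure_def INF_less_iff[of _ "covers_plus X (A i) N"] by (auto intro: less_imp_le)
  qed
  then obtain \<E> where E: "\<And>i. \<E> i \<in> covers_plus X (A i) N"
    "\<And>i. infsum (leaf_cost X \<phi> P x) (\<E> i) \<le> leaf_premeasure X \<phi> P x N (A i) + ennreal (e * (1/2)^Suc i)"
    by metis
  have "(\<Union>i. \<E> i) \<in> covers_plus X (\<Union>i. A i) N"
    using E(1) unfolding covers_plus_def by blast
  then have "leaf_premeasure X \<phi> P x N (\<Union>i. A i) \<le> infsum (leaf_cost X \<phi> P x) (\<Union>i. \<E> i)"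
    by (rule leaf_premeasure_le)
  also have "\<dots> \<le> (\<Sum>i. infsum (leaf_cost X \<phi> P x) (\<E> i))" by (rule infsum_ennreal_UN_le)
  also have "\<dots> \<le> (\<Sum>i. leaf_premeasure X \<phi> P x N (A i) + ennreal (e * (1/2)^Suc i))"
    by (intro suminf_le E(2)) auto
  also have "\<dots> = (\<Sum>i. leaf_premeasure X \<phi> P x N (A i)) + (\<Sum>i. ennreal (e * (1/2)^Suc i))"
    by (intro suminf_add[symmetric]) auto
  also have "(\<Sum>i. ennreal (e * (1/2)^Suc i)) = ennreal e"
    using e sums_mult[OF power_half_series, of e] by (intro suminf_ennreal_eq) auto
  finally show "leaf_premeasure X \<phi> P x N (\<Union>i. A i) \<le> (\<Sum>i. leaf_premeasure X \<phi> P x N (A i)) + ennreal e" .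
qed

lemma leaf_outer_UN_le:
  fixes A :: "nat \<Rightarrow> (int \<Rightarrow> 'a) set"
  shows "leaf_outer X \<phi> P x (\<Union>i. A i) \<le> (\<Sum>i. leaf_outer X \<phi> P x (A i))"
  unfolding leaf_outer_def[of X \<phi> P x "\<Union>i. A i"]
  by (intro SUP_least order_trans[OF leaf_premeasure_UN_le] suminf_le leaf_premeasure_le_outer) auto

lemma leaf_outer_measure_space: "outer_measure_space (Pow D) (leaf_outer X \<phi> P x)"
  unfolding outer_measure_space_def positive_def increasing_def countably_subadditive_def
  by (auto intro: leaf_outer_mono leaf_outer_UN_le)

text \<open>On a leaf a cylinder of length greater than \<open>k\<close> lies either inside or outside a set described
  by the coordinates up to \<open>k\<close>; hence such sets split the outer measure.\<close>

lemma leaf_outer_split: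
  assumes T: "T \<subseteq> Wu_loc X x"
    and C: "\<And>y z. y \<in> Wu_loc X x \<Longrightarrow> z \<in> Wu_loc X x \<Longrightarrow> (\<forall>n\<le>int k. y n = z n) \<Longrightarrow> y \<in> C \<Longrightarrow> z \<in> C"
  shows "leaf_outer X \<phi> P x (T \<inter> C) + leaf_outer X \<phi> P x (T - C) \<le> leaf_outer X \<phi> P x T"
proof -
  let ?p = "leaf_premeasure X \<phi> P x"
  have split: "?p N (T \<inter> C) + ?p N (T - C) \<le> ?p N T" if N: "N > k" for N
    unfolding leaf_premeasure_def[of X \<phi> P x N T]
  proof (rule INF_greatest)
    fix \<E> assume E: "\<E> \<in> covers_plus X T N"
    define E1 where "E1 = {w \<in> \<E>. cyl_plus X w \<inter> (T \<inter> C) \<noteq> {}}"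
    define E2 where "E2 = {w \<in> \<E>. cyl_plus X w \<inter> (T - C) \<noteq> {}}"
    have "E1 \<in> covers_plus X (T \<inter> C) N" "E2 \<in> covers_plus X (T - C) N"
      using E unfolding E1_def E2_def covers_plus_def by blast+
    then have "?p N (T \<inter> C) + ?p N (T - C) \<le>
        infsum (leaf_cost X \<phi> P x) E1 + infsum (leaf_cost X \<phi> P x) E2"
      by (intro add_mono leaf_premeasure_le)
    also have "\<dots> = infsum (leaf_cost X \<phi> P x) (E1 \<union> E2)"
    proof (rule infsum_Un_disjoint[symmetric])
      show "E1 \<inter> E2 = {}"
      proof (rule ccontr)
        assume "E1 \<inter> E2 \<noteq> {}"
        then obtain w y z where w: "w \<in> \<E>" "y \<in> cyl_plus X w" "y \<in> T" "y \<in> C"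
          "z \<in> cyl_plus X w" "z \<in> T" "z \<notin> C" unfolding E1_def E2_def by blast
        have len: "k < length w" using E w(1) N by (auto simp: covers_plus_def)
        have "y n = z n" if "n \<le> int k" for n
        proof (cases "n \<le> 0")
          case True
          then show ?thesis using subsetD[OF T w(3)] subsetD[OF T w(6)] by (simp add: Wu_loc_def)
        next
          case False
          then have "nat n < length w" "int (nat n) = n" using that len by auto
          then show ?thesis using w(2,5) unfolding cyl_plus_def by (metis (mono_tags, lifting) mem_Collect_eq)
        qed
        then show False using C[of y z] w T by blast
      qed
    qed (auto intro: nonneg_summable_on_complete)
    also have "\<dots> \<le> infsum (leaf_cost X \<phi> P x) \<E>"
      by (rule infsum_ennreal_mono) (auto simp: E1_def E2_def)
    finally show "?p N (T \<inter> C) + ?p N (T - C) \<le> infsum (leaf_cost X \<phi> P x) \<E>" .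
  qed
  have "leaf_outer X \<phi> P x (T \<inter> C) + leaf_outer X \<phi> P x (T - C) = (SUP N. ?p N (T \<inter> C) + ?p N (T - C))"
    unfolding leaf_outer_def by (rule ennreal_SUP_add[symmetric]) (rule incseq_leaf_premeasure)+
  also have "\<dots> \<le> leaf_outer X \<phi> P x T"
  proof (rule SUP_least)
    fix N
    \<comment> \<open>The splitting holds only for covers by words longer than \<open>k\<close>;
      monotonicity in \<open>N\<close> passes to those.\<close>
    have "?p N (T \<inter> C) + ?p N (T - C) \<le> ?p (N + k + 1) (T \<inter> C) + ?p (N + k + 1) (T - C)"
      by (intro add_mono incseqD[OF incseq_leaf_premeasure]) auto
    also have "\<dots> \<le> ?p (N + k + 1) T" by (rule split) simp
    also have "\<dots> \<le> leaf_outer X \<phi> P x T" by (rule leaf_premeasure_le_outer)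
    finally show "?p N (T \<inter> C) + ?p N (T - C) \<le> leaf_outer X \<phi> P x T" .
  qed
  finally show ?thesis .
qed

text \<open>Caratheodory's theorem is applied on all subsets of \<open>D\<close>, so
  \<open>D\<close> may be any part of a leaf. Cylinders split the outer measure by
  \<open>leaf_outer_split\<close>, and the rest of the trace sigma-algebra is generated from
  them.\<close>

lemma measure_space_leaf_outer:
  fixes X :: "(int \<Rightarrow> 'a::finite) set"
  assumes D: "D \<subseteq> Wu_loc X x"
  shows "measure_space D (borel_subsets D) (leaf_outer X \<phi> P x)"
proof -
  let ?\<mu> = "leaf_outer X \<phi> P x" and ?L = "lambda_system D (Pow D) (leaf_outer X \<phi> P x)"
  have L: "measure_space D ?L ?\<mu>"
    by (rule sigma_algebra.caratheodory_lemma[OF sigma_algebra_Pow leaf_outer_measure_space])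
  then have sL: "sigma_algebra D ?L" by (simp add: measure_space_def)
  have cyl: "D \<inter> {y. \<forall>n. nat \<bar>n\<bar> \<le> k \<longrightarrow> y n = z n} \<in> ?L" (is "D \<inter> ?C \<in> _") for k z
  proof -
    have "?\<mu> (D \<inter> ?C \<inter> T) + ?\<mu> ((D - D \<inter> ?C) \<inter> T) = ?\<mu> T" if T: "T \<subseteq> D" for T
    proof (rule antisym)
      have "D \<inter> ?C \<inter> T = T \<inter> ?C" "(D - D \<inter> ?C) \<inter> T = T - ?C" using T by auto
      then show "?\<mu> (D \<inter> ?C \<inter> T) + ?\<mu> ((D - D \<inter> ?C) \<inter> T) \<le> ?\<mu> T"
        using leaf_outer_split[of T X x k ?C \<phi> P] T D by force
      have "subadditive (Pow D) ?\<mu>"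
        using leaf_outer_measure_space[of D X \<phi> P x]
          ring_of_sets.countably_subadditive_subadditive[of D "Pow D" ?\<mu>]
        by (simp add: outer_measure_space_def algebra.axioms(1) sigma_algebra.axioms(1) sigma_algebra_Pow)
      then have "?\<mu> ((D \<inter> ?C \<inter> T) \<union> ((D - D \<inter> ?C) \<inter> T)) \<le> ?\<mu> (D \<inter> ?C \<inter> T) + ?\<mu> ((D - D \<inter> ?C) \<inter> T)"
        unfolding subadditive_def by (elim ballE allE impE) auto
      moreover have "(D \<inter> ?C \<inter> T) \<union> ((D - D \<inter> ?C) \<inter> T) = T" using T by auto
      ultimately show "?\<mu> T \<le> ?\<mu> (D \<inter> ?C \<inter> T) + ?\<mu> ((D - D \<inter> ?C) \<inter> T)" by simp
    qed
    then show ?thesis unfolding lambda_system_def by auto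
  qed
  have openL: "D \<inter> U \<in> ?L" if U: "openin seq_topology U" for U
  proof (rule openin_seq_countable_Union[OF U])
    fix \<C> :: "(int \<Rightarrow> 'a) set set"
    assume C: "countable \<C>" "U = \<Union>\<C>"
      "\<And>C. C \<in> \<C> \<Longrightarrow> \<exists>x k. C = {y. \<forall>n. nat \<bar>n\<bar> \<le> k \<longrightarrow> y n = x n}"
    have "(\<Union>C\<in>\<C>. D \<inter> C) \<in> ?L"
      using C(1) by (rule sigma_algebra.countable_UN'[OF sL]) (use C(3) cyl in blast)
    moreover have "(\<Union>C\<in>\<C>. D \<inter> C) = D \<inter> U" unfolding C(2) by blast
    ultimately show "D \<inter> U \<in> ?L" by simp
  qed
  have "D \<inter> B \<in> ?L" if "B \<in> sigma_sets UNIV {U. openin seq_topology U}" for B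
    using that
  proof induction
    case (Basic U) then show ?case using openL by simp
  next
    case Empty
    then show ?case using sigma_algebra.sigma_sets_eq[OF sL] sigma_sets.Empty[of D ?L] by simp
  next
    case (Compl B)
    have "D - D \<inter> B \<in> ?L"
      using Compl.IH sL by (auto simp: sigma_algebra_iff2)
    moreover have "D - D \<inter> B = D \<inter> (UNIV - B)" by blast
    ultimately show ?case by simp
  next
    case (Union B)
    have "(\<Union>i. D \<inter> B i) \<in> ?L"
      using Union.IH by (intro sigma_algebra.countable_UN'[OF sL]) auto
    then show ?case by (simp only: Int_UN_distrib)
  qed
  then have "borel_subsets D \<subseteq> ?L"
    unfolding borel_subsets_eq sets_seq_borel by (auto simp: Int_commute)
  then show ?thesis by (rule measure_down[OF L sigma_algebra_borel_subsets])
qed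

section \<open>Scaling of the leaf measures under the shift\<close>

text \<open>For \<open>M > 0\<close> these are the basic neighbourhoods of \<open>x\<close> in its
  unstable leaf. For fixed \<open>n\<close> the \<open>n\<close>-th Birkhoff sum is almost constant
  on them once \<open>M\<close> is large.\<close>

definition past_cyl :: "(int \<Rightarrow> 'a) set \<Rightarrow> (int \<Rightarrow> 'a) \<Rightarrow> nat \<Rightarrow> (int \<Rightarrow> 'a) set" where
  "past_cyl X x M = {y \<in> X. \<forall>k<int M. y k = x k}"

lemma past_cyl_antimono: "M \<le> M' \<Longrightarrow> past_cyl X x M' \<subseteq> past_cyl X x M"
  by (auto simp: past_cyl_def)

lemma birkhoff_plus_add:
  "birkhoff_plus \<phi> (n + m) x = birkhoff_plus \<phi> n x + birkhoff_plus \<phi> m (shift (int n) x)"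
proof -
  have "{..<n + m} = {..<n} \<union> (\<lambda>k. k + n) ` {..<m}"
    by (auto simp: image_iff Bex_def) presburger
  then have "birkhoff_plus \<phi> (n + m) x = birkhoff_plus \<phi> n x + (\<Sum>k\<in>(\<lambda>k. k + n) ` {..<m}. \<phi> (shift (int k) x))"
    unfolding birkhoff_plus_def by (auto intro!: sum.union_disjoint)
  also have "(\<Sum>k\<in>(\<lambda>k. k + n) ` {..<m}. \<phi> (shift (int k) x)) = birkhoff_plus \<phi> m (shift (int n) x)"
    unfolding birkhoff_plus_def by (subst sum.reindex) (auto simp: inj_on_def add.commute)
  finally show ?thesis .
qed

lemma cyl_plus_append:
  "cyl_plus X (u @ v) = {y \<in> cyl_plus X u. \<forall>i<length v. y (int (length u + i)) = v ! i}"
proof -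
  have "(\<forall>i<length u + length v. y (int i) = (u @ v) ! i) \<longleftrightarrow>
      (\<forall>i<length u. y (int i) = u ! i) \<and> (\<forall>i<length v. y (int (length u + i)) = v ! i)" for y :: "int \<Rightarrow> 'a"
  proof -
    have "{..<length u + length v} = {..<length u} \<union> (\<lambda>i. length u + i) ` {..<length v}"
      using image_add_atLeastLessThan[of "length u" 0 "length v"] by (auto simp: atLeast0LessThan)
    then have "(\<forall>i<length u + length v. y (int i) = (u @ v) ! i) \<longleftrightarrow>
        (\<forall>i\<in>{..<length u} \<union> (\<lambda>i. length u + i) ` {..<length v}. y (int i) = (u @ v) ! i)"
      by blast
    then show ?thesis by (auto simp: ball_Un nth_append)
  qed
  then show ?thesis by (auto simp: cyl_plus_def)
qed

section \<open>Birkhoff sums of a continuous potential: boundedness and oscillation\<close>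

locale shift_potential =
  fixes X :: "(int \<Rightarrow> 'a::finite) set" and \<phi> :: "(int \<Rightarrow> 'a) \<Rightarrow> real"
  assumes shift_space: "shift_space X"
    and continuous: "continuous_map (subtopology seq_topology X) euclideanreal \<phi>"
begin

lemma shift_in: "x \<in> X \<Longrightarrow> shift k x \<in> X"
proof (induction k rule: int_induct[of _ 0])
  case base then show ?case by simp
next
  case (step1 i)
  have "shift 1 (shift i x) \<in> X"
    using step1 shift_space unfolding shift_space_def by (metis imageI)
  then show ?case by (simp add: add.commute)
next
  case (step2 i)
  then obtain z where z: "z \<in> X" "shift i x = shift 1 z"
    using shift_space unfolding shift_space_def by (metis imageE)
  have "shift (i - 1) x = shift (-1) (shift i x)" by simp
  also have "\<dots> = z" unfolding z(2) by simp
  finally show ?case using z by simp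
qed

lemma shift_in_iff [simp]: "shift k x \<in> X \<longleftrightarrow> x \<in> X"
  using shift_in[of x k] shift_in[of "shift k x" "- k"] by auto

lemma closedin_X: "closedin seq_topology X"
  using shift_space by (simp add: shift_space_def)

lemma potential_bounded: obtains B where "\<And>x. x \<in> X \<Longrightarrow> \<bar>\<phi> x\<bar> \<le> B"
proof -
  have "compactin seq_topology X" using closedin_compact_space[OF compact_space_seq_topology closedin_X] .
  then have "compactin (subtopology seq_topology X) X" by (simp add: compactin_subtopology)
  from image_compactin[OF this continuous] have "bounded (\<phi> ` X)"
    by (simp add: compact_imp_bounded)
  then show ?thesis using that by (auto simp: bounded_iff)
qed

lemma birkhoff_bounded: obtains B where "\<And>x. x \<in> X \<Longrightarrow> \<bar>birkhoff_plus \<phi> n x\<bar> \<le> B"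
proof -
  obtain B where B: "\<And>x. x \<in> X \<Longrightarrow> \<bar>\<phi> x\<bar> \<le> B" using potential_bounded by blast
  show ?thesis
  proof (rule that)
    fix x assume x: "x \<in> X"
    have "\<bar>birkhoff_plus \<phi> n x\<bar> \<le> (\<Sum>k<n. \<bar>\<phi> (shift (int k) x)\<bar>)"
      unfolding birkhoff_plus_def by (rule sum_abs)
    also have "\<dots> \<le> (\<Sum>k<n. B)" using B x by (intro sum_mono) simp
    finally show "\<bar>birkhoff_plus \<phi> n x\<bar> \<le> (\<Sum>k<n. B)" .
  qed
qed

lemma birkhoff_uniform:
  assumes e: "\<epsilon> > 0"
  shows "\<exists>M. \<forall>x\<in>X. \<forall>y\<in>X. (\<forall>k<int M. x k = y k) \<longrightarrow> \<bar>birkhoff_plus \<phi> n x - birkhoff_plus \<phi> n y\<bar> \<le> \<epsilon>"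
proof -
  \<comment> \<open>Each of the \<open>n\<close> summands gets an equal share of the error; adding 1
    keeps the share defined for \<open>n = 0\<close>.\<close>
  have "\<epsilon> / (real n + 1) > 0" using e by simp
  then obtain k :: nat where k: "\<And>x y. x \<in> X \<Longrightarrow> y \<in> X \<Longrightarrow> (\<forall>n. nat \<bar>n\<bar> \<le> k \<longrightarrow> x n = y n) \<Longrightarrow>
      \<bar>\<phi> x - \<phi> y\<bar> < \<epsilon> / (real n + 1)"
    by (rule continuous_map_seq_uniform[OF closedin_X continuous]) blast
  show ?thesis
  \<comment> \<open>The term with index \<open>i < n\<close> looks at the coordinates within
    \<open>k\<close> of \<open>i\<close>, all of which lie below \<open>n + k\<close>.\<close>
  proof (intro exI[of _ "n + k + 1"] ballI impI)
    fix x y assume xy: "x \<in> X" "y \<in> X" "\<forall>j<int (n + k + 1). x j = y j"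
    have "\<bar>birkhoff_plus \<phi> n x - birkhoff_plus \<phi> n y\<bar> \<le> (\<Sum>i<n. \<bar>\<phi> (shift (int i) x) - \<phi> (shift (int i) y)\<bar>)"
      unfolding birkhoff_plus_def sum_subtractf[symmetric] by (rule sum_abs)
    also have "\<dots> \<le> (\<Sum>i<n. \<epsilon> / (real n + 1))"
      using xy by (intro sum_mono less_imp_le k) (auto simp: shift_apply)
    also have "\<dots> \<le> \<epsilon>" using e by (simp add: field_simps)
    finally show "\<bar>birkhoff_plus \<phi> n x - birkhoff_plus \<phi> n y\<bar> \<le> \<epsilon>" .
  qed
qed

text \<open>Outside \<open>X\<close> nothing is known of \<phi>. Its preimages are therefore
  rewritten as preimages of an open set of the full shift with the correct trace on
  \<open>X\<close>, which is legitimate because \<open>f\<close> takes its values in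
  \<open>X\<close>.\<close>

lemma measurable_potential_shift:
  assumes f: "f \<in> measurable M seq_borel" and X: "\<And>\<omega>. \<omega> \<in> space M \<Longrightarrow> f \<omega> \<in> X"
  shows "(\<lambda>\<omega>. \<phi> (shift k (f \<omega>))) \<in> borel_measurable M"
proof (rule borel_measurableI)
  fix S :: "real set" assume "open S"
  then have "openin (subtopology seq_topology X) {x \<in> topspace (subtopology seq_topology X). \<phi> x \<in> S}"
    using continuous by (intro openin_continuous_map_preimage) auto
  then obtain V where V: "openin seq_topology V" "{x \<in> X. \<phi> x \<in> S} = V \<inter> X"
    unfolding openin_subtopology by auto
  have "(\<lambda>\<omega>. \<phi> (shift k (f \<omega>))) -` S \<inter> space M = (\<lambda>\<omega>. shift k (f \<omega>)) -` V \<inter> space M"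
  proof -
    have "\<phi> (shift k (f \<omega>)) \<in> S \<longleftrightarrow> shift k (f \<omega>) \<in> V" if "\<omega> \<in> space M" for \<omega>
      using V(2) shift_in[OF X[OF that]] by blast
    then show ?thesis by auto
  qed
  also have "\<dots> \<in> sets M"
    using f openin_seq_borel[OF V(1)] by measurable
  finally show "(\<lambda>\<omega>. \<phi> (shift k (f \<omega>))) -` S \<inter> space M \<in> sets M" .
qed

end

text \<open>The common principle behind both scaling inequalities. Passing to \<open>\<E>'\<close>
  discards words that miss the set; injectivity of \<open>f\<close> keeps the sum over the new cover
  equal to a sum over old words.\<close>

lemma leaf_premeasure_le_transport:
  assumes "\<And>\<E>. \<E> \<in> covers_plus X A N' \<Longrightarrow> \<exists>\<E>' f. \<E>' \<subseteq> \<E> \<and> inj_on f \<E>' \<and> f ` \<E>' \<in> covers_plus X' A' N \<and>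
     (\<forall>w\<in>\<E>'. leaf_cost X' \<phi>' P' x' (f w) \<le> K * leaf_cost X \<phi> P x w)"
    and K: "K > 0"
  shows "leaf_premeasure X' \<phi>' P' x' N A' \<le> ennreal K * leaf_premeasure X \<phi> P x N' A"
proof -
  \<comment> \<open>Dividing by \<open>K\<close> leaves a bare infimum over covers on the right, to
    which \<open>INF_greatest\<close> applies.\<close>
  have "ennreal (1/K) * leaf_premeasure X' \<phi>' P' x' N A' \<le> leaf_premeasure X \<phi> P x N' A"
    unfolding leaf_premeasure_def[of X \<phi> P x N' A]
  proof (rule INF_greatest)
    fix \<E> assume "\<E> \<in> covers_plus X A N'"
    from assms(1)[OF this] obtain \<E>' f where f: "\<E>' \<subseteq> \<E>" "inj_on f \<E>'" "f ` \<E>' \<in> covers_plus X' A' N"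
      "\<And>w. w \<in> \<E>' \<Longrightarrow> leaf_cost X' \<phi>' P' x' (f w) \<le> K * leaf_cost X \<phi> P x w" by blast
    have "leaf_premeasure X' \<phi>' P' x' N A' \<le> infsum (leaf_cost X' \<phi>' P' x') (f ` \<E>')"
      using f(3) by (rule leaf_premeasure_le)
    also have "\<dots> = infsum (leaf_cost X' \<phi>' P' x' \<circ> f) \<E>'" using f(2) by (rule infsum_reindex)
    also have "\<dots> \<le> infsum (\<lambda>w. K * leaf_cost X \<phi> P x w) \<E>"
      using f(1,4) by (intro infsum_ennreal_mono) auto
    also have "\<dots> = K * infsum (leaf_cost X \<phi> P x) \<E>" by (rule infsum_ennreal_cmult)
    finally have "ennreal (1/K) * leaf_premeasure X' \<phi>' P' x' N A' \<le>
        ennreal (1/K) * (K * infsum (leaf_cost X \<phi> P x) \<E>)" by (intro mult_left_mono) auto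
    also have "\<dots> = infsum (leaf_cost X \<phi> P x) \<E>"
      using K by (simp add: mult.assoc[symmetric] ennreal_mult'[symmetric])
    finally show "ennreal (1/K) * leaf_premeasure X' \<phi>' P' x' N A' \<le> infsum (leaf_cost X \<phi> P x) \<E>" .
  qed
  then have "ennreal K * (ennreal (1/K) * leaf_premeasure X' \<phi>' P' x' N A') \<le>
      ennreal K * leaf_premeasure X \<phi> P x N' A" by (intro mult_left_mono) auto
  then show ?thesis using K by (simp add: mult.assoc[symmetric] ennreal_mult'[symmetric])
qed

text \<open>The map \<open>g\<close> leads from the leaf whose cost is to be bounded back to the one
  that bounds it, so that each exponential on the left has a competitor in the supremum on the
  right.\<close>

lemma leaf_cost_le_transport:
  assumes "\<And>y. y \<in> Wu_loc X' x' \<inter> cyl_plus X' w' \<Longrightarrow>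
     g y \<in> Wu_loc X x \<inter> cyl_plus X w \<and>
     birkhoff_plus \<phi>' (length w') y - real (length w') * P' \<le>
       c + (birkhoff_plus \<phi> (length w) (g y) - real (length w) * P)"
  shows "leaf_cost X' \<phi>' P' x' w' \<le> exp c * leaf_cost X \<phi> P x w"
  unfolding leaf_cost_eq_SUP[of X' \<phi>' P' x' w']
proof (rule SUP_least)
  fix y assume y: "y \<in> Wu_loc X' x' \<inter> cyl_plus X' w'"
  have "ennreal (exp (birkhoff_plus \<phi>' (length w') y - real (length w') * P')) \<le>
      ennreal (exp c) * ennreal (exp (birkhoff_plus \<phi> (length w) (g y) - real (length w) * P))"
    using assms[OF y] by (simp add: ennreal_mult'[symmetric] exp_add[symmetric])
  also have "\<dots> \<le> exp c * leaf_cost X \<phi> P x w"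
    unfolding leaf_cost_eq_SUP using assms[OF y] by (intro mult_left_mono SUP_upper) auto
  finally show "ennreal (exp (birkhoff_plus \<phi>' (length w') y - real (length w') * P')) \<le> exp c * leaf_cost X \<phi> P x w" .
qed

context shift_potential
begin

text \<open>A cover of the shifted set becomes a cover of \<open>A\<close> by putting the first
  \<open>n\<close> letters of \<open>x\<close> in front of each word. The Birkhoff sum then splits
  into the part bounded by \<open>c\<close> and the one belonging to the old word. The condition
  \<open>n < M\<close> puts position \<open>n\<close>, which the shift moves to 0, among the
  coordinates shared with \<open>x\<close>.\<close>

lemma leaf_outer_le_shift:
  assumes x: "x \<in> X" and n: "n < M" and A: "A \<subseteq> past_cyl X x M"
    and c: "\<And>y. y \<in> past_cyl X x M \<Longrightarrow> birkhoff_plus \<phi> n y \<le> c"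
  shows "leaf_outer X \<phi> P x A \<le>
    exp (c - real n * P) * leaf_outer X \<phi> P (shift (int n) x) (shift (int n) ` A)"
  unfolding leaf_outer_def[of X \<phi> P x A]
proof (rule SUP_least)
  fix N
  define u where "u = map x (map int [0..<n])"
  have len_u: "length u = n" and u: "\<And>i. i < n \<Longrightarrow> u ! i = x (int i)" by (simp_all add: u_def)
  \<comment> \<open>Words of length at least \<open>N + M\<close> that meet the shifted set contain
    the letters of \<open>x\<close> at the positions \<open>n\<close> to \<open>M - 1\<close>. The
    part of the leaf in the prefixed cylinder thus lies in \<open>past_cyl X x M\<close>, where
    \<open>c\<close> is a bound.\<close>
  have "leaf_premeasure X \<phi> P x N A \<le>
      ennreal (exp (c - real n * P)) * leaf_premeasure X \<phi> P (shift (int n) x) (N + M) (shift (int n) ` A)"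
  proof (rule leaf_premeasure_le_transport)
    fix \<E> assume E: "\<E> \<in> covers_plus X (shift (int n) ` A) (N + M)"
    define E' where "E' = {v \<in> \<E>. cyl_plus X v \<inter> shift (int n) ` A \<noteq> {}}"
    have E': "\<exists>a\<in>A. shift (int n) a \<in> cyl_plus X v \<and> N + M \<le> length v" if "v \<in> E'" for v
      using that E by (auto simp: E'_def covers_plus_def)
    have cyl_app: "a \<in> cyl_plus X (u @ v)" if "a \<in> past_cyl X x M" "shift (int n) a \<in> cyl_plus X v" for a v
      unfolding cyl_plus_append
      using that n by (auto simp: cyl_plus_def past_cyl_def len_u u shift_def add.commute)
    have "(@) u ` E' \<in> covers_plus X A N"
      unfolding covers_plus_def
    proof (rule CollectI, rule conjI; rule subsetI)
      fix w assume "w \<in> (@) u ` E'"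
      then obtain v where v: "v \<in> E'" "w = u @ v" by blast
      from E'[OF v(1)] obtain a where a: "a \<in> A" "shift (int n) a \<in> cyl_plus X v" "N + M \<le> length v"
        by blast
      have "a \<in> cyl_plus X w" using cyl_app a(1,2) A v(2) by blast
      then show "w \<in> {w \<in> lang X. N \<le> length w}" using a v(2) by (auto simp: lang_def)
    next
      fix a assume a: "a \<in> A"
      then obtain v where v: "v \<in> \<E>" "shift (int n) a \<in> cyl_plus X v"
        using E unfolding covers_plus_def by blast
      then have "v \<in> E'" using a by (auto simp: E'_def)
      moreover have "a \<in> cyl_plus X (u @ v)" using cyl_app a A v(2) by blast
      ultimately show "a \<in> (\<Union>w\<in>(@) u ` E'. cyl_plus X w)" by blast
    qed
    moreover have "leaf_cost X \<phi> P x (u @ v) \<le> exp (c - real n * P) * leaf_cost X \<phi> P (shift (int n) x) v"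
      if v: "v \<in> E'" for v
    proof (rule leaf_cost_le_transport[where g = "shift (int n)"])
      fix y assume y: "y \<in> Wu_loc X x \<inter> cyl_plus X (u @ v)"
      from E'[OF v] obtain a where a: "a \<in> A" "shift (int n) a \<in> cyl_plus X v" "N + M \<le> length v" by blast
      then have aM: "a \<in> past_cyl X x M" using A by blast
      have y1: "y k = x k" if "k \<le> 0" for k using y that by (simp add: Wu_loc_def)
      have y2: "y (int i) = x (int i)" if "i < n" for i
        using y that unfolding cyl_plus_append by (simp add: cyl_plus_def len_u u)
      have y3: "y (int (n + i)) = v ! i" if "i < length v" for i
        using y that by (simp add: cyl_plus_append len_u)
      have a3: "a (int (n + i)) = v ! i" if "i < length v" for i
        using a(2) that by (simp add: cyl_plus_def shift_def add.commute)
      \<comment> \<open>Below \<open>n\<close> the prefix fixes \<open>y\<close>; from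
        \<open>n\<close> on, \<open>y\<close> and \<open>a\<close> carry the same word
        \<open>v\<close>, and \<open>a\<close> agrees with \<open>x\<close> up to
        \<open>M\<close>.\<close>
      have yx: "y k = x k" if k: "k < int M" for k
      proof (cases "k < int n")
        case True
        then show ?thesis using y1[of k] y2[of "nat k"] by (cases "k \<le> 0") auto
      next
        case False
        define i where "i = nat (k - int n)"
        have i: "k = int (n + i)" "i < length v" using False k a(3) by (auto simp: i_def)
        show ?thesis using y3[OF i(2)] a3[OF i(2)] aM k unfolding i(1) past_cyl_def by simp
      qed
      have yX: "y \<in> X" using y by (simp add: Wu_loc_def)
      then have "y \<in> past_cyl X x M" using yx by (simp add: past_cyl_def)
      then have le: "birkhoff_plus \<phi> n y \<le> c" by (rule c)
      have "shift (int n) y \<in> Wu_loc X (shift (int n) x)"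
        using yX yx n by (simp add: Wu_loc_def shift_apply)
      moreover have "shift (int n) y \<in> cyl_plus X v"
        using yX y3 by (simp add: cyl_plus_def shift_apply add.commute)
      ultimately show "shift (int n) y \<in> Wu_loc X (shift (int n) x) \<inter> cyl_plus X v \<and>
          birkhoff_plus \<phi> (length (u @ v)) y - real (length (u @ v)) * P \<le>
          c - real n * P + (birkhoff_plus \<phi> (length v) (shift (int n) y) - real (length v) * P)"
        using le by (simp add: len_u birkhoff_plus_add algebra_simps)
    qed
    ultimately show "\<exists>\<E>' f. \<E>' \<subseteq> \<E> \<and> inj_on f \<E>' \<and> f ` \<E>' \<in> covers_plus X A N \<and>
        (\<forall>w\<in>\<E>'. leaf_cost X \<phi> P x (f w) \<le> ennreal (exp (c - real n * P)) * leaf_cost X \<phi> P (shift (int n) x) w)"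
      by (intro exI[of _ E'] exI[of _ "(@) u"]) (auto simp: E'_def inj_on_def)
  qed simp
  also have "\<dots> \<le> exp (c - real n * P) * leaf_outer X \<phi> P (shift (int n) x) (shift (int n) ` A)"
    by (intro mult_left_mono leaf_premeasure_le_outer) simp
  finally show "leaf_premeasure X \<phi> P x N A \<le>
      exp (c - real n * P) * leaf_outer X \<phi> P (shift (int n) x) (shift (int n) ` A)" .
qed

text \<open>Here the first \<open>n\<close> letters are deleted. Two words could collide, but all
  words meeting \<open>A\<close> begin with the same letters of \<open>x\<close>, so deletion is
  injective on them.\<close>

lemma leaf_outer_shift_le:
  assumes x: "x \<in> X" and n: "n < M" and A: "A \<subseteq> past_cyl X x M"
    and c: "\<And>y. y \<in> past_cyl X x M \<Longrightarrow> c \<le> birkhoff_plus \<phi> n y"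
  shows "leaf_outer X \<phi> P (shift (int n) x) (shift (int n) ` A) \<le>
    exp (real n * P - c) * leaf_outer X \<phi> P x A"
  unfolding leaf_outer_def[of X \<phi> P "shift (int n) x"]
proof (rule SUP_least)
  fix N
  have "leaf_premeasure X \<phi> P (shift (int n) x) N (shift (int n) ` A) \<le>
      ennreal (exp (real n * P - c)) * leaf_premeasure X \<phi> P x (N + M) A"
  proof (rule leaf_premeasure_le_transport)
    fix \<E> assume E: "\<E> \<in> covers_plus X A (N + M)"
    define E' where "E' = {w \<in> \<E>. cyl_plus X w \<inter> A \<noteq> {}}"
    have E': "\<exists>a\<in>A. a \<in> cyl_plus X w \<and> N + M \<le> length w" if "w \<in> E'" for w
      using that E by (auto simp: E'_def covers_plus_def)
    have coord: "w ! i = x (int i)" if "w \<in> E'" "i < M" for w i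
    proof -
      from E'[OF that(1)] obtain a where a: "a \<in> past_cyl X x M" "a \<in> cyl_plus X w" "N + M \<le> length w"
        using A by blast
      then have "i < length w" using that(2) by simp
      then have "a (int i) = w ! i" using a(2) unfolding cyl_plus_def by blast
      moreover have "a (int i) = x (int i)" using a(1) that(2) by (simp add: past_cyl_def)
      ultimately show ?thesis by simp
    qed
    have cyl_drop: "shift (int n) a \<in> cyl_plus X (drop n w)" if "a \<in> cyl_plus X w" "n \<le> length w" for a w
      using that by (auto simp: cyl_plus_def shift_apply add.commute simp flip: of_nat_add)
    have inj: "inj_on (drop n) E'"
    proof (rule inj_onI)
      fix v w assume vw: "v \<in> E'" "w \<in> E'" "drop n v = drop n w"
      have "take n v = take n w"
      proof (rule nth_equalityI)
        show "length (take n v) = length (take n w)" using E'[OF vw(1)] E'[OF vw(2)] n by auto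
        fix i assume "i < length (take n v)"
        then show "take n v ! i = take n w ! i" using coord vw n by simp
      qed
      then show "v = w" using vw(3) by (metis append_take_drop_id)
    qed
    have "drop n ` E' \<in> covers_plus X (shift (int n) ` A) N"
      unfolding covers_plus_def
    proof (rule CollectI, rule conjI; rule subsetI)
      fix w assume "w \<in> drop n ` E'"
      then obtain v where v: "v \<in> E'" "w = drop n v" by blast
      from E'[OF v(1)] obtain a where a: "a \<in> cyl_plus X v" "N + M \<le> length v" by blast
      have "shift (int n) a \<in> cyl_plus X w" unfolding v(2) using a n by (intro cyl_drop) auto
      then show "w \<in> {w \<in> lang X. N \<le> length w}" using a n v(2) by (auto simp: lang_def)
    next
      fix b assume "b \<in> shift (int n) ` A"
      then obtain a where a: "a \<in> A" "b = shift (int n) a" by blast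
      then obtain w where w: "w \<in> \<E>" "a \<in> cyl_plus X w" "N + M \<le> length w"
        using E unfolding covers_plus_def by blast
      then have "w \<in> E'" using a by (auto simp: E'_def)
      moreover have "b \<in> cyl_plus X (drop n w)" unfolding a(2) using w n by (intro cyl_drop) auto
      ultimately show "b \<in> (\<Union>w\<in>drop n ` E'. cyl_plus X w)" by blast
    qed
    moreover have "leaf_cost X \<phi> P (shift (int n) x) (drop n w) \<le> exp (real n * P - c) * leaf_cost X \<phi> P x w"
      if w: "w \<in> E'" for w
    proof (rule leaf_cost_le_transport[where g = "shift (- int n)"])
      fix y assume y: "y \<in> Wu_loc X (shift (int n) x) \<inter> cyl_plus X (drop n w)"
      have len: "N + M \<le> length w" using E'[OF w] by blast
      have yX: "y \<in> X" using y by (simp add: Wu_loc_def)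
      \<comment> \<open>A point of the leaf of \<open>shift (int n) x\<close> agrees, after shifting
        back, with \<open>x\<close> up to position \<open>n\<close>; the letters of \<open>w\<close>
        carry this agreement on up to \<open>M\<close>.\<close>
      let ?z = "shift (- int n) y"
      have z1: "?z k = x k" if "k \<le> int n" for k
        using y that by (simp add: Wu_loc_def shift_apply)
      have z2: "?z (int i) = w ! i" if i: "i < length w" for i
      proof (cases "i < n")
        case True then show ?thesis using z1 coord[OF w] n by simp
      next
        case False
        then have j: "i - n < length (drop n w)" "drop n w ! (i - n) = w ! i" "int i + - int n = int (i - n)"
          using i by auto
        have "y (int (i - n)) = drop n w ! (i - n)" using y j(1) unfolding cyl_plus_def by blast
        then show ?thesis unfolding shift_apply j(2,3) .
      qed
      have zx: "?z k = x k" if k: "k < int M" for k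
      proof (cases "k \<le> 0")
        case True then show ?thesis using z1 by simp
      next
        case False
        then show ?thesis using z2[of "nat k"] coord[OF w, of "nat k"] k len by simp
      qed
      have "?z \<in> past_cyl X x M" using zx yX by (simp add: past_cyl_def)
      then have le: "c \<le> birkhoff_plus \<phi> n ?z" by (rule c)
      have "?z \<in> Wu_loc X x \<inter> cyl_plus X w"
        using z1 z2 yX by (simp add: Wu_loc_def cyl_plus_def)
      moreover have "birkhoff_plus \<phi> (length w) ?z = birkhoff_plus \<phi> n ?z + birkhoff_plus \<phi> (length w - n) y"
        using birkhoff_plus_add[of \<phi> n "length w - n" ?z] len n by simp
      moreover have "real (length w - n) = real (length w) - real n" using len n by simp
      ultimately show "?z \<in> Wu_loc X x \<inter> cyl_plus X w \<and>
          birkhoff_plus \<phi> (length (drop n w)) y - real (length (drop n w)) * P \<le>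
          real n * P - c + (birkhoff_plus \<phi> (length w) ?z - real (length w) * P)"
        using le by (simp add: algebra_simps)
    qed
    ultimately show "\<exists>\<E>' f. \<E>' \<subseteq> \<E> \<and> inj_on f \<E>' \<and> f ` \<E>' \<in> covers_plus X (shift (int n) ` A) N \<and>
        (\<forall>w\<in>\<E>'. leaf_cost X \<phi> P (shift (int n) x) (f w) \<le> ennreal (exp (real n * P - c)) * leaf_cost X \<phi> P x w)"
      using inj by (intro exI[of _ E'] exI[of _ "drop n"]) (auto simp: E'_def)
  qed simp
  also have "\<dots> \<le> exp (real n * P - c) * leaf_outer X \<phi> P x A"
    by (intro mult_left_mono leaf_premeasure_le_outer) simp
  finally show "leaf_premeasure X \<phi> P (shift (int n) x) N (shift (int n) ` A) \<le>
      exp (real n * P - c) * leaf_outer X \<phi> P x A" .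
qed

end

section \<open>Families of rectangles with uniformly continuous holonomies\<close>

lemma ennreal_le_exp_epsilon:
  fixes x y :: ennreal
  assumes le: "\<And>\<epsilon>::real. \<epsilon> > 0 \<Longrightarrow> x \<le> ennreal (exp \<epsilon>) * y"
  shows "x \<le> y"
proof (cases y)
  case top
  then show ?thesis by simp
next
  case (real r)
  have le': "x \<le> ennreal (exp \<epsilon> * r)" if "\<epsilon> > 0" for \<epsilon>
    using le[OF that] real by (simp add: ennreal_mult')
  obtain s where s: "x = ennreal s" "s \<ge> 0"
    using le'[of 1] by (cases x) (auto simp: top_unique)
  have "z * s \<le> r" if z: "0 < z" "z < 1" for z
  proof -
    have "s \<le> exp (- ln z) * r" using le'[of "- ln z"] z real s by simp
    then show ?thesis using z by (simp add: exp_minus field_simps)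
  qed
  then have "s \<le> r" using field_le_mult_one_interval by blast
  then show ?thesis using s real by (simp add: ennreal_leI)
qed

text \<open>Reduces a comparison of two measures to pieces so small that the density is nearly
  constant on them.\<close>

lemma emeasure_le_finite_partition:
  assumes sets: "sets N1 = sets N2" and A: "A \<in> sets N2"
    and I: "finite I" "\<And>p. p \<in> I \<Longrightarrow> p \<in> sets N2" "disjoint I" "A \<subseteq> \<Union>I"
    and le: "\<And>p. p \<in> I \<Longrightarrow> emeasure N1 (A \<inter> p) \<le> K * emeasure N2 (A \<inter> p)"
  shows "emeasure N1 A \<le> K * emeasure N2 A"
proof -
  have disj: "disjoint_family_on (\<lambda>p. A \<inter> p) I"
    using I(3) by (auto simp: disjoint_family_on_def disjoint_def)
  have AI: "(\<Union>p\<in>I. A \<inter> p) = A" using I(4) by auto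
  have sub: "(\<lambda>p. A \<inter> p) ` I \<subseteq> sets N2" using A I(2) by auto
  have "emeasure N1 A = (\<Sum>p\<in>I. emeasure N1 (A \<inter> p))"
    using sum_emeasure[of "\<lambda>p. A \<inter> p" I N1, unfolded AI sets, OF sub disj I(1)] by simp
  also have "\<dots> \<le> (\<Sum>p\<in>I. K * emeasure N2 (A \<inter> p))" by (intro sum_mono le)
  also have "\<dots> = K * emeasure N2 A"
    using sum_emeasure[of "\<lambda>p. A \<inter> p" I N2, unfolded AI, OF sub disj I(1)]
    by (simp add: sum_distrib_left[symmetric])
  finally show ?thesis .
qed

section \<open>Leaf measures on rectangles and Borel sets under the bracket\<close>

definition leaf_measure ::
    "(int \<Rightarrow> 'a) set \<Rightarrow> ((int \<Rightarrow> 'a) \<Rightarrow> real) \<Rightarrow> real \<Rightarrow> (int \<Rightarrow> 'a) \<Rightarrow> (int \<Rightarrow> 'a) set \<Rightarrow> (int \<Rightarrow> 'a) measure" where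
  "leaf_measure X \<phi> P x D = measure_of D (borel_subsets D) (leaf_outer X \<phi> P x)"

lemma sets_leaf_measure [simp]: "sets (leaf_measure X \<phi> P x D) = borel_subsets D"
  by (simp add: leaf_measure_def)

lemma space_leaf_measure [simp]: "space (leaf_measure X \<phi> P x D) = D"
  by (simp add: leaf_measure_def)

lemma emeasure_leaf_measure:
  fixes X :: "(int \<Rightarrow> 'a::finite) set"
  assumes "D \<subseteq> Wu_loc X x" "A \<in> borel_subsets D"
  shows "emeasure (leaf_measure X \<phi> P x D) A = leaf_outer X \<phi> P x A"
  unfolding leaf_measure_def
  by (intro emeasure_measure_of_borel_subsets measure_space_leaf_outer assms)

lemma measurable_id_seq_borel:
  assumes "sets M = borel_subsets D" shows "(\<lambda>x. x) \<in> measurable M seq_borel"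
proof -
  have "(\<lambda>x. x) \<in> measurable (restrict_space seq_borel D) seq_borel"
    by (intro measurable_restrict_space1) simp
  then show ?thesis
    by (subst measurable_cong_sets[OF assms[folded sets_restrict_seq_borel] refl])
qed

lemma measurable_borel_subsetsI:
  assumes "f \<in> measurable M seq_borel" "\<And>\<omega>. \<omega> \<in> space M \<Longrightarrow> f \<omega> \<in> D" "sets N = borel_subsets D"
  shows "f \<in> measurable M N"
proof -
  have "f \<in> measurable M (restrict_space seq_borel D)"
    using assms(1,2) by (intro measurable_restrict_space2) auto
  then show ?thesis
    by (subst measurable_cong_sets[OF refl assms(3)[folded sets_restrict_seq_borel]])
qed

text \<open>This is why the holonomies between two leaves are inverse to each other.\<close>

lemma bracket_leaf: "x \<in> Wu_loc X a \<Longrightarrow> bracket a (bracket b x) = x"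
  by (auto simp: bracket_def Wu_loc_def)

lemma bracket_past_eq: "(\<And>k. k \<le> 0 \<Longrightarrow> x k = b k) \<Longrightarrow> bracket x = bracket b"
  by (auto simp: bracket_def fun_eq_iff)

text \<open>The image under one holonomy is the preimage under the inverse one, and preimages under
  measurable maps are measurable.\<close>

lemma bracket_image_borel:
  fixes X :: "(int \<Rightarrow> 'a::finite) set"
  assumes R: "rectangle X R" and ab: "a \<in> R" "b \<in> R" and A: "A \<in> borel_subsets (Wu_rect X R a)"
  shows "bracket b ` A \<in> borel_subsets (Wu_rect X R b)"
proof -
  obtain B where B: "B \<in> sets seq_borel" "A = B \<inter> Wu_rect X R a" using A by (auto simp: borel_subsets_eq)
  have [measurable]: "B \<in> sets seq_borel" by (rule B)
  have br: "bracket x y \<in> Wu_rect X R x" if "x \<in> R" "y \<in> R" for x y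
    using R that by (auto simp: rectangle_def Wu_rect_def Wu_loc_def bracket_def subset_iff)
  have "bracket b ` A = {y \<in> UNIV. bracket a y \<in> B} \<inter> Wu_rect X R b"
  proof (intro equalityI subsetI)
    fix y assume "y \<in> bracket b ` A"
    then obtain x where x: "x \<in> B" "x \<in> Wu_rect X R a" "y = bracket b x" unfolding B(2) by blast
    then have "bracket a y = x" using bracket_leaf[of x X a b] by (simp add: Wu_rect_def)
    with x br[of b x] ab show "y \<in> {y \<in> UNIV. bracket a y \<in> B} \<inter> Wu_rect X R b" by (simp add: Wu_rect_def)
  next
    fix y assume y: "y \<in> {y \<in> UNIV. bracket a y \<in> B} \<inter> Wu_rect X R b"
    then have "bracket a y \<in> A" unfolding B(2) using br[of a y] ab by (simp add: Wu_rect_def)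
    moreover have "y = bracket b (bracket a y)" using y bracket_leaf[of y X b a] by (simp add: Wu_rect_def)
    ultimately show "y \<in> bracket b ` A" by blast
  qed
  moreover have "(\<lambda>y. bracket a y) -` B \<inter> space seq_borel \<in> sets seq_borel"
    by (rule measurable_sets[OF _ B(1)]) measurable
  then have "{y \<in> UNIV. bracket a y \<in> B} \<in> sets seq_borel" by (simp add: vimage_def)
  ultimately show ?thesis by (simp add: sets_into_borel_subsets)
qed

lemma Int_past_cyl_borel:
  fixes X :: "(int \<Rightarrow> 'a::finite) set"
  assumes "A \<in> borel_subsets D" "D \<subseteq> X"
  shows "A \<inter> past_cyl X a M \<in> borel_subsets D"
proof -
  obtain B where B: "B \<in> sets seq_borel" "A = B \<inter> D" using assms(1) by (auto simp: borel_subsets_eq)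
  have "{y \<in> space seq_borel. y k = a k} \<in> sets seq_borel" for k
    using measurable_sets[OF measurable_seq_coord[of k], of "{a k}"] by (simp add: vimage_def)
  then have "{y \<in> space seq_borel. \<forall>k\<in>{..<int M}. y k = a k} \<in> sets seq_borel"
    by (intro sets.sets_Collect_countable_Ball) auto
  then have "(B \<inter> {y. \<forall>k<int M. y k = a k}) \<inter> D \<in> borel_subsets D"
    using B(1) by (intro sets_into_borel_subsets sets.Int) (simp_all add: lessThan_def)
  also have "(B \<inter> {y. \<forall>k<int M. y k = a k}) \<inter> D = A \<inter> past_cyl X a M"
    using assms(2) unfolding B(2) past_cyl_def by blast
  finally show ?thesis .
qed

text \<open>Collects what is used of one kind of leaves, so that it can be instantiated for a system
  and for its time reversal. The holonomy bound is stated in one direction, since exchanging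
  \<open>y\<close> and \<open>z\<close> gives the other. The assumption \<open>semifinite\<close> is
  the form in which sigma-finiteness of the leaf measures enters here.\<close>

locale holonomy_family = shift_potential +
  fixes P :: real and \<R> :: "(int \<Rightarrow> 'a::finite) set set"
  assumes rect: "R \<in> \<R> \<Longrightarrow> rectangle X R"
    and invariant: "\<lbrakk>R \<in> \<R>; w \<in> lang X; length w = n + 1; R \<inter> cyl_plus X w \<noteq> {}\<rbrakk>
      \<Longrightarrow> shift (int n) ` (R \<inter> cyl_plus X w) \<in> \<R>"
    and holonomy: "\<epsilon> > 0 \<Longrightarrow> \<exists>\<delta>::real. \<delta> > 0 \<and> (\<forall>R\<in>\<R>. \<forall>y\<in>R. \<forall>z\<in>R. seq_dist y z < \<delta> \<longrightarrow>
      (\<forall>Y\<in>borel_subsets (Wu_rect X R y).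
         leaf_outer X \<phi> P y Y \<le> ennreal (exp \<epsilon>) * leaf_outer X \<phi> P z (bracket z ` Y)))"
    and positive: "R \<in> \<R> \<Longrightarrow> \<exists>x\<in>R. leaf_outer X \<phi> P x (Wu_rect X R x) > 0"
    and semifinite: "\<lbrakk>R \<in> \<R>; x \<in> R; A \<in> borel_subsets (Wu_rect X R x); leaf_outer X \<phi> P x A > 0\<rbrakk>
      \<Longrightarrow> \<exists>B\<in>borel_subsets (Wu_rect X R x). B \<subseteq> A \<and> 0 < leaf_outer X \<phi> P x B \<and> leaf_outer X \<phi> P x B < \<infinity>"
begin

abbreviation m :: "(int \<Rightarrow> 'a) \<Rightarrow> (int \<Rightarrow> 'a) set \<Rightarrow> ennreal" where
  "m \<equiv> leaf_outer X \<phi> P"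

abbreviation S :: "nat \<Rightarrow> (int \<Rightarrow> 'a) \<Rightarrow> real" where
  "S \<equiv> birkhoff_plus \<phi>"

lemma rect_in_X: "R \<in> \<R> \<Longrightarrow> x \<in> R \<Longrightarrow> x \<in> X"
  using rect unfolding rectangle_def by blast

lemma bracket_in_rect: "R \<in> \<R> \<Longrightarrow> x \<in> R \<Longrightarrow> y \<in> R \<Longrightarrow> bracket x y \<in> R"
  using rect unfolding rectangle_def by blast

lemma rect_zero_eq: "R \<in> \<R> \<Longrightarrow> x \<in> R \<Longrightarrow> y \<in> R \<Longrightarrow> x 0 = y 0"
  using rect unfolding rectangle_def by blast

lemma Wu_rect_subset: "Wu_rect X R a \<subseteq> Wu_loc X a" "Wu_rect X R a \<subseteq> X" "Wu_rect X R a \<subseteq> R"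
  by (auto simp: Wu_rect_def Wu_loc_def)

text \<open>The \<open>n + 1\<close> fixed letters include position \<open>n\<close>, which becomes
  position 0 after the shift, where the points of a rectangle have to agree. The letters before it
  become a common past, which makes points on a common stable leaf close.\<close>

lemma shifted_rect:
  fixes n :: nat
  assumes R: "R \<in> \<R>" and a: "a \<in> R"
  defines "Q \<equiv> {y \<in> R. \<forall>k. 0 \<le> k \<and> k \<le> int n \<longrightarrow> y k = a k}"
  shows "shift (int n) ` Q \<in> \<R>"
proof -
  define w where "w = map a (map int [0..<n + 1])"
  have w: "cyl_plus X w = {y \<in> X. \<forall>k. 0 \<le> k \<and> k \<le> int n \<longrightarrow> y k = a k}"
  proof -
    have "(\<forall>i<n + 1. y (int i) = a (int i)) \<longleftrightarrow> (\<forall>k. 0 \<le> k \<and> k \<le> int n \<longrightarrow> y k = a k)" (is "?L \<longleftrightarrow> ?R") for y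
    proof
      assume ?L
      then show ?R by (metis Suc_eq_plus1 less_Suc_eq_le nonneg_int_cases of_nat_le_iff)
    qed auto
    then show ?thesis by (auto simp: cyl_plus_def w_def simp del: upt_Suc)
  qed
  have "a \<in> R \<inter> cyl_plus X w" using a rect_in_X[OF R a] unfolding w by simp
  moreover from this have "w \<in> lang X" by (auto simp: lang_def)
  moreover have "R \<inter> cyl_plus X w = Q" unfolding w Q_def using rect_in_X[OF R] by auto
  ultimately show ?thesis using invariant[OF R, of w n] by (auto simp: w_def)
qed

lemma bracket_image_past_cyl:
  assumes "R \<in> \<R>" "b \<in> R" "A \<subseteq> Wu_rect X R a" "A \<subseteq> past_cyl X a M" "b \<in> Ws_loc X a"
  shows "bracket b ` A \<subseteq> past_cyl X b M"
proof
  fix y assume "y \<in> bracket b ` A"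
  then obtain x where x: "x \<in> A" "y = bracket b x" by blast
  have "x \<in> R" using x(1) assms(3) by (auto simp: Wu_rect_def)
  then have "y \<in> X" unfolding x(2) using assms(1,2) bracket_in_rect rect_in_X by blast
  moreover have "y k = b k" if "k < int M" for k
    using assms(4,5) x that by (auto simp: past_cyl_def Ws_loc_def bracket_def subset_iff)
  ultimately show "y \<in> past_cyl X b M" by (simp add: past_cyl_def)
qed

text \<open>Conjugating a holonomy by \<open>n\<close> shifts brings the two leaves close together, at the cost of the
  difference of the Birkhoff sums.\<close>

lemma holonomy_le:
  assumes e: "\<epsilon> > 0"
  shows "\<exists>n0. \<forall>n\<ge>n0. \<exists>M0. \<forall>M\<ge>M0. \<forall>R\<in>\<R>. \<forall>a\<in>R. \<forall>b\<in>R. b \<in> Ws_loc X a \<longrightarrow>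
    (\<forall>A\<in>borel_subsets (Wu_rect X R a). A \<subseteq> past_cyl X a M \<longrightarrow>
       m a A \<le> ennreal (exp (S n a - S n b + \<epsilon>)) * m b (bracket b ` A))"
proof -
  have e3: "\<epsilon> / 3 > 0" using e by simp
  from holonomy[OF e3] obtain \<delta> where \<delta>0: "\<delta> > 0" and *: "\<forall>R\<in>\<R>. \<forall>y\<in>R. \<forall>z\<in>R. seq_dist y z < \<delta> \<longrightarrow>
      (\<forall>Y\<in>borel_subsets (Wu_rect X R y). m y Y \<le> ennreal (exp (\<epsilon> / 3)) * m z (bracket z ` Y))"
    by (elim exE conjE)
  note \<delta> = \<delta>0 *[rule_format]
  \<comment> \<open>Depends on \<epsilon> alone, through \<delta>. This is the source of the
    uniformity in the rectangle and its points.\<close>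
  obtain n0 :: nat where n0: "(1/2)^n0 < \<delta>" using real_arch_pow_inv[OF \<delta>(1), of "1/2"] by auto
  show ?thesis
  proof (rule exI[of _ n0], intro allI impI)
    fix n assume n: "n0 \<le> n"
    obtain M1 where M1: "\<And>x y. x \<in> X \<Longrightarrow> y \<in> X \<Longrightarrow> (\<forall>k<int M1. x k = y k) \<Longrightarrow> \<bar>S n x - S n y\<bar> \<le> \<epsilon> / 3"
      using birkhoff_uniform[OF e3, of n] by blast
    show "\<exists>M0. \<forall>M\<ge>M0. \<forall>R\<in>\<R>. \<forall>a\<in>R. \<forall>b\<in>R. b \<in> Ws_loc X a \<longrightarrow>
      (\<forall>A\<in>borel_subsets (Wu_rect X R a). A \<subseteq> past_cyl X a M \<longrightarrow>
         m a A \<le> ennreal (exp (S n a - S n b + \<epsilon>)) * m b (bracket b ` A))"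
    \<comment> \<open>\<open>M1\<close> controls the oscillation of \<open>S n\<close>, and
      \<open>n + 1\<close> makes the points of \<open>A\<close> share with \<open>a\<close> the
      letters 0 to \<open>n\<close> that define \<open>Q\<close>.\<close>
    proof (intro exI[of _ "M1 + n + 1"] allI ballI impI)
      fix M R a b A
      assume M: "M1 + n + 1 \<le> M" and R: "R \<in> \<R>" and a: "a \<in> R" and b: "b \<in> R"
        and bWs: "b \<in> Ws_loc X a" and A: "A \<in> borel_subsets (Wu_rect X R a)" and AM: "A \<subseteq> past_cyl X a M"
      from bWs have ab: "\<forall>k\<ge>0. b k = a k" by (simp add: Ws_loc_def)
      let ?s = "shift (int n)"
      define Q where "Q = {y \<in> R. \<forall>k. 0 \<le> k \<and> k \<le> int n \<longrightarrow> y k = a k}"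
      have Q: "?s ` Q \<in> \<R>" unfolding Q_def by (rule shifted_rect[OF R a])
      have aX: "a \<in> X" "b \<in> X" using R a b rect_in_X by auto
      have abQ: "?s a \<in> ?s ` Q" "?s b \<in> ?s ` Q" using a b ab by (auto simp: Q_def)
      have "seq_dist (?s a) (?s b) < (1/2)^n"
        unfolding seq_dist_less_iff using ab by (auto simp: shift_apply)
      moreover have "(1/2 :: real)^n \<le> (1/2)^n0" using n by (intro power_decreasing) auto
      ultimately have dist: "seq_dist (?s a) (?s b) < \<delta>" using n0 by linarith
      obtain B where B: "B \<in> sets seq_borel" "A = B \<inter> Wu_rect X R a" using A by (auto simp: borel_subsets_eq)
      \<comment> \<open>The shifted piece must be recognised as a Borel set of the leaf in the image
        rectangle, since the holonomy hypothesis speaks of such sets only.\<close>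
      have sA: "?s ` A = shift (- int n) -` B \<inter> Wu_rect X (?s ` Q) (?s a)"
      proof (intro equalityI subsetI)
        fix y assume "y \<in> ?s ` A"
        then obtain x where x: "x \<in> A" "y = ?s x" by blast
        then have xR: "x \<in> X" "x \<in> B" "x \<in> R" using B(2) by (auto simp: Wu_rect_def Wu_loc_def)
        have xM: "x k = a k" if "k < int M" for k using AM x(1) that by (auto simp: past_cyl_def)
        have "x \<in> Q" using xR xM M by (auto simp: Q_def)
        moreover have "y k = ?s a k" if "k \<le> 0" for k
          unfolding x(2) shift_apply using that M by (intro xM) auto
        ultimately show "y \<in> shift (- int n) -` B \<inter> Wu_rect X (?s ` Q) (?s a)"
          using xR x(2) by (auto simp: Wu_rect_def Wu_loc_def)
      next
        fix y assume y: "y \<in> shift (- int n) -` B \<inter> Wu_rect X (?s ` Q) (?s a)"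
        then obtain x where x: "x \<in> Q" "y = ?s x" by (auto simp: Wu_rect_def)
        have xX: "x \<in> X" "x \<in> R" using x rect_in_X[OF R] by (auto simp: Q_def)
        have "x k = a k" if "k \<le> 0" for k
        proof -
          have "y (k - int n) = ?s a (k - int n)" using y that by (simp add: Wu_rect_def Wu_loc_def)
          then show ?thesis by (simp add: x(2) shift_apply)
        qed
        then have "x \<in> Wu_rect X R a" using xX by (simp add: Wu_rect_def Wu_loc_def)
        moreover have "x \<in> B" using y x(2) by simp
        ultimately show "y \<in> ?s ` A" unfolding B(2) x(2) by blast
      qed
      have "shift (- int n) -` B \<inter> space seq_borel \<in> sets seq_borel"
        by (rule measurable_sets[OF measurable_shift B(1)])
      then have sA_borel: "?s ` A \<in> borel_subsets (Wu_rect X (?s ` Q) (?s a))"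
        unfolding sA by (simp add: sets_into_borel_subsets)
      \<comment> \<open>The two brackets change from one sequence to the other at different
        positions, 0 and \<open>n\<close> in the original coordinates. On \<open>A\<close> this does
        not matter, because its points coincide with \<open>b\<close> in between.\<close>
      have img: "bracket (?s b) ` ?s ` A = ?s ` bracket b ` A"
      proof -
        have "bracket (?s b) (?s x) = ?s (bracket b x)" if "x \<in> A" for x
        proof -
          have "x k = a k" if "k < int M" for k using AM \<open>x \<in> A\<close> that by (auto simp: past_cyl_def)
          then have "x k = b k" if "0 \<le> k" "k < int M" for k using ab that by simp
          then show ?thesis using M by (auto simp: fun_eq_iff bracket_def shift_apply)
        qed
        then show ?thesis by (auto simp: image_image intro!: image_cong)
      qed
      have AbM: "bracket b ` A \<subseteq> past_cyl X b M"
        by (rule bracket_image_past_cyl[OF R b borel_subsets_subset[OF A] AM bWs])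
      have Sa: "S n y \<le> S n a + \<epsilon> / 3" if "y \<in> past_cyl X a M" for y
      proof -
        have "y \<in> X" "\<forall>k<int M1. y k = a k" using that M by (auto simp: past_cyl_def)
        from M1[OF this(1) aX(1) this(2)] show ?thesis by linarith
      qed
      have Sb: "S n b - \<epsilon> / 3 \<le> S n y" if "y \<in> past_cyl X b M" for y
      proof -
        have "y \<in> X" "\<forall>k<int M1. y k = b k" using that M by (auto simp: past_cyl_def)
        from M1[OF this(1) aX(2) this(2)] show ?thesis by linarith
      qed
      have "m a A \<le> exp (S n a + \<epsilon> / 3 - real n * P) * m (?s a) (?s ` A)"
        using M by (intro leaf_outer_le_shift[OF aX(1) _ AM Sa]) auto
      also have "\<dots> \<le> exp (S n a + \<epsilon> / 3 - real n * P) * (exp (\<epsilon> / 3) * m (?s b) (?s ` bracket b ` A))"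
        unfolding img[symmetric]
        by (intro mult_left_mono \<delta>(2)[OF Q abQ dist sA_borel]) simp
      also have "\<dots> \<le> exp (S n a + \<epsilon> / 3 - real n * P) * (exp (\<epsilon> / 3) *
          (exp (real n * P - (S n b - \<epsilon> / 3)) * m b (bracket b ` A)))"
        using M by (intro mult_left_mono leaf_outer_shift_le[OF aX(2) _ AbM Sb]) auto
      also have "\<dots> = exp (S n a - S n b + \<epsilon>) * m b (bracket b ` A)"
        by (simp add: mult.assoc[symmetric] ennreal_mult'[symmetric] exp_add[symmetric])
          (simp add: algebra_simps)
      finally show "m a A \<le> ennreal (exp (S n a - S n b + \<epsilon>)) * m b (bracket b ` A)" .
    qed
  qed
qed

text \<open>Positivity is assumed at one unspecified point of each rectangle. Applied to an image
  rectangle, it gives a point whose leaf is close to that of the shifted \<open>a\<close>, and the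
  holonomy carries positive measure over. Shifted back, the whole leaf of the image rectangle
  becomes a small piece around \<open>a\<close>.\<close>

lemma leaf_outer_past_cyl_pos:
  assumes R: "R \<in> \<R>" and a: "a \<in> R"
  shows "m a (Wu_rect X R a \<inter> past_cyl X a L) > 0"
proof -
  \<comment> \<open>Any distortion factor will do, as only positivity is at stake.\<close>
  from holonomy[OF zero_less_one] obtain \<delta> where \<delta>0: "\<delta> > 0" and *: "\<forall>R\<in>\<R>. \<forall>y\<in>R. \<forall>z\<in>R. seq_dist y z < \<delta> \<longrightarrow>
      (\<forall>Y\<in>borel_subsets (Wu_rect X R y). m y Y \<le> ennreal (exp 1) * m z (bracket z ` Y))"
    by (elim exE conjE)
  note \<delta> = \<delta>0 *[rule_format]
  obtain n0 :: nat where n0: "(1/2)^n0 < \<delta>" using real_arch_pow_inv[OF \<delta>(1), of "1/2"] by auto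
  define n where "n = max n0 L"
  let ?s = "shift (int n)"
  define Q where "Q = {y \<in> R. \<forall>k. 0 \<le> k \<and> k \<le> int n \<longrightarrow> y k = a k}"
  have Q: "?s ` Q \<in> \<R>" unfolding Q_def by (rule shifted_rect[OF R a])
  have aX: "a \<in> X" using R a rect_in_X by auto
  have aQ: "?s a \<in> ?s ` Q" using a by (auto simp: Q_def)
  obtain p where p: "p \<in> Q" "m (?s p) (Wu_rect X (?s ` Q) (?s p)) > 0"
    using positive[OF Q] by blast
  \<comment> \<open>On the unstable leaf of \<open>?s p\<close>, so the measure is the same, but
    with the future of \<open>?s a\<close>. The past agrees with that of \<open>?s a\<close> down to
    position \<open>-n\<close> because \<open>p\<close> lies in \<open>Q\<close>.\<close>
  define q where "q = bracket (?s p) (?s a)"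
  have qQ: "q \<in> ?s ` Q" unfolding q_def using Q p(1) aQ by (intro bracket_in_rect) auto
  have q_past: "q k = ?s p k" if "k \<le> 0" for k using that by (simp add: q_def bracket_def)
  have mq: "m q = m (?s p)" by (rule leaf_outer_leaf_eq) (rule q_past)
  have Wq: "Wu_rect X (?s ` Q) q = Wu_rect X (?s ` Q) (?s p)"
    unfolding Wu_rect_def using Wu_loc_eq[of q "?s p" X] q_past by simp
  have "seq_dist q (?s a) < (1/2)^n"
    unfolding seq_dist_less_iff using p(1) by (auto simp: shift_apply q_def bracket_def Q_def)
  moreover have "(1/2 :: real)^n \<le> (1/2)^n0" by (intro power_decreasing) (auto simp: n_def)
  ultimately have dist: "seq_dist q (?s a) < \<delta>" using n0 by linarith
  define A where "A = Wu_rect X R a \<inter> past_cyl X a (n + 1)"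
  have "bracket (?s a) ` Wu_rect X (?s ` Q) q \<subseteq> ?s ` A"
  proof
    fix y assume "y \<in> bracket (?s a) ` Wu_rect X (?s ` Q) q"
    then obtain z where z: "z \<in> ?s ` Q" "y = bracket (?s a) z" by (auto simp: Wu_rect_def)
    then have "y \<in> ?s ` Q" using bracket_in_rect[OF Q aQ] by blast
    then obtain x where x: "x \<in> Q" "y = ?s x" by blast
    have xR: "x \<in> R" "x \<in> X" using x(1) rect_in_X[OF R] by (auto simp: Q_def)
    have "x k = a k" if "k \<le> int n" for k
    proof -
      have "y (k - int n) = ?s a (k - int n)" unfolding z(2) using that by (simp add: bracket_def)
      then show ?thesis by (simp add: x(2) shift_apply)
    qed
    then have "x \<in> A" using xR by (simp add: A_def Wu_rect_def Wu_loc_def past_cyl_def)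
    then show "y \<in> ?s ` A" using x(2) by blast
  qed
  then have "m (?s a) (bracket (?s a) ` Wu_rect X (?s ` Q) q) \<le> m (?s a) (?s ` A)"
    by (rule leaf_outer_mono)
  moreover have "0 < m (?s a) (bracket (?s a) ` Wu_rect X (?s ` Q) q)"
    using \<delta>(2)[OF Q qQ aQ dist self_in_borel_subsets] p(2) unfolding mq Wq
    by (metis gr_zeroI leD mult_zero_right)
  ultimately have "0 < m (?s a) (?s ` A)" by (rule less_le_trans[rotated])
  moreover obtain B where B: "\<And>x. x \<in> X \<Longrightarrow> \<bar>S n x\<bar> \<le> B" by (rule birkhoff_bounded) blast
  have "m (?s a) (?s ` A) \<le> exp (real n * P - (- B)) * m a A"
  proof (rule leaf_outer_shift_le[OF aX, of n "n + 1"])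
    fix y assume "y \<in> past_cyl X a (n + 1)"
    then show "- B \<le> S n y" using B[of y] by (simp add: past_cyl_def)
  qed (auto simp: A_def)
  ultimately have "0 < m a A" by (metis gr_zeroI leD mult_zero_right)
  moreover have "m a A \<le> m a (Wu_rect X R a \<inter> past_cyl X a L)"
  proof -
    have "past_cyl X a (n + 1) \<subseteq> past_cyl X a L" by (rule past_cyl_antimono) (simp add: n_def)
    then show ?thesis unfolding A_def by (intro leaf_outer_mono) auto
  qed
  ultimately show ?thesis by (rule less_le_trans)
qed

section \<open>Convergence of the series Delta^s, uniformly over the family\<close>

lemma bracket_bracket_image: "A \<subseteq> Wu_rect X R a \<Longrightarrow> bracket a ` bracket b ` A = A"
  using bracket_leaf[of _ X a b] by (force simp: image_image Wu_rect_def)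

text \<open>A set \<open>A\<close> is carried from the leaf of \<open>a\<close> to that of
  \<open>b\<close> with the estimate at time \<open>n\<close>, and back with the estimate at time
  \<open>k\<close>. The round trip is the identity, so dividing by the positive finite number
  \<open>m a A\<close> shows that the product of the two factors is at least 1.\<close>

lemma birkhoff_difference_Cauchy:
  assumes e: "\<epsilon> > 0"
  shows "\<exists>n0. \<forall>n\<ge>n0. \<forall>k\<ge>n0. \<forall>R\<in>\<R>. \<forall>a\<in>R. \<forall>b\<in>R. b \<in> Ws_loc X a \<longrightarrow>
    \<bar>(S n b - S n a) - (S k b - S k a)\<bar> \<le> \<epsilon>"
proof -
  have e2: "\<epsilon> / 2 > 0" using e by simp
  from holonomy_le[OF e2] obtain n0 where "\<forall>n\<ge>n0. \<exists>M0. \<forall>M\<ge>M0. \<forall>R\<in>\<R>. \<forall>a\<in>R. \<forall>b\<in>R. b \<in> Ws_loc X a \<longrightarrow>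
    (\<forall>A\<in>borel_subsets (Wu_rect X R a). A \<subseteq> past_cyl X a M \<longrightarrow>
       m a A \<le> ennreal (exp (S n a - S n b + \<epsilon> / 2)) * m b (bracket b ` A))" by (elim exE)
  then have n0: "\<And>n. n \<ge> n0 \<Longrightarrow> \<exists>M0. \<forall>M\<ge>M0. \<forall>R\<in>\<R>. \<forall>a\<in>R. \<forall>b\<in>R. b \<in> Ws_loc X a \<longrightarrow>
    (\<forall>A\<in>borel_subsets (Wu_rect X R a). A \<subseteq> past_cyl X a M \<longrightarrow>
       m a A \<le> ennreal (exp (S n a - S n b + \<epsilon> / 2)) * m b (bracket b ` A))" by (elim allE impE)
  have one: "(S n b - S n a) - (S k b - S k a) \<le> \<epsilon>"
    if nk: "n \<ge> n0" "k \<ge> n0" and R: "R \<in> \<R>" and a: "a \<in> R" and b: "b \<in> R" and ab: "b \<in> Ws_loc X a"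
    for n k R a b
  proof -
    have ba: "a \<in> Ws_loc X b" using ab rect_in_X[OF R a] by (simp add: Ws_loc_def)
    from n0[OF nk(1)] obtain Mn where "\<forall>M\<ge>Mn. \<forall>R\<in>\<R>. \<forall>a\<in>R. \<forall>b\<in>R. b \<in> Ws_loc X a \<longrightarrow>
      (\<forall>A\<in>borel_subsets (Wu_rect X R a). A \<subseteq> past_cyl X a M \<longrightarrow>
         m a A \<le> ennreal (exp (S n a - S n b + \<epsilon> / 2)) * m b (bracket b ` A))" by (elim exE)
    note Mn = this[rule_format]
    from n0[OF nk(2)] obtain Mk where "\<forall>M\<ge>Mk. \<forall>R\<in>\<R>. \<forall>a\<in>R. \<forall>b\<in>R. b \<in> Ws_loc X a \<longrightarrow>
      (\<forall>A\<in>borel_subsets (Wu_rect X R a). A \<subseteq> past_cyl X a M \<longrightarrow>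
         m a A \<le> ennreal (exp (S k a - S k b + \<epsilon> / 2)) * m b (bracket b ` A))" by (elim exE)
    note Mk = this[rule_format]
    \<comment> \<open>Deep enough for both times, so that one and the same set serves for the way
      there and the way back.\<close>
    define M where "M = max Mn Mk"
    have "Wu_rect X R a \<inter> past_cyl X a M \<in> borel_subsets (Wu_rect X R a)"
      using Wu_rect_subset by (intro Int_past_cyl_borel) auto
    from semifinite[OF R a this leaf_outer_past_cyl_pos[OF R a]] obtain A where
      A: "A \<in> borel_subsets (Wu_rect X R a)" "A \<subseteq> Wu_rect X R a \<inter> past_cyl X a M" "0 < m a A" "m a A < \<infinity>"
      by blast
    have A': "bracket a ` bracket b ` A = A" using A(2) by (intro bracket_bracket_image) auto
    have bA: "bracket b ` A \<in> borel_subsets (Wu_rect X R b)"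
      using bracket_image_borel[OF rect[OF R] a b A(1)] .
    have bM: "bracket b ` A \<subseteq> past_cyl X b M"
      using A(2) by (intro bracket_image_past_cyl[OF R b _ _ ab]) auto
    have "m a A \<le> ennreal (exp (S n a - S n b + \<epsilon> / 2)) * m b (bracket b ` A)"
      using A by (intro Mn[of M, OF _ R a b ab]) (auto simp: M_def)
    also have "\<dots> \<le> ennreal (exp (S n a - S n b + \<epsilon> / 2)) * (ennreal (exp (S k b - S k a + \<epsilon> / 2)) * m a A)"
      using Mk[of M, OF _ R b a ba bA bM] unfolding A' by (intro mult_left_mono) (auto simp: M_def)
    also have "\<dots> = ennreal (exp (S n a - S n b + S k b - S k a + \<epsilon>)) * m a A"
      by (simp add: mult.assoc[symmetric] ennreal_mult'[symmetric] exp_add[symmetric])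
        (simp add: algebra_simps)
    finally have le: "m a A \<le> ennreal (exp (S n a - S n b + S k b - S k a + \<epsilon>)) * m a A" .
    obtain r where r: "m a A = ennreal r" "r > 0" using A(3,4) by (cases "m a A") auto
    have "r \<le> exp (S n a - S n b + S k b - S k a + \<epsilon>) * r"
      using le r by (simp add: ennreal_mult'[symmetric])
    then have "1 \<le> exp (S n a - S n b + S k b - S k a + \<epsilon>)" using r(2) by simp
    then show ?thesis by simp
  qed
  show ?thesis
  proof (intro exI[of _ n0] allI ballI impI)
    fix n k R a b
    assume *: "n0 \<le> n" "n0 \<le> k" "R \<in> \<R>" "a \<in> R" "b \<in> R" "b \<in> Ws_loc X a"
    show "\<bar>(S n b - S n a) - (S k b - S k a)\<bar> \<le> \<epsilon>"
      using one[OF *] one[OF *(2,1,3-6)] by linarith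
  qed
qed

lemma birkhoff_difference_eq_sum:
  "S n b - S n a = (\<Sum>i<n. \<phi> (shift (int i) b) - \<phi> (shift (int i) a))"
  unfolding birkhoff_plus_def by (rule sum_subtractf[symmetric])

lemma Delta_s_summable:
  assumes "R \<in> \<R>" "a \<in> R" "b \<in> R" "b \<in> Ws_loc X a"
  shows "summable (\<lambda>n. \<phi> (shift (int n) b) - \<phi> (shift (int n) a))"
  unfolding summable_iff_convergent birkhoff_difference_eq_sum[symmetric]
proof (rule Cauchy_convergent, rule CauchyI)
  fix e :: real assume e: "0 < e"
  then have "e / 2 > 0" by simp
  from birkhoff_difference_Cauchy[OF this] obtain n0 where
    "\<forall>n\<ge>n0. \<forall>k\<ge>n0. \<forall>R\<in>\<R>. \<forall>a\<in>R. \<forall>b\<in>R. b \<in> Ws_loc X a \<longrightarrow>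
      \<bar>(S n b - S n a) - (S k b - S k a)\<bar> \<le> e / 2" by (elim exE)
  note n0 = this[rule_format, OF _ _ assms]
  show "\<exists>N. \<forall>n\<ge>N. \<forall>k\<ge>N. norm (S n b - S n a - (S k b - S k a)) < e"
  proof (intro exI[of _ n0] allI impI)
    fix n k assume "n0 \<le> n" "n0 \<le> k"
    from n0[OF this] show "norm (S n b - S n a - (S k b - S k a)) < e" using e by simp
  qed
qed

text \<open>Letting \<open>k\<close> tend to infinity in the Cauchy estimate keeps \<open>n0\<close>
  independent of the points; the density comparison relies on a single \<open>n\<close> for a whole
  leaf.\<close>

lemma Delta_s_approx:
  assumes e: "\<epsilon> > 0"
  shows "\<exists>n0. \<forall>n\<ge>n0. \<forall>R\<in>\<R>. \<forall>a\<in>R. \<forall>b\<in>R. b \<in> Ws_loc X a \<longrightarrow>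
    \<bar>Delta_s \<phi> b a - (S n b - S n a)\<bar> \<le> \<epsilon>"
proof -
  from birkhoff_difference_Cauchy[OF e] obtain n0 where
    "\<forall>n\<ge>n0. \<forall>k\<ge>n0. \<forall>R\<in>\<R>. \<forall>a\<in>R. \<forall>b\<in>R. b \<in> Ws_loc X a \<longrightarrow>
      \<bar>(S n b - S n a) - (S k b - S k a)\<bar> \<le> \<epsilon>" by (elim exE)
  note n0 = this[rule_format]
  show ?thesis
  proof (intro exI[of _ n0] allI ballI impI)
    fix n R a b assume *: "n0 \<le> n" "R \<in> \<R>" "a \<in> R" "b \<in> R" "b \<in> Ws_loc X a"
    have "(\<lambda>k. S k b - S k a) \<longlonglongrightarrow> Delta_s \<phi> b a"
      unfolding birkhoff_difference_eq_sum Delta_s_def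
      using Delta_s_summable[OF *(2-)] by (rule summable_LIMSEQ)
    then have lim: "(\<lambda>k. \<bar>(S k b - S k a) - (S n b - S n a)\<bar>) \<longlonglongrightarrow> \<bar>Delta_s \<phi> b a - (S n b - S n a)\<bar>"
      by (intro tendsto_intros)
    show "\<bar>Delta_s \<phi> b a - (S n b - S n a)\<bar> \<le> \<epsilon>"
      using n0[OF _ *(1) *(2-)] by (intro LIMSEQ_le_const2[OF lim]) blast
  qed
qed

end

lemma (in shift_potential) measurable_Delta_s:
  assumes "f \<in> measurable M seq_borel" "\<And>\<omega>. \<omega> \<in> space M \<Longrightarrow> f \<omega> \<in> X"
    and "g \<in> measurable M seq_borel" "\<And>\<omega>. \<omega> \<in> space M \<Longrightarrow> g \<omega> \<in> X"
  shows "(\<lambda>\<omega>. Delta_s \<phi> (f \<omega>) (g \<omega>)) \<in> borel_measurable M"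
  unfolding Delta_s_def
  by (intro borel_measurable_suminf borel_measurable_diff measurable_potential_shift assms)

section \<open>Change of variables along holonomies\<close>

context holonomy_family
begin

lemma measurable_bracket_leaf:
  assumes R: "R \<in> \<R>" and ab: "a \<in> R" "b \<in> R"
    and M: "sets M = borel_subsets (Wu_rect X R a)" and N: "sets N = borel_subsets (Wu_rect X R b)"
  shows "bracket b \<in> measurable M N"
proof (rule measurable_borel_subsetsI[OF _ _ N])
  show "bracket b \<in> measurable M seq_borel"
    by (intro measurable_bracket[where f = "\<lambda>_. b" and g = "\<lambda>x. x", simplified] measurable_const
        measurable_id_seq_borel[OF M])
next
  fix x assume "x \<in> space M"
  then have "x \<in> R" using sets_eq_imp_space_eq[of M "leaf_measure X \<phi> P a (Wu_rect X R a)"] M by (simp add: Wu_rect_def)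
  then have "bracket b x \<in> R" using bracket_in_rect R ab by blast
  then show "bracket b x \<in> Wu_rect X R b"
    using rect_in_X[OF R] by (simp add: Wu_rect_def Wu_loc_def bracket_def)
qed

lemma measurable_holonomy_density:
  assumes R: "R \<in> \<R>" and ab: "a \<in> R" "b \<in> R" and M: "sets M = borel_subsets (Wu_rect X R a)"
  shows "(\<lambda>x. Delta_s \<phi> (bracket b x) x) \<in> borel_measurable M"
proof (rule measurable_Delta_s)
  show id: "(\<lambda>x. x) \<in> measurable M seq_borel" by (rule measurable_id_seq_borel[OF M])
  show "bracket b \<in> measurable M seq_borel"
    by (intro measurable_bracket[where f = "\<lambda>_. b" and g = "\<lambda>x. x", simplified] measurable_const id)
  fix x assume "x \<in> space M"
  then have "x \<in> R" using sets_eq_imp_space_eq[of M "leaf_measure X \<phi> P a (Wu_rect X R a)"] M by (simp add: Wu_rect_def)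
  then show "x \<in> X" "bracket b x \<in> X" using bracket_in_rect R ab rect_in_X by blast+
qed

lemma bracket_Ws_loc: "R \<in> \<R> \<Longrightarrow> b \<in> R \<Longrightarrow> x \<in> R \<Longrightarrow> bracket b x \<in> Ws_loc X x"
  using bracket_in_rect[of R b x] rect_in_X[of R "bracket b x"] rect_zero_eq[of R b x]
  by (auto simp: Ws_loc_def bracket_def)

text \<open>Both sides are compared on the leaf of \<open>a\<close>: \<open>N1\<close> is the
  measure of the other leaf brought over by the inverse holonomy, \<open>N2\<close> the candidate
  density. On a piece of points sharing many letters each is almost \<open>exp c\<close> times the
  leaf measure, with the same \<open>c\<close>. This costs a factor \<open>exp \<epsilon>\<close>,
  and \<epsilon> is arbitrary.\<close>

lemma leaf_measure_eq_distr_density: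
  assumes R: "R \<in> \<R>" and a: "a \<in> R" and b: "b \<in> R"
  defines "D \<equiv> Wu_rect X R a" and "E \<equiv> Wu_rect X R b"
  shows "leaf_measure X \<phi> P b E = distr
    (density (leaf_measure X \<phi> P a D) (\<lambda>x. ennreal (exp (Delta_s \<phi> (bracket b x) x))))
    (leaf_measure X \<phi> P b E) (bracket b)"
proof -
  let ?ma = "leaf_measure X \<phi> P a D" and ?mb = "leaf_measure X \<phi> P b E"
  let ?f = "\<lambda>x. ennreal (exp (Delta_s \<phi> (bracket b x) x))"
  define N1 where "N1 = distr ?mb ?ma (bracket a)"
  define N2 where "N2 = density ?ma ?f"
  have DE: "D \<subseteq> Wu_loc X a" "E \<subseteq> Wu_loc X b" "D \<subseteq> R" "D \<subseteq> X" by (auto simp: D_def E_def Wu_rect_subset)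
  have [measurable]: "bracket a \<in> measurable ?mb ?ma" "bracket b \<in> measurable ?ma ?mb"
    by (rule measurable_bracket_leaf[OF R]; simp add: a b D_def E_def)+
  have f[measurable]: "?f \<in> borel_measurable ?ma"
    using measurable_holonomy_density[OF R a b, of ?ma] by (simp add: D_def)
  have N1: "emeasure N1 A = m b (bracket b ` A)" if A: "A \<in> borel_subsets D" for A
  proof -
    have "bracket a -` A \<inter> E = bracket b ` A"
    proof (intro equalityI subsetI)
      fix y assume "y \<in> bracket a -` A \<inter> E"
      then show "y \<in> bracket b ` A"
        using bracket_leaf[of y X b a] DE(2) by (intro image_eqI[of _ _ "bracket a y"]) auto
    next
      fix y assume "y \<in> bracket b ` A"
      moreover have "bracket b ` A \<subseteq> E"
        using bracket_image_borel[OF rect[OF R] a b A[unfolded D_def]] unfolding E_def by (rule borel_subsets_subset)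
      moreover have "bracket a ` bracket b ` A = A"
        using A by (intro bracket_bracket_image[of _ R]) (simp add: D_def borel_subsets_subset)
      ultimately show "y \<in> bracket a -` A \<inter> E" by blast
    qed
    moreover have "bracket b ` A \<in> borel_subsets E"
      using bracket_image_borel[OF rect[OF R] a b A[unfolded D_def]] unfolding E_def .
    ultimately show ?thesis unfolding N1_def
      using A DE(2) by (subst emeasure_distr) (auto simp: emeasure_leaf_measure)
  qed
  have N2: "emeasure N2 A = (\<integral>\<^sup>+x. ?f x * indicator A x \<partial>?ma)" if "A \<in> borel_subsets D" for A
    unfolding N2_def using emeasure_density[OF f, of A] that by simp
  have compare: "emeasure N1 A \<le> exp \<epsilon> * emeasure N2 A \<and> emeasure N2 A \<le> exp \<epsilon> * emeasure N1 A"
    if \<epsilon>: "\<epsilon> > 0" and A: "A \<in> borel_subsets D" for \<epsilon> :: real and A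
  proof -
    \<comment> \<open>One share is the error of the holonomy estimate. The other three bound the
      oscillation of the density: truncating Delta^s at \<open>n\<close>, and moving each of the two
      points in its Birkhoff sum.\<close>
    define \<eta> where "\<eta> = \<epsilon> / 4"
    have \<eta>: "\<eta> > 0" using \<epsilon> by (simp add: \<eta>_def)
    from holonomy_le[OF \<eta>] obtain n1 where n1: "\<forall>n\<ge>n1. \<exists>M0. \<forall>M\<ge>M0. \<forall>R\<in>\<R>. \<forall>a\<in>R. \<forall>b\<in>R. b \<in> Ws_loc X a \<longrightarrow>
      (\<forall>A\<in>borel_subsets (Wu_rect X R a). A \<subseteq> past_cyl X a M \<longrightarrow>
         m a A \<le> ennreal (exp (S n a - S n b + \<eta>)) * m b (bracket b ` A))" by (elim exE)
    from Delta_s_approx[OF \<eta>] obtain n2 where n2: "\<forall>n\<ge>n2. \<forall>R\<in>\<R>. \<forall>a\<in>R. \<forall>b\<in>R. b \<in> Ws_loc X a \<longrightarrow>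
      \<bar>Delta_s \<phi> b a - (S n b - S n a)\<bar> \<le> \<eta>" by (elim exE)
    define n where "n = max n1 n2"
    have "\<exists>M0. \<forall>M\<ge>M0. \<forall>R\<in>\<R>. \<forall>a\<in>R. \<forall>b\<in>R. b \<in> Ws_loc X a \<longrightarrow>
      (\<forall>A\<in>borel_subsets (Wu_rect X R a). A \<subseteq> past_cyl X a M \<longrightarrow>
         m a A \<le> ennreal (exp (S n a - S n b + \<eta>)) * m b (bracket b ` A))"
      by (rule n1[THEN spec, THEN mp]) (simp add: n_def)
    then obtain M0 where "\<forall>M\<ge>M0. \<forall>R\<in>\<R>. \<forall>a\<in>R. \<forall>b\<in>R. b \<in> Ws_loc X a \<longrightarrow>
      (\<forall>A\<in>borel_subsets (Wu_rect X R a). A \<subseteq> past_cyl X a M \<longrightarrow>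
         m a A \<le> ennreal (exp (S n a - S n b + \<eta>)) * m b (bracket b ` A))" by (elim exE)
    note hol = this[rule_format]
    have \<Delta>: "\<bar>Delta_s \<phi> y x - (S n y - S n x)\<bar> \<le> \<eta>" if "x \<in> R" "y \<in> R" "y \<in> Ws_loc X x" for x y
      using n2[rule_format, of n R x y] R that by (simp add: n_def)
    from birkhoff_uniform[OF \<eta>, of n] obtain M1 where
      "\<forall>x\<in>X. \<forall>y\<in>X. (\<forall>k<int M1. x k = y k) \<longrightarrow> \<bar>S n x - S n y\<bar> \<le> \<eta>" by (elim exE)
    then have M1: "\<bar>S n x - S n y\<bar> \<le> \<eta>" if "x \<in> X" "y \<in> X" "\<forall>k<int M1. x k = y k" for x y
      using that by blast
    define M where "M = max M0 M1 + 1"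
    \<comment> \<open>Points of one leaf already share their past, so these windows cut
      \<open>D\<close> only through the coordinates from 1 to \<open>M\<close>.\<close>
    let ?C = "\<lambda>x :: int \<Rightarrow> 'a. {y. \<forall>n. nat \<bar>n\<bar> \<le> M \<longrightarrow> y n = x n}"
    define I where "I = (\<lambda>C. C \<inter> D) ` range ?C"
    have I1: "finite I" unfolding I_def by (intro finite_imageI finite_seq_cylinders)
    have I2: "p \<in> sets N2" if "p \<in> I" for p
      using that openin_seq_borel[OF openin_seq_cylinder]
      by (auto simp: I_def N2_def intro!: sets_into_borel_subsets)
    have I3: "disjoint I"
    proof (rule disjointI)
      fix p q assume pq: "p \<in> I" "q \<in> I" "p \<noteq> q"
      then obtain x y where xy: "p = ?C x \<inter> D" "q = ?C y \<inter> D" unfolding I_def by blast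
      show "p \<inter> q = {}"
      proof (rule ccontr)
        assume "p \<inter> q \<noteq> {}"
        then obtain z where "z \<in> ?C x" "z \<in> ?C y" unfolding xy by blast
        then have "x n = y n" if "nat \<bar>n\<bar> \<le> M" for n using that by simp
        then have "?C x = ?C y" by auto
        then show False using pq(3) unfolding xy by simp
      qed
    qed
    have I4: "A \<subseteq> \<Union>I" using borel_subsets_subset[OF A] unfolding I_def by fastforce
    have piece: "emeasure N1 (A \<inter> p) \<le> exp \<epsilon> * emeasure N2 (A \<inter> p) \<and>
        emeasure N2 (A \<inter> p) \<le> exp \<epsilon> * emeasure N1 (A \<inter> p)" if p: "p \<in> I" for p
    proof (cases "A \<inter> p = {}")
      case True then show ?thesis by simp
    next
      case False
      define B where "B = A \<inter> p"
      have B: "B \<in> borel_subsets D"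
        using A I2[OF p] sigma_algebra_borel_subsets[of D] unfolding B_def
        by (simp add: N2_def) (metis sets.Int sets_leaf_measure)
      obtain x where x: "x \<in> B" using False B_def by blast
      obtain z where z: "p = ?C z \<inter> D" using p unfolding I_def by blast
      have BD: "B \<subseteq> D" by (rule borel_subsets_subset[OF B])
      have xD: "x \<in> D" "x \<in> R" "x \<in> X" using x BD DE by auto
      have BM: "y k = x k" if y: "y \<in> B" and k: "k < int M" for y k
      proof (cases "k \<le> 0")
        case True
        have "x \<in> Wu_loc X a" "y \<in> Wu_loc X a" using xD(1) y BD DE(1) by blast+
        then show ?thesis using True by (simp add: Wu_loc_def)
      next
        case False
        then have "nat \<bar>k\<bar> \<le> M" using k by simp
        moreover have "x \<in> ?C z" "y \<in> ?C z" using x y unfolding B_def z by auto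
        ultimately show ?thesis by simp
      qed
      \<comment> \<open>The points \<open>a\<close> and \<open>b\<close> need not lie on a common
        stable leaf, as the holonomy estimate demands, but \<open>x\<close> and \<open>x'\<close>
        do. They lie on the unstable leaves of \<open>a\<close> and \<open>b\<close>, so measures,
        leaves and brackets do not change when they replace them.\<close>
      define x' where "x' = bracket b x"
      have x'R: "x' \<in> R" "x' \<in> X" using bracket_in_rect[OF R b xD(2)] rect_in_X[OF R] by (auto simp: x'_def)
      have x's: "x' \<in> Ws_loc X x" unfolding x'_def by (rule bracket_Ws_loc[OF R b xD(2)])
      then have xs: "x \<in> Ws_loc X x'" using xD by (simp add: Ws_loc_def)
      have past: "x k = a k" "x' k = b k" if "k \<le> 0" for k
        using xD DE(1) that by (auto simp: Wu_loc_def x'_def bracket_def)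
      have mx: "m x = m a" "m x' = m b" by (rule leaf_outer_leaf_eq; simp add: past)+
      have Wx: "Wu_rect X R x = D" "Wu_rect X R x' = E"
        unfolding D_def E_def Wu_rect_def using Wu_loc_eq[of x a X] Wu_loc_eq[of x' b X] past by simp_all
      have brx: "bracket x = bracket a" "bracket x' = bracket b" by (rule bracket_past_eq; simp add: past)+
      define c where "c = S n x' - S n x"
      have Bp: "B \<subseteq> past_cyl X x M" using BM BD DE(4) by (auto simp: past_cyl_def)
      have bB: "bracket b ` B \<in> borel_subsets E"
        using bracket_image_borel[OF rect[OF R] a b B[unfolded D_def]] unfolding E_def .
      have bBp: "bracket b ` B \<subseteq> past_cyl X x' M"
        unfolding brx(2)[symmetric] using BD Bp by (intro bracket_image_past_cyl[OF R x'R(1) _ _ x's]) (simp_all add: Wx)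
      have baB: "bracket a ` bracket b ` B = B"
        using BD by (intro bracket_bracket_image[of _ R]) (simp add: D_def)
      have le1: "m a B \<le> exp (- c + \<eta>) * m b (bracket b ` B)"
        using hol[of M R x x' B] R xD x'R x's B Bp unfolding Wx mx brx c_def M_def by simp
      have le2: "m b (bracket b ` B) \<le> exp (c + \<eta>) * m a B"
        using hol[of M R x' x "bracket b ` B"] R xD x'R xs bB bBp unfolding Wx mx brx baB c_def M_def by simp
      have \<Delta>c: "\<bar>Delta_s \<phi> (bracket b y) y - c\<bar> \<le> 3 * \<eta>" if y: "y \<in> B" for y
      proof -
        have yR: "y \<in> R" "y \<in> X" using y BD DE by auto
        have y'R: "bracket b y \<in> R" "bracket b y \<in> X"
          using bracket_in_rect[OF R b yR(1)] rect_in_X[OF R] by auto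
        have "\<bar>Delta_s \<phi> (bracket b y) y - (S n (bracket b y) - S n y)\<bar> \<le> \<eta>"
          by (intro \<Delta> bracket_Ws_loc[OF R b] yR y'R)
        moreover have "\<bar>S n y - S n x\<bar> \<le> \<eta>"
          using BM[OF y] by (intro M1 yR xD) (auto simp: M_def)
        moreover have "\<bar>S n (bracket b y) - S n x'\<bar> \<le> \<eta>"
          using BM[OF y] by (intro M1 y'R x'R) (auto simp: M_def x'_def bracket_def)
        ultimately show ?thesis unfolding c_def by linarith
      qed
      have eB: "emeasure ?ma B = m a B" using B DE(1) by (rule emeasure_leaf_measure[rotated])
      have up: "emeasure N2 B \<le> exp (c + 3 * \<eta>) * m a B"
      proof -
        have "emeasure N2 B \<le> (\<integral>\<^sup>+y. ennreal (exp (c + 3 * \<eta>)) * indicator B y \<partial>?ma)"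
          unfolding N2[OF B] using \<Delta>c
          by (intro nn_integral_mono) (force split: split_indicator simp: abs_le_iff)
        also have "\<dots> = exp (c + 3 * \<eta>) * m a B" using B by (simp add: nn_integral_cmult_indicator eB)
        finally show ?thesis .
      qed
      have lo: "exp (c - 3 * \<eta>) * m a B \<le> emeasure N2 B"
      proof -
        have "exp (c - 3 * \<eta>) * m a B = (\<integral>\<^sup>+y. ennreal (exp (c - 3 * \<eta>)) * indicator B y \<partial>?ma)"
          using B by (simp add: nn_integral_cmult_indicator eB)
        also have "\<dots> \<le> emeasure N2 B"
          unfolding N2[OF B] using \<Delta>c
          by (intro nn_integral_mono) (force split: split_indicator simp: abs_le_iff)
        finally show ?thesis .
      qed
      have "emeasure N1 B \<le> exp (c + \<eta>) * m a B" unfolding N1[OF B] by (rule le2)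
      also have "\<dots> = exp (4 * \<eta>) * (exp (c - 3 * \<eta>) * m a B)"
        by (simp add: mult.assoc[symmetric] ennreal_mult'[symmetric] exp_add[symmetric] add.commute)
      also have "\<dots> \<le> exp (4 * \<eta>) * emeasure N2 B" by (intro mult_left_mono lo) simp
      finally have 1: "emeasure N1 B \<le> exp \<epsilon> * emeasure N2 B" by (simp add: \<eta>_def)
      have "emeasure N2 B \<le> exp (c + 3 * \<eta>) * (exp (- c + \<eta>) * m b (bracket b ` B))"
        by (rule order_trans[OF up]) (intro mult_left_mono le1, simp)
      also have "\<dots> = exp (4 * \<eta>) * emeasure N1 B"
        unfolding N1[OF B] by (simp add: mult.assoc[symmetric] ennreal_mult'[symmetric] exp_add[symmetric])
      finally have "emeasure N2 B \<le> exp \<epsilon> * emeasure N1 B" by (simp add: \<eta>_def)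
      with 1 show ?thesis unfolding B_def by simp
    qed
    have sN: "sets N1 = sets N2" "sets N2 = borel_subsets D" by (simp_all add: N1_def N2_def)
    show ?thesis
    proof
      show "emeasure N1 A \<le> exp \<epsilon> * emeasure N2 A"
        using A unfolding sN(2)[symmetric]
        by (rule emeasure_le_finite_partition[OF sN(1) _ I1 I2 I3 I4 piece[THEN conjunct1]])
      show "emeasure N2 A \<le> exp \<epsilon> * emeasure N1 A"
        using A unfolding sN(2)[symmetric] sN(1)[symmetric]
        by (rule emeasure_le_finite_partition[OF sN(1)[symmetric] _ I1 I2[folded sN(1)] I3 I4 piece[THEN conjunct2]])
    qed
  qed
  have eq: "emeasure N1 A = emeasure N2 A" if A: "A \<in> borel_subsets D" for A
  proof (rule antisym)
    show "emeasure N1 A \<le> emeasure N2 A"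
      by (rule ennreal_le_exp_epsilon) (rule compare[OF _ A, THEN conjunct1])
    show "emeasure N2 A \<le> emeasure N1 A"
      by (rule ennreal_le_exp_epsilon) (rule compare[OF _ A, THEN conjunct2])
  qed
  have "N1 = N2"
  proof (rule measure_eqI)
    show "sets N1 = sets N2" by (simp add: N1_def N2_def)
    fix A assume "A \<in> sets N1"
    then show "emeasure N1 A = emeasure N2 A" by (intro eq) (simp add: N1_def)
  qed
  \<comment> \<open>Pushing the equality forward undoes the inverse holonomy contained in
    \<open>N1\<close>.\<close>
  have "distr N2 ?mb (bracket b) = distr (distr ?mb ?ma (bracket a)) ?mb (bracket b)"
    unfolding \<open>N1 = N2\<close>[symmetric] N1_def ..
  also have "\<dots> = distr ?mb ?mb (bracket b \<circ> bracket a)" by (rule distr_distr) measurable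
  also have "\<dots> = distr ?mb ?mb (\<lambda>x. x)"
    using bracket_leaf[of _ X b a] DE(2) by (intro distr_cong refl) auto
  also have "\<dots> = ?mb" by (rule distr_id)
  finally show ?thesis unfolding N2_def by simp
qed

end

section \<open>Time reversal\<close>

definition flip :: "(int \<Rightarrow> 'a) \<Rightarrow> (int \<Rightarrow> 'a)" where
  "flip x = (\<lambda>n. x (- n))"

lemma flip_flip [simp]: "flip (flip x) = x"
  by (simp add: flip_def)

lemma flip_apply: "flip x n = x (- n)"
  by (simp add: flip_def)

lemma flip_image_flip [simp]: "flip ` flip ` A = A"
  by (simp add: image_image)

lemma inj_flip: "inj flip"
  by (metis flip_flip injI)

lemma flip_image_eq_vimage: "flip ` A = flip -` A"
  by (auto simp: image_iff) (metis flip_flip)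

lemma flip_mem_image [simp]: "flip x \<in> flip ` A \<longleftrightarrow> x \<in> A"
  by (simp add: flip_image_eq_vimage)

lemma shift_flip: "shift k (flip x) = flip (shift (- k) x)"
  by (simp add: shift_def flip_def)

text \<open>Past and future change places, hence the swapped arguments. Position 0 is read from the
  first argument on both sides, hence the hypothesis.\<close>

lemma bracket_flip: "x 0 = y 0 \<Longrightarrow> bracket (flip x) (flip y) = flip (bracket y x)"
  by (auto simp: bracket_def flip_def fun_eq_iff)

lemma openin_flip: "openin seq_topology U \<Longrightarrow> openin seq_topology (flip -` U)"
  unfolding openin_seq_topology_iff
proof
  fix x assume U: "\<forall>x\<in>U. \<exists>k::nat. \<forall>y. (\<forall>n. nat \<bar>n\<bar> \<le> k \<longrightarrow> y n = x n) \<longrightarrow> y \<in> U" and "x \<in> flip -` U"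
  then have "flip x \<in> U" by simp
  with U obtain k :: nat where k: "\<forall>y. (\<forall>n. nat \<bar>n\<bar> \<le> k \<longrightarrow> y n = flip x n) \<longrightarrow> y \<in> U" by blast
  show "\<exists>k::nat. \<forall>y. (\<forall>n. nat \<bar>n\<bar> \<le> k \<longrightarrow> y n = x n) \<longrightarrow> y \<in> flip -` U"
  proof (intro exI[of _ k] allI impI)
    fix y assume "\<forall>n. nat \<bar>n\<bar> \<le> k \<longrightarrow> y n = x n"
    then have "\<forall>n. nat \<bar>n\<bar> \<le> k \<longrightarrow> flip y n = flip x n" by (simp add: flip_def)
    with k show "y \<in> flip -` U" by simp
  qed
qed

lemma seq_dist_flip [simp]: "seq_dist (flip x) (flip y) = seq_dist x y"
proof -
  have "(\<exists>n. nat \<bar>n\<bar> = k \<and> x (- n) \<noteq> y (- n)) \<longleftrightarrow> (\<exists>n. nat \<bar>n\<bar> = k \<and> x n \<noteq> y n)" for k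
    by (metis abs_minus_cancel minus_minus)
  moreover have "flip x = flip y \<longleftrightarrow> x = y" by (metis flip_flip)
  ultimately show ?thesis by (simp add: seq_dist_def flip_apply)
qed

lemma measurable_flip: "flip \<in> measurable (seq_borel :: (int \<Rightarrow> 'a::finite) measure) seq_borel"
  by (rule seq_borel_measurableI) (simp add: flip_def)

lemma borel_subsets_flip:
  fixes D :: "(int \<Rightarrow> 'a::finite) set"
  assumes "A \<in> borel_subsets D"
  shows "flip ` A \<in> borel_subsets (flip ` D)"
proof -
  obtain B where B: "B \<in> sets seq_borel" "A = B \<inter> D" using assms by (auto simp: borel_subsets_eq)
  have "flip -` B \<in> sets seq_borel" using measurable_sets[OF measurable_flip B(1)] by simp
  moreover have "flip ` A = flip -` B \<inter> flip ` D" unfolding B(2) by (auto simp: flip_image_eq_vimage)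
  ultimately show ?thesis by (simp add: sets_into_borel_subsets)
qed

lemma measurable_flip_leaf:
  fixes D :: "(int \<Rightarrow> 'a::finite) set"
  assumes M: "sets M = borel_subsets D" and N: "sets N = borel_subsets (flip ` D)"
  shows "flip \<in> measurable M N"
proof (rule measurable_borel_subsetsI[OF _ _ N])
  show "flip \<in> measurable M seq_borel"
    by (rule measurable_compose[OF measurable_id_seq_borel[OF M] measurable_flip])
  show "flip x \<in> flip ` D" if "x \<in> space M" for x
    using that sets_eq_imp_space_eq[of M "restrict_space seq_borel D"] M
    by (simp add: sets_restrict_seq_borel space_restrict_space)
qed

lemma Ws_loc_flip: "flip ` Ws_loc X x = Wu_loc (flip ` X) (flip x)"
proof -
  have "(\<forall>k\<ge>0. y k = x k) \<longleftrightarrow> (\<forall>k\<le>0. flip y k = flip x k)" for y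
    unfolding flip_def by (metis neg_0_le_iff_le minus_minus)
  then show ?thesis unfolding flip_image_eq_vimage by (auto simp: Wu_loc_def Ws_loc_def)
qed

lemma Ws_rect_flip: "flip ` Ws_rect X R x = Wu_rect (flip ` X) (flip ` R) (flip x)"
  unfolding Ws_rect_def Wu_rect_def Ws_loc_flip[symmetric] by (rule image_Int[OF inj_flip])

text \<open>A word read from left to right and ending at 0 is, after reversal, a word starting at 0
  and read backwards.\<close>

lemma cyl_minus_flip: "flip ` cyl_minus X w = cyl_plus (flip ` X) (rev w)"
proof -
  have "(\<forall>i<length w. y (int i - int (length w) + 1) = w ! i) \<longleftrightarrow>
      (\<forall>i<length w. flip y (int i) = rev w ! i)" (is "?L \<longleftrightarrow> ?R") for y
  proof
    assume L: ?L
    show ?R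
    proof (intro allI impI)
      fix i assume i: "i < length w"
      then have "length w - Suc i < length w" by simp
      with L have "y (int (length w - Suc i) - int (length w) + 1) = w ! (length w - Suc i)" by blast
      moreover have "int (length w - Suc i) - int (length w) + 1 = - int i" using i by simp
      ultimately show "flip y (int i) = rev w ! i" unfolding flip_apply rev_nth[OF i] by metis
    qed
  next
    assume R: ?R
    show ?L
    proof (intro allI impI)
      fix i assume i: "i < length w"
      then have "length w - Suc i < length w" by simp
      with R have "flip y (int (length w - Suc i)) = rev w ! (length w - Suc i)" by blast
      moreover have "- int (length w - Suc i) = int i - int (length w) + 1" using i by simp
      ultimately show "y (int i - int (length w) + 1) = w ! i" using i by (simp add: flip_apply rev_nth algebra_simps)
    qed
  qed
  then show ?thesis unfolding flip_image_eq_vimage by (auto simp: cyl_plus_def cyl_minus_def)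
qed

lemma Delta_s_flip: "Delta_s (\<phi> \<circ> flip) (flip x') (flip x) = Delta_u \<phi> x' x"
  by (simp add: Delta_s_def Delta_u_def shift_flip)

section \<open>The stable leaf measures as unstable ones of the reversed system\<close>

context shift_potential
begin

lemma shift_potential_flip: "shift_potential (flip ` X) (\<phi> \<circ> flip)"
proof
  have "closedin seq_topology (flip -` X)"
    using closedin_X openin_flip[of "- X"] by (simp add: closedin_def Compl_eq_Diff_UNIV vimage_Diff)
  moreover have "shift 1 ` flip ` X = flip ` X"
  proof (intro equalityI subsetI)
    fix y assume "y \<in> shift 1 ` flip ` X"
    then show "y \<in> flip ` X" by (auto simp: shift_flip)
  next
    fix y assume "y \<in> flip ` X"
    then obtain x where "x \<in> X" "y = flip x" by blast
    then have "y = shift 1 (flip (shift 1 x))" "shift 1 x \<in> X" by (simp_all add: shift_flip)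
    then show "y \<in> shift 1 ` flip ` X" by blast
  qed
  ultimately show "shift_space (flip ` X)"
    using shift_space by (simp add: shift_space_def flip_image_eq_vimage[symmetric])
  have "continuous_map seq_topology seq_topology flip"
    using openin_flip by (auto simp: continuous_map_def vimage_def)
  then have "continuous_map (subtopology seq_topology (flip ` X)) (subtopology seq_topology X) flip"
    by (auto simp: continuous_map_in_subtopology intro: continuous_map_from_subtopology)
  then show "continuous_map (subtopology seq_topology (flip ` X)) euclideanreal (\<phi> \<circ> flip)"
    using continuous by (rule continuous_map_compose)
qed

text \<open>The language is defined through occurrences starting at 0, while reversal produces
  occurrences ending at 0; a shift by the length minus one relates them.\<close>

lemma lang_flip: "lang (flip ` X) = rev ` lang X"
proof -
  have "cyl_minus X w \<noteq> {} \<longleftrightarrow> cyl_plus X w \<noteq> {}" for w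
  proof -
    let ?l = "int (length w) - 1"
    have "shift (- ?l) x \<in> cyl_plus X w" if "x \<in> cyl_minus X w" for x
      using that by (auto simp: cyl_plus_def cyl_minus_def shift_apply algebra_simps)
    moreover have "shift ?l x \<in> cyl_minus X w" if "x \<in> cyl_plus X w" for x
      using that by (auto simp: cyl_plus_def cyl_minus_def shift_apply algebra_simps)
    ultimately show ?thesis by blast
  qed
  then have "cyl_plus (flip ` X) (rev w) \<noteq> {} \<longleftrightarrow> cyl_plus X w \<noteq> {}" for w
    unfolding cyl_minus_flip[symmetric] by simp
  then have iff: "rev w \<in> lang (flip ` X) \<longleftrightarrow> w \<in> lang X" for w by (simp add: lang_def)
  show ?thesis
  proof (rule set_eqI)
    fix w
    show "w \<in> lang (flip ` X) \<longleftrightarrow> w \<in> rev ` lang X"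
      using iff[of "rev w"] by (auto simp: image_iff intro!: bexI[of _ "rev w"])
  qed
qed

text \<open>Reversing words preserves their length, so covers and costs correspond one to one. The
  constant on the right is the pressure of the original system, which avoids comparing it with that
  of the reversed one.\<close>

lemma ms_eq_leaf_outer:
  "ms X \<phi> x Z = leaf_outer (flip ` X) (\<phi> \<circ> flip) (pressure X \<phi>) (flip x) (flip ` Z)"
proof -
  have weight: "weight_minus X \<phi> x w = weight_plus (flip ` X) (\<phi> \<circ> flip) (flip x) (rev w)" for w
  proof -
    have "Wu_loc (flip ` X) (flip x) \<inter> cyl_plus (flip ` X) (rev w) = flip ` (Ws_loc X x \<inter> cyl_minus X w)"
      unfolding Ws_loc_flip[symmetric] cyl_minus_flip[symmetric] by (rule image_Int[OF inj_flip, symmetric])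
    then show ?thesis
      by (simp add: weight_plus_def weight_minus_def image_image birkhoff_plus_def birkhoff_minus_def shift_flip)
  qed
  have covers: "covers_plus (flip ` X) (flip ` Z) N = (`) rev ` covers_minus X Z N" for N
  proof -
    have iff: "rev ` \<E> \<in> covers_plus (flip ` X) (flip ` Z) N \<longleftrightarrow> \<E> \<in> covers_minus X Z N" for \<E>
    proof -
      have "rev ` \<E> \<subseteq> {w \<in> lang (flip ` X). N \<le> length w} \<longleftrightarrow> \<E> \<subseteq> {w \<in> lang X. N \<le> length w}"
        unfolding lang_flip by auto
      moreover have "(\<Union>w\<in>rev ` \<E>. cyl_plus (flip ` X) w) = flip ` (\<Union>w\<in>\<E>. cyl_minus X w)"
        by (simp add: image_UN cyl_minus_flip)
      then have "flip ` Z \<subseteq> (\<Union>w\<in>rev ` \<E>. cyl_plus (flip ` X) w) \<longleftrightarrow> Z \<subseteq> (\<Union>w\<in>\<E>. cyl_minus X w)"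
        by (simp add: inj_image_subset_iff[OF inj_flip])
      ultimately show ?thesis unfolding covers_plus_def covers_minus_def by blast
    qed
    show ?thesis
    proof (intro equalityI subsetI)
      fix \<E> assume E: "\<E> \<in> covers_plus (flip ` X) (flip ` Z) N"
      have "rev ` rev ` \<E> = \<E>" by (simp add: image_image)
      with iff[of "rev ` \<E>"] E show "\<E> \<in> (`) rev ` covers_minus X Z N" by (metis image_eqI)
    qed (use iff in blast)
  qed
  have "infsum (leaf_cost (flip ` X) (\<phi> \<circ> flip) (pressure X \<phi>) (flip x)) (rev ` \<E>) =
      infsum (\<lambda>w. exp_ereal (weight_minus X \<phi> x w - ereal (real (length w) * pressure X \<phi>))) \<E>" for \<E>
    by (subst infsum_reindex) (auto simp: leaf_cost_def weight o_def inj_on_def)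
  then have "leaf_premeasure (flip ` X) (\<phi> \<circ> flip) (pressure X \<phi>) (flip x) N (flip ` Z) =
      (INF \<E>\<in>covers_minus X Z N.
         infsum (\<lambda>w. exp_ereal (weight_minus X \<phi> x w - ereal (real (length w) * pressure X \<phi>))) \<E>)" for N
    unfolding leaf_premeasure_def covers by (simp add: image_image)
  then show ?thesis unfolding ms_def lim_leaf_premeasure[symmetric] by simp
qed

lemma emeasure_distr_flip_leaf_measure:
  assumes D: "D \<subseteq> Ws_loc X x" and A: "A \<in> borel_subsets D"
  shows "emeasure (distr (leaf_measure (flip ` X) (\<phi> \<circ> flip) (pressure X \<phi>) (flip x) (flip ` D))
    (restrict_space seq_borel D) flip) A = ms X \<phi> x A" (is "emeasure (distr ?L _ _) _ = _")
proof -
  have D': "flip ` D \<subseteq> Wu_loc (flip ` X) (flip x)" using D unfolding Ws_loc_flip[symmetric] by blast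
  have meas: "flip \<in> measurable ?L (restrict_space seq_borel D)"
    by (rule measurable_flip_leaf[of _ "flip ` D"]) (simp_all add: sets_restrict_seq_borel)
  have "flip -` A \<inter> flip ` D = flip ` A"
    using borel_subsets_subset[OF A] by (auto simp: flip_image_eq_vimage)
  then show ?thesis
    using meas A emeasure_leaf_measure[OF D' borel_subsets_flip[OF A]]
    by (simp add: emeasure_distr sets_restrict_seq_borel ms_eq_leaf_outer)
qed

text \<open>As an image of a leaf measure, the stable measure inherits countable additivity.\<close>

lemma ms_measure_eq_distr:
  assumes D: "D \<subseteq> Ws_loc X x"
  shows "ms_measure X \<phi> x D =
    distr (leaf_measure (flip ` X) (\<phi> \<circ> flip) (pressure X \<phi>) (flip x) (flip ` D)) (restrict_space seq_borel D) flip"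
    (is "_ = ?M")
proof -
  have "measure_of D (borel_subsets D) (emeasure ?M) = ms_measure X \<phi> x D"
    unfolding ms_measure_def using emeasure_distr_flip_leaf_measure[OF D]
    by (intro measure_of_eq) (auto dest: borel_subsets_subset
        simp: sigma_algebra.sigma_sets_eq[OF sigma_algebra_borel_subsets])
  moreover have "measure_of D (borel_subsets D) (emeasure ?M) = ?M"
    using measure_of_of_measure[of ?M] by (simp add: sets_restrict_seq_borel space_restrict_space)
  ultimately show ?thesis by simp
qed

lemma emeasure_ms_measure:
  "D \<subseteq> Ws_loc X x \<Longrightarrow> A \<in> borel_subsets D \<Longrightarrow> emeasure (ms_measure X \<phi> x D) A = ms X \<phi> x A"
  unfolding ms_measure_eq_distr by (rule emeasure_distr_flip_leaf_measure)

lemma nn_integral_ms_measure: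
  assumes D: "D \<subseteq> Ws_loc X x" and f: "f \<in> borel_measurable (ms_measure X \<phi> x D)"
  shows "(\<integral>\<^sup>+y. f y \<partial>ms_measure X \<phi> x D) =
    (\<integral>\<^sup>+y. f (flip y) \<partial>leaf_measure (flip ` X) (\<phi> \<circ> flip) (pressure X \<phi>) (flip x) (flip ` D))"
proof -
  have "f \<in> borel_measurable (restrict_space seq_borel D)"
    using f unfolding ms_measure_eq_distr[OF D] by simp
  then show ?thesis unfolding ms_measure_eq_distr[OF D]
    by (intro nn_integral_distr measurable_flip_leaf[of _ "flip ` D"]) (simp_all add: sets_restrict_seq_borel)
qed

end

lemma sets_ms_measure [simp]: "sets (ms_measure X \<phi> x D) = borel_subsets D"
  by (simp add: ms_measure_def)

lemma space_ms_measure [simp]: "space (ms_measure X \<phi> x D) = D"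
  by (simp add: ms_measure_def)

lemma mu_measure_eq_leaf_measure: "mu_measure X \<phi> = leaf_measure X \<phi> (pressure X \<phi>)"
  by (intro ext) (simp add: mu_measure_def leaf_measure_def mu_eq_leaf_outer)

text \<open>The bridge from sigma-finite leaf measures to the assumption \<open>semifinite\<close>
  of \<open>holonomy_family\<close>.\<close>

lemma (in sigma_finite_measure) ex_finite_positive_subset:
  assumes A: "A \<in> sets M" "emeasure M A > 0"
  shows "\<exists>B\<in>sets M. B \<subseteq> A \<and> 0 < emeasure M B \<and> emeasure M B < \<infinity>"
proof (cases "emeasure M A = \<infinity>")
  case True
  obtain B where "B \<in> sets M" "B \<subseteq> A" "emeasure M B < \<infinity>" "emeasure M B > ennreal 0"
    using approx_PInf_emeasure_with_finite[OF A(1) True, of 0] by blast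
  then show ?thesis by auto
next
  case False
  then show ?thesis using A by (intro bexI[of _ A]) (auto simp: top.not_eq_extremum)
qed

lemma rectangle_flip: "rectangle X R \<Longrightarrow> rectangle (flip ` X) (flip ` R)"
  by (auto simp: rectangle_def bracket_flip flip_apply)

section \<open>The product measure\<close>

text \<open>Both instances carry the same constant, since the stable measures are normalised by the
  pressure of the original system. Sigma-finiteness of the stable measures is what makes the inner
  integral a measurable function of the outer variable.\<close>

locale product_family =
  u: holonomy_family X \<phi> "pressure X \<phi>" \<R> +
  s: holonomy_family "flip ` X" "\<phi> \<circ> flip" "pressure X \<phi>" "(`) flip ` \<R>"
  for X :: "(int \<Rightarrow> 'a::finite) set" and \<phi> :: "(int \<Rightarrow> 'a) \<Rightarrow> real" and \<R> :: "(int \<Rightarrow> 'a) set set" +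
  assumes sigma_finite_ms: "R \<in> \<R> \<Longrightarrow> q \<in> R \<Longrightarrow> sigma_finite_measure (ms_measure X \<phi> q (Ws_rect X R q))"
begin

abbreviation U :: "(int \<Rightarrow> 'a) set \<Rightarrow> (int \<Rightarrow> 'a) \<Rightarrow> (int \<Rightarrow> 'a) measure" where
  "U R q \<equiv> mu_measure X \<phi> q (Wu_rect X R q)"

abbreviation V :: "(int \<Rightarrow> 'a) set \<Rightarrow> (int \<Rightarrow> 'a) \<Rightarrow> (int \<Rightarrow> 'a) measure" where
  "V R q \<equiv> ms_measure X \<phi> q (Ws_rect X R q)"

lemma sets_U [simp]: "sets (U R q) = borel_subsets (Wu_rect X R q)"
  and space_U [simp]: "space (U R q) = Wu_rect X R q"
  by (simp_all add: mu_measure_eq_leaf_measure)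

lemma flip_family: "R \<in> \<R> \<Longrightarrow> flip ` R \<in> (`) flip ` \<R>"
  by blast

lemma rect_mem:
  "z \<in> Wu_rect X R q \<Longrightarrow> z \<in> R" "y \<in> Ws_rect X R q \<Longrightarrow> y \<in> R"
  by (auto simp: Wu_rect_def Ws_rect_def)

lemma nn_integral_U:
  assumes R: "R \<in> \<R>" and ab: "a \<in> R" "b \<in> R" and f[measurable]: "f \<in> borel_measurable (U R b)"
  shows "(\<integral>\<^sup>+z. f z \<partial>U R b) =
    (\<integral>\<^sup>+z. ennreal (exp (Delta_s \<phi> (bracket b z) z)) * f (bracket b z) \<partial>U R a)"
proof -
  have [measurable]: "bracket b \<in> measurable (U R a) (U R b)"
    by (rule u.measurable_bracket_leaf[OF R ab]) simp_all
  have [measurable]: "(\<lambda>z. Delta_s \<phi> (bracket b z) z) \<in> borel_measurable (U R a)"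
    by (rule u.measurable_holonomy_density[OF R ab]) simp
  have "(\<integral>\<^sup>+z. f z \<partial>U R b) = (\<integral>\<^sup>+z. f z \<partial>distr
      (density (U R a) (\<lambda>z. ennreal (exp (Delta_s \<phi> (bracket b z) z)))) (U R b) (bracket b))"
    using u.leaf_measure_eq_distr_density[OF R ab] by (simp add: mu_measure_eq_leaf_measure)
  also have "\<dots> = (\<integral>\<^sup>+z. f (bracket b z) \<partial>density (U R a) (\<lambda>z. ennreal (exp (Delta_s \<phi> (bracket b z) z))))"
    by (rule nn_integral_distr) simp_all
  also have "\<dots> = (\<integral>\<^sup>+z. ennreal (exp (Delta_s \<phi> (bracket b z) z)) * f (bracket b z) \<partial>U R a)"
    by (rule nn_integral_density) simp_all
  finally show ?thesis .
qed

lemma measurable_Delta_u: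
  assumes f: "f \<in> measurable M seq_borel" "\<And>\<omega>. \<omega> \<in> space M \<Longrightarrow> f \<omega> \<in> X"
    and g: "g \<in> measurable M seq_borel" "\<And>\<omega>. \<omega> \<in> space M \<Longrightarrow> g \<omega> \<in> X"
  shows "(\<lambda>\<omega>. Delta_u \<phi> (f \<omega>) (g \<omega>)) \<in> borel_measurable M"
  unfolding Delta_u_def
  by (intro borel_measurable_suminf borel_measurable_diff u.measurable_potential_shift f g)

lemma Ws_rect_subset: "Ws_rect X R a \<subseteq> Ws_loc X a"
  by (auto simp: Ws_rect_def)

lemma bracket_in_Ws_rect:
  assumes R: "R \<in> \<R>" and "b \<in> R" "y \<in> R"
  shows "bracket y b \<in> Ws_rect X R b"
  using u.bracket_in_rect[OF R assms(3,2)] u.rect_in_X[OF R] u.rect_zero_eq[OF R assms(3,2)]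
  by (auto simp: Ws_rect_def Ws_loc_def bracket_def)

lemma measurable_bracket_V:
  assumes R: "R \<in> \<R>" and ab: "a \<in> R" "b \<in> R"
  shows "(\<lambda>y. bracket y b) \<in> measurable (V R a) (V R b)"
proof (rule measurable_borel_subsetsI[where D = "Ws_rect X R b"])
  show "(\<lambda>y. bracket y b) \<in> measurable (V R a) seq_borel"
    by (intro measurable_bracket measurable_id_seq_borel[where D = "Ws_rect X R a"] measurable_const) simp_all
qed (use R ab in \<open>auto intro!: bracket_in_Ws_rect dest: rect_mem\<close>)

text \<open>The stable substitution is the unstable one of the reversed system, transported back by
  \<open>flip\<close>; this is why the base point appears as the second argument of the
  bracket.\<close>

lemma nn_integral_V:
  assumes R: "R \<in> \<R>" and a: "a \<in> R" and b: "b \<in> R" and f[measurable]: "f \<in> borel_measurable (V R b)"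
  shows "(\<integral>\<^sup>+y. f y \<partial>V R b) =
    (\<integral>\<^sup>+y. ennreal (exp (Delta_u \<phi> (bracket y b) y)) * f (bracket y b) \<partial>V R a)"
proof -
  let ?L = "\<lambda>q. leaf_measure (flip ` X) (\<phi> \<circ> flip) (pressure X \<phi>) (flip q) (flip ` Ws_rect X R q)"
  let ?d = "\<lambda>x. ennreal (exp (Delta_s (\<phi> \<circ> flip) (bracket (flip b) x) x))"
  note R' = flip_family[OF R]
  have ab': "flip a \<in> flip ` R" "flip b \<in> flip ` R" using a b by auto
  have [measurable]: "bracket (flip b) \<in> measurable (?L a) (?L b)"
    by (rule s.measurable_bracket_leaf[OF R' ab']) (simp_all add: Ws_rect_flip)
  have [measurable]: "(\<lambda>x. Delta_s (\<phi> \<circ> flip) (bracket (flip b) x) x) \<in> borel_measurable (?L a)"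
    by (rule s.measurable_holonomy_density[OF R' ab']) (simp add: Ws_rect_flip)
  have [measurable]: "flip \<in> measurable (?L b) (V R b)"
    by (rule measurable_flip_leaf[where D = "flip ` Ws_rect X R b"]) simp_all
  have [measurable]: "(\<lambda>y. bracket y b) \<in> measurable (V R a) (V R b)"
    by (rule measurable_bracket_V[OF R a b])
  have id: "(\<lambda>y. y) \<in> measurable (V R a) seq_borel" by (rule measurable_id_seq_borel) simp
  have [measurable]: "(\<lambda>y. Delta_u \<phi> (bracket y b) y) \<in> borel_measurable (V R a)"
    using b by (intro measurable_Delta_u id measurable_bracket measurable_const)
      (auto dest!: rect_mem intro: u.rect_in_X[OF R] u.bracket_in_rect[OF R])
  have "(\<integral>\<^sup>+y. f y \<partial>V R b) = (\<integral>\<^sup>+x. f (flip x) \<partial>?L b)"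
    by (rule u.nn_integral_ms_measure[OF Ws_rect_subset f])
  also have "\<dots> = (\<integral>\<^sup>+x. f (flip x) \<partial>distr (density (?L a) ?d) (?L b) (bracket (flip b)))"
    using s.leaf_measure_eq_distr_density[OF R' ab'] by (simp add: Ws_rect_flip)
  also have "\<dots> = (\<integral>\<^sup>+x. f (flip (bracket (flip b) x)) \<partial>density (?L a) ?d)"
    by (rule nn_integral_distr) simp_all
  also have "\<dots> = (\<integral>\<^sup>+x. ?d x * f (flip (bracket (flip b) x)) \<partial>?L a)"
    by (rule nn_integral_density) simp_all
  also have "\<dots> = (\<integral>\<^sup>+x. ennreal (exp (Delta_u \<phi> (bracket (flip x) b) (flip x))) * f (bracket (flip x) b) \<partial>?L a)"
  proof (rule nn_integral_cong)
    fix x assume "x \<in> space (?L a)"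
    then obtain y where y: "y \<in> R" "x = flip y" by (auto dest: rect_mem)
    have "bracket (flip b) x = flip (bracket y b)"
      unfolding y(2) using u.rect_zero_eq[OF R b y(1)] by (rule bracket_flip)
    then show "?d x * f (flip (bracket (flip b) x)) =
        ennreal (exp (Delta_u \<phi> (bracket (flip x) b) (flip x))) * f (bracket (flip x) b)"
      by (simp add: y(2) Delta_s_flip)
  qed
  also have "\<dots> = (\<integral>\<^sup>+y. ennreal (exp (Delta_u \<phi> (bracket y b) y)) * f (bracket y b) \<partial>V R a)"
    by (rule u.nn_integral_ms_measure[OF Ws_rect_subset, symmetric]) measurable
  finally show ?thesis .
qed

lemma U_space_pos: "R \<in> \<R> \<Longrightarrow> q \<in> R \<Longrightarrow> 0 < emeasure (U R q) (Wu_rect X R q)"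
  using u.leaf_outer_past_cyl_pos[of R q 0]
    leaf_outer_mono[of "Wu_rect X R q \<inter> past_cyl X q 0" "Wu_rect X R q" X \<phi> "pressure X \<phi>" q]
  by (simp add: mu_measure_eq_leaf_measure emeasure_leaf_measure u.Wu_rect_subset)

lemma V_space_pos:
  assumes R: "R \<in> \<R>" and q: "q \<in> R"
  shows "0 < emeasure (V R q) (Ws_rect X R q)"
proof -
  have "0 < leaf_outer (flip ` X) (\<phi> \<circ> flip) (pressure X \<phi>) (flip q)
      (Wu_rect (flip ` X) (flip ` R) (flip q) \<inter> past_cyl (flip ` X) (flip q) 0)"
    using flip_family[OF R] q by (intro s.leaf_outer_past_cyl_pos) auto
  also have "\<dots> \<le> ms X \<phi> q (Ws_rect X R q)"
    unfolding u.ms_eq_leaf_outer Ws_rect_flip by (rule leaf_outer_mono) simp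
  finally show ?thesis using u.emeasure_ms_measure[OF Ws_rect_subset] by simp
qed

definition integrand :: "(int \<Rightarrow> 'a) set \<Rightarrow> (int \<Rightarrow> 'a) \<Rightarrow> (int \<Rightarrow> 'a) \<Rightarrow> ennreal" where
  "integrand Z z y = ennreal (exp (Delta_u \<phi> (bracket y z) y)) *
     ennreal (exp (Delta_s \<phi> (bracket y z) z)) * indicator Z (bracket y z)"

lemma lambda_fun_eq: "lambda_fun X \<phi> R q Z = (\<integral>\<^sup>+z. (\<integral>\<^sup>+y. integrand Z z y \<partial>V R q) \<partial>U R q)"
  by (simp add: lambda_fun_def integrand_def)

lemma measurable_integrand:
  assumes R: "R \<in> \<R>" and Z: "Z \<in> borel_subsets R"
  shows "(\<lambda>(z, y). integrand Z z y) \<in> borel_measurable (U R q \<Otimes>\<^sub>M V R q)"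
proof -
  let ?M = "U R q \<Otimes>\<^sub>M V R q"
  obtain B where B[measurable]: "B \<in> sets seq_borel" and ZB: "Z = B \<inter> R"
    using Z by (auto simp: borel_subsets_eq)
  have mem: "fst \<omega> \<in> R" "snd \<omega> \<in> R" if "\<omega> \<in> space ?M" for \<omega>
    using that by (auto simp: space_pair_measure dest: rect_mem)
  then have brR: "bracket (snd \<omega>) (fst \<omega>) \<in> R" if "\<omega> \<in> space ?M" for \<omega>
    using that by (intro u.bracket_in_rect[OF R]) auto
  have z[measurable]: "fst \<in> measurable ?M seq_borel"
    by (rule measurable_compose[OF measurable_fst]) (rule measurable_id_seq_borel, simp)
  have y[measurable]: "snd \<in> measurable ?M seq_borel"
    by (rule measurable_compose[OF measurable_snd]) (rule measurable_id_seq_borel, simp)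
  have br[measurable]: "(\<lambda>\<omega>. bracket (snd \<omega>) (fst \<omega>)) \<in> measurable ?M seq_borel"
    by (rule measurable_bracket[OF y z])
  have [measurable]: "(\<lambda>\<omega>. Delta_u \<phi> (bracket (snd \<omega>) (fst \<omega>)) (snd \<omega>)) \<in> borel_measurable ?M"
    by (intro measurable_Delta_u br y u.rect_in_X[OF R] brR mem)
  have [measurable]: "(\<lambda>\<omega>. Delta_s \<phi> (bracket (snd \<omega>) (fst \<omega>)) (fst \<omega>)) \<in> borel_measurable ?M"
    by (intro u.measurable_Delta_s br z u.rect_in_X[OF R] brR mem)
  \<comment> \<open>The indicator of \<open>Z\<close> is replaced by that of a Borel set
    \<open>B\<close> of the full shift. They agree at brackets, which stay in the possibly non-Borel
    set \<open>R\<close>.\<close>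
  have "(\<lambda>\<omega>. ennreal (exp (Delta_u \<phi> (bracket (snd \<omega>) (fst \<omega>)) (snd \<omega>))) *
      ennreal (exp (Delta_s \<phi> (bracket (snd \<omega>) (fst \<omega>)) (fst \<omega>))) *
      indicator B (bracket (snd \<omega>) (fst \<omega>))) \<in> borel_measurable ?M"
    by measurable
  then show ?thesis
    by (rule measurable_cong[THEN iffD1, rotated])
      (auto simp: integrand_def ZB split: split_indicator dest: brR)
qed

lemma measurable_integrand_V:
  assumes "R \<in> \<R>" "Z \<in> borel_subsets R" "z \<in> Wu_rect X R q"
  shows "integrand Z z \<in> borel_measurable (V R q)"
  using measurable_compose[OF measurable_Pair1'[of z "U R q" "V R q"] measurable_integrand[OF assms(1,2), of q]]
    assms(3) by simp

lemma measurable_integrand_U: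
  assumes R: "R \<in> \<R>" and q: "q \<in> R" and Z: "Z \<in> borel_subsets R"
  shows "(\<lambda>z. \<integral>\<^sup>+y. integrand Z z y \<partial>V R q) \<in> borel_measurable (U R q)"
  by (rule sigma_finite_measure.borel_measurable_nn_integral[OF sigma_finite_ms[OF R q]
      measurable_integrand[OF R Z]])

section \<open>The product measure: additivity, base point and positivity\<close>

lemma measure_space_lambda:
  assumes R: "R \<in> \<R>" and q: "q \<in> R"
  shows "measure_space R (borel_subsets R) (lambda_fun X \<phi> R q)"
  unfolding measure_space_def
proof (intro conjI sigma_algebra_borel_subsets)
  show "positive (borel_subsets R) (lambda_fun X \<phi> R q)"
    by (simp add: positive_def lambda_fun_eq integrand_def)
  show "countably_additive (borel_subsets R) (lambda_fun X \<phi> R q)"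
    unfolding countably_additive_def
  proof (intro allI impI)
    fix A :: "nat \<Rightarrow> (int \<Rightarrow> 'a) set"
    assume A: "range A \<subseteq> borel_subsets R" "disjoint_family A"
    then have Ai: "A i \<in> borel_subsets R" for i by blast
    have "(\<Sum>i. lambda_fun X \<phi> R q (A i)) = (\<integral>\<^sup>+z. (\<Sum>i. \<integral>\<^sup>+y. integrand (A i) z y \<partial>V R q) \<partial>U R q)"
      unfolding lambda_fun_eq by (rule nn_integral_suminf[symmetric]) (rule measurable_integrand_U[OF R q Ai])
    also have "\<dots> = (\<integral>\<^sup>+z. (\<integral>\<^sup>+y. (\<Sum>i. integrand (A i) z y) \<partial>V R q) \<partial>U R q)"
      by (intro nn_integral_cong nn_integral_suminf[symmetric] measurable_integrand_V[OF R Ai]) simp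
    also have "\<dots> = lambda_fun X \<phi> R q (\<Union>i. A i)"
      unfolding lambda_fun_eq integrand_def
      using suminf_indicator[OF A(2)] by simp
    finally show "(\<Sum>i. lambda_fun X \<phi> R q (A i)) = lambda_fun X \<phi> R q (\<Union>i. A i)" .
  qed
qed

text \<open>The terms telescope; the convergence of both series, obtained from the holonomies,
  permits adding them termwise.\<close>

lemma Delta_s_cocycle:
  assumes R: "R \<in> \<R>" and x: "x \<in> R" and y: "y \<in> R" "y \<in> Ws_loc X x" and z: "z \<in> R" "z \<in> Ws_loc X x"
  shows "Delta_s \<phi> z y + Delta_s \<phi> y x = Delta_s \<phi> z x"
proof -
  have "z \<in> Ws_loc X y" using y z by (simp add: Ws_loc_def)
  from suminf_add[OF u.Delta_s_summable[OF R y(1) z(1) this] u.Delta_s_summable[OF R x y]]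
  show ?thesis unfolding Delta_s_def by simp
qed

lemma Delta_u_cocycle:
  assumes R: "R \<in> \<R>" and x: "x \<in> R" and y: "y \<in> R" "y \<in> Wu_loc X x" and z: "z \<in> R" "z \<in> Wu_loc X x"
  shows "Delta_u \<phi> z y + Delta_u \<phi> y x = Delta_u \<phi> z x"
proof -
  have flip_leaf: "flip w \<in> Ws_loc (flip ` X) (flip v)" if "w \<in> Wu_loc X v" for v w
    using that by (auto simp: Ws_loc_def Wu_loc_def flip_apply)
  have zy: "z \<in> Wu_loc X y" using y z by (simp add: Wu_loc_def)
  have summable: "summable (\<lambda>n. \<phi> (shift (- int n) w) - \<phi> (shift (- int n) v))"
    if "w \<in> R" "v \<in> R" "w \<in> Wu_loc X v" for v w
    using s.Delta_s_summable[OF flip_family[OF R], of "flip v" "flip w"] that flip_leaf[of w v]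
    by (simp add: shift_flip)
  from suminf_add[OF summable[OF z(1) y(1) zy] summable[OF y(1) x y(2)]]
  show ?thesis unfolding Delta_u_def by simp
qed

lemma lambda_fun_independent:
  assumes R: "R \<in> \<R>" and p: "p \<in> R" and q: "q \<in> R" and Z: "Z \<in> borel_subsets R"
  shows "lambda_fun X \<phi> R q Z = lambda_fun X \<phi> R p Z"
proof -
  have "lambda_fun X \<phi> R q Z = (\<integral>\<^sup>+z. ennreal (exp (Delta_s \<phi> (bracket q z) z)) *
      (\<integral>\<^sup>+y. integrand Z (bracket q z) y \<partial>V R q) \<partial>U R p)"
    unfolding lambda_fun_eq by (rule nn_integral_U[OF R p q measurable_integrand_U[OF R q Z]])
  also have "\<dots> = (\<integral>\<^sup>+z. (\<integral>\<^sup>+y. integrand Z z y \<partial>V R p) \<partial>U R p)"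
  proof (rule nn_integral_cong)
    fix z assume "z \<in> space (U R p)"
    then have zp: "z \<in> Wu_rect X R p" and z: "z \<in> R" by (auto dest: rect_mem)
    define z' where "z' = bracket q z"
    have z': "z' \<in> R" unfolding z'_def by (rule u.bracket_in_rect[OF R q z])
    then have "z' \<in> Wu_rect X R q"
      using u.rect_in_X[OF R z'] by (simp add: Wu_rect_def Wu_loc_def z'_def bracket_def)
    note meas = measurable_integrand_V[OF R Z this]
    have [measurable]: "(\<lambda>y. bracket y q) \<in> measurable (V R p) (V R q)"
      by (rule measurable_bracket_V[OF R p q])
    have id: "(\<lambda>y. y) \<in> measurable (V R p) seq_borel" by (rule measurable_id_seq_borel) simp
    have [measurable]: "(\<lambda>y. Delta_u \<phi> (bracket y q) y) \<in> borel_measurable (V R p)"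
      using q by (intro measurable_Delta_u id measurable_bracket measurable_const)
        (auto dest!: rect_mem intro: u.rect_in_X[OF R] u.bracket_in_rect[OF R])
    have [measurable]: "(\<lambda>y. integrand Z z' (bracket y q)) \<in> borel_measurable (V R p)"
      by (rule measurable_compose[OF _ meas]) measurable
    have "ennreal (exp (Delta_s \<phi> z' z)) * (\<integral>\<^sup>+y. integrand Z z' y \<partial>V R q) =
        (\<integral>\<^sup>+y. ennreal (exp (Delta_s \<phi> z' z)) *
          (ennreal (exp (Delta_u \<phi> (bracket y q) y)) * integrand Z z' (bracket y q)) \<partial>V R p)"
      unfolding nn_integral_V[OF R p q meas] by (rule nn_integral_cmult[symmetric]) measurable
    also have "\<dots> = (\<integral>\<^sup>+y. integrand Z z y \<partial>V R p)"
    proof (rule nn_integral_cong)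
      fix y assume "y \<in> space (V R p)"
      then have y: "y \<in> R" by (auto dest: rect_mem)
      define y' where "y' = bracket y q"
      have y': "y' \<in> R" unfolding y'_def by (rule u.bracket_in_rect[OF R y q])
      have X: "y \<in> X" "y' \<in> X" "z \<in> X" "z' \<in> X" using y y' z z' u.rect_in_X[OF R] by blast+
      define w where "w = bracket y z"
      have w: "w \<in> R" "w \<in> X" unfolding w_def using u.bracket_in_rect[OF R y z] u.rect_in_X[OF R] by blast+
      \<comment> \<open>The substitutions change only the future of \<open>y\<close> and the past of
        \<open>z\<close>, which the bracket ignores. The point tested against \<open>Z\<close>
        therefore stays the same.\<close>
      have w': "bracket y' z' = w" by (auto simp: w_def y'_def z'_def bracket_def)
      have zero: "y 0 = z 0" "q 0 = z 0" using u.rect_zero_eq[OF R] y z q by blast+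
      have "Delta_s \<phi> w z' + Delta_s \<phi> z' z = Delta_s \<phi> w z"
        using X w zero by (intro Delta_s_cocycle[OF R z z' _ w(1)])
          (auto simp: Ws_loc_def w_def z'_def bracket_def)
      moreover have "Delta_u \<phi> w y' + Delta_u \<phi> y' y = Delta_u \<phi> w y"
        using X w zero by (intro Delta_u_cocycle[OF R y y' _ w(1)])
          (auto simp: Wu_loc_def w_def y'_def bracket_def)
      \<comment> \<open>The two factors from the changes of variables turn the exponents based at
        \<open>y'\<close> and \<open>z'\<close> into those based at \<open>y\<close> and
        \<open>z\<close>.\<close>
      ultimately have "Delta_s \<phi> z' z + (Delta_u \<phi> y' y + (Delta_u \<phi> w y' + Delta_s \<phi> w z')) =
          Delta_u \<phi> w y + Delta_s \<phi> w z" by simp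
      then have "ennreal (exp (Delta_s \<phi> z' z)) * (ennreal (exp (Delta_u \<phi> y' y)) *
          (ennreal (exp (Delta_u \<phi> w y')) * ennreal (exp (Delta_s \<phi> w z')))) =
          ennreal (exp (Delta_u \<phi> w y)) * ennreal (exp (Delta_s \<phi> w z))"
        by (simp add: ennreal_mult'[symmetric] exp_add[symmetric])
      then show "ennreal (exp (Delta_s \<phi> z' z)) *
          (ennreal (exp (Delta_u \<phi> (bracket y q) y)) * integrand Z z' (bracket y q)) = integrand Z z y"
        unfolding integrand_def y'_def[symmetric] w' w_def[symmetric] by (simp add: mult.assoc[symmetric])
    qed
    finally show "ennreal (exp (Delta_s \<phi> (bracket q z) z)) *
        (\<integral>\<^sup>+y. integrand Z (bracket q z) y \<partial>V R q) = (\<integral>\<^sup>+y. integrand Z z y \<partial>V R p)"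
      unfolding z'_def .
  qed
  finally show ?thesis unfolding lambda_fun_eq .
qed

lemma lambda_measure_independent:
  assumes "R \<in> \<R>" "p \<in> R" "q \<in> R"
  shows "lambda_measure X \<phi> R q = lambda_measure X \<phi> R p"
  unfolding lambda_measure_def
  using assms by (intro measure_of_eq lambda_fun_independent) (auto dest: borel_subsets_subset
      simp: sigma_algebra.sigma_sets_eq[OF sigma_algebra_borel_subsets])

lemma lambda_measure_nonzero:
  assumes R: "R \<in> \<R>" and q: "q \<in> R"
  shows "emeasure (lambda_measure X \<phi> R q) R \<noteq> 0"
proof
  assume "emeasure (lambda_measure X \<phi> R q) R = 0"
  then have 0: "(\<integral>\<^sup>+z. (\<integral>\<^sup>+y. integrand R z y \<partial>V R q) \<partial>U R q) = 0"
    using emeasure_measure_of_borel_subsets[OF measure_space_lambda[OF R q] self_in_borel_subsets]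
    by (simp add: lambda_measure_def lambda_fun_eq)
  have inner: "(\<integral>\<^sup>+y. integrand R z y \<partial>V R q) \<noteq> 0" if zq: "z \<in> Wu_rect X R q" for z
  proof
    assume "(\<integral>\<^sup>+y. integrand R z y \<partial>V R q) = 0"
    then have "emeasure (V R q) {y \<in> Ws_rect X R q. integrand R z y \<noteq> 0} = 0"
      using nn_integral_0_iff[OF measurable_integrand_V[OF R self_in_borel_subsets zq]] by simp
    \<comment> \<open>On all of \<open>R\<close> the indicator is 1, and what remains is a product
      of exponentials.\<close>
    moreover have "integrand R z y \<noteq> 0" if y: "y \<in> Ws_rect X R q" for y
      using u.bracket_in_rect[OF R rect_mem(2)[OF y] rect_mem(1)[OF zq]]
      by (simp add: integrand_def ennreal_eq_0_iff not_le)
    then have "{y \<in> Ws_rect X R q. integrand R z y \<noteq> 0} = Ws_rect X R q" by blast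
    ultimately show False using V_space_pos[OF R q] by simp
  qed
  have "emeasure (U R q) {z \<in> Wu_rect X R q. (\<integral>\<^sup>+y. integrand R z y \<partial>V R q) \<noteq> 0} = 0"
    using nn_integral_0_iff[OF measurable_integrand_U[OF R q self_in_borel_subsets]] 0 by simp
  moreover have "{z \<in> Wu_rect X R q. (\<integral>\<^sup>+y. integrand R z y \<partial>V R q) \<noteq> 0} = Wu_rect X R q"
    using inner by blast
  ultimately show False using U_space_pos[OF R q] by simp
qed

end

theorem theorem1p17:
  fixes X :: "(int \<Rightarrow> 'a::finite) set"
    and \<phi> :: "(int \<Rightarrow> 'a) \<Rightarrow> real"
    and \<R> :: "(int \<Rightarrow> 'a) set set"
  assumes "shift_space X"
    and "continuous_map (subtopology seq_topology X) euclideanreal \<phi>"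
    and "\<forall>R\<in>\<R>. rectangle X R"
    and "L_invariant X \<R>"
    and "uniform_holonomies_u X \<phi> \<R>" and "uniform_holonomies_s X \<phi> \<R>"
    and "positive_u X \<phi> \<R>" and "positive_s X \<phi> \<R>"
    and "\<forall>R\<in>\<R>. \<forall>q\<in>R. sigma_finite_measure (mu_measure X \<phi> q (Wu_rect X R q)) \<and>
                     sigma_finite_measure (ms_measure X \<phi> q (Ws_rect X R q))"
  shows "\<forall>R\<in>\<R>.
           (\<forall>q\<in>R. measure_space R (borel_subsets R) (lambda_fun X \<phi> R q)) \<and>
           (\<forall>q\<in>R. \<forall>q'\<in>R. lambda_measure X \<phi> R q = lambda_measure X \<phi> R q') \<and>
           (\<forall>q\<in>R. emeasure (lambda_measure X \<phi> R q) R \<noteq> 0)"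
proof -
  interpret shift_potential X \<phi> by standard (rule assms)+
  interpret flipped: shift_potential "flip ` X" "\<phi> \<circ> flip" by (rule shift_potential_flip)
  let ?X' = "flip ` X" and ?\<phi>' = "\<phi> \<circ> flip" and ?P = "pressure X \<phi>"
  have sf_u: "sigma_finite_measure (mu_measure X \<phi> q (Wu_rect X R q))"
    and sf_s: "sigma_finite_measure (ms_measure X \<phi> q (Ws_rect X R q))" if "R \<in> \<R>" "q \<in> R" for R q
    using assms(9) that by blast+
  have u: "holonomy_family X \<phi> ?P \<R>"
  proof
    show "rectangle X R" if "R \<in> \<R>" for R using assms(3) that by blast
    show "shift (int n) ` (R \<inter> cyl_plus X w) \<in> \<R>"
      if "R \<in> \<R>" "w \<in> lang X" "length w = n + 1" "R \<inter> cyl_plus X w \<noteq> {}" for R w n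
      using assms(4) that unfolding L_invariant_def by blast
    show "\<exists>\<delta>::real. \<delta> > 0 \<and> (\<forall>R\<in>\<R>. \<forall>y\<in>R. \<forall>z\<in>R. seq_dist y z < \<delta> \<longrightarrow>
      (\<forall>Y\<in>borel_subsets (Wu_rect X R y).
         leaf_outer X \<phi> ?P y Y \<le> ennreal (exp \<epsilon>) * leaf_outer X \<phi> ?P z (bracket z ` Y)))"
      if \<epsilon>: "\<epsilon> > 0" for \<epsilon>
    proof -
      have "hol_s y z = bracket z" for y z :: "int \<Rightarrow> 'a" by (simp add: fun_eq_iff hol_s_def)
      then show ?thesis
        using assms(5)[unfolded uniform_holonomies_u_def, rule_format, OF \<epsilon>]
        unfolding mu_eq_leaf_outer by (elim exE conjE) (intro exI conjI, assumption, simp)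
    qed
    show "\<exists>x\<in>R. leaf_outer X \<phi> ?P x (Wu_rect X R x) > 0" if "R \<in> \<R>" for R
      using assms(7) that unfolding positive_u_def mu_eq_leaf_outer by blast
    fix R x A
    assume *: "R \<in> \<R>" "x \<in> R" "A \<in> borel_subsets (Wu_rect X R x)" "leaf_outer X \<phi> ?P x A > 0"
    have D: "Wu_rect X R x \<subseteq> Wu_loc X x" by (auto simp: Wu_rect_def)
    show "\<exists>B\<in>borel_subsets (Wu_rect X R x). B \<subseteq> A \<and> 0 < leaf_outer X \<phi> ?P x B \<and> leaf_outer X \<phi> ?P x B < \<infinity>"
      using sigma_finite_measure.ex_finite_positive_subset[OF sf_u[OF *(1,2)], of A] *(3,4)
      by (auto simp: mu_measure_eq_leaf_measure emeasure_leaf_measure[OF D])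
  qed
  \<comment> \<open>Each assumption on stable leaves is read in the reversed system; invariance
    under \<open>cyl_minus\<close> and backward shifts becomes invariance under
    \<open>cyl_plus\<close> and forward shifts.\<close>
  have s: "holonomy_family ?X' ?\<phi>' ?P ((`) flip ` \<R>)"
  proof
    fix R' assume "R' \<in> (`) flip ` \<R>"
    then obtain R where R: "R \<in> \<R>" "R' = flip ` R" by blast
    show "rectangle ?X' R'" unfolding R(2) using assms(3) R(1) by (blast intro: rectangle_flip)
    show "\<exists>x\<in>R'. leaf_outer ?X' ?\<phi>' ?P x (Wu_rect ?X' R' x) > 0"
    proof -
      obtain x where "x \<in> R" "ms X \<phi> x (Ws_rect X R x) > 0" using assms(8) R(1) unfolding positive_s_def by blast
      then show ?thesis unfolding R(2) ms_eq_leaf_outer Ws_rect_flip by blast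
    qed
    show "shift (int n) ` (R' \<inter> cyl_plus ?X' w) \<in> (`) flip ` \<R>"
      if w: "w \<in> lang ?X'" "length w = n + 1" "R' \<inter> cyl_plus ?X' w \<noteq> {}" for w n
    proof -
      obtain v where v: "v \<in> lang X" "w = rev v" using w(1) unfolding lang_flip by blast
      have eq: "R' \<inter> cyl_plus ?X' w = flip ` (R \<inter> cyl_minus X v)"
        unfolding R(2) v(2) cyl_minus_flip[symmetric] by (rule image_Int[OF inj_flip, symmetric])
      then have "R \<inter> cyl_minus X v \<noteq> {}" "length v = n + 1" using w v(2) by auto
      then have "shift (- int n) ` (R \<inter> cyl_minus X v) \<in> \<R>"
        using assms(4) R(1) v(1) unfolding L_invariant_def by blast
      moreover have "shift (int n) ` (R' \<inter> cyl_plus ?X' w) = flip ` shift (- int n) ` (R \<inter> cyl_minus X v)"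
        unfolding eq by (simp add: image_image shift_flip)
      ultimately show ?thesis by blast
    qed
    fix x' A' assume x': "x' \<in> R'" and A': "A' \<in> borel_subsets (Wu_rect ?X' R' x')"
      and pos: "leaf_outer ?X' ?\<phi>' ?P x' A' > 0"
    obtain x where x: "x \<in> R" "x' = flip x" using x' R(2) by blast
    have W: "Wu_rect ?X' R' x' = flip ` Ws_rect X R x" unfolding R(2) x(2) Ws_rect_flip ..
    have A: "flip ` A' \<in> borel_subsets (Ws_rect X R x)"
      using borel_subsets_flip[OF A'] unfolding W by simp
    have D: "Ws_rect X R x \<subseteq> Ws_loc X x" by (auto simp: Ws_rect_def)
    have "0 < emeasure (ms_measure X \<phi> x (Ws_rect X R x)) (flip ` A')"
      unfolding emeasure_ms_measure[OF D A] ms_eq_leaf_outer using pos x(2) by simp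
    from sigma_finite_measure.ex_finite_positive_subset[OF sf_s[OF R(1) x(1)] _ this] A
    obtain B where B: "B \<in> borel_subsets (Ws_rect X R x)" "B \<subseteq> flip ` A'"
      "0 < ms X \<phi> x B" "ms X \<phi> x B < \<infinity>" by (auto simp: emeasure_ms_measure[OF D])
    have "flip ` B \<subseteq> A'" using B(2) by auto
    then show "\<exists>B\<in>borel_subsets (Wu_rect ?X' R' x'). B \<subseteq> A' \<and>
        0 < leaf_outer ?X' ?\<phi>' ?P x' B \<and> leaf_outer ?X' ?\<phi>' ?P x' B < \<infinity>"
      using B(3,4) borel_subsets_flip[OF B(1)] unfolding W unfolding ms_eq_leaf_outer x(2)
      by (intro bexI[of _ "flip ` B"] conjI)
  next
    fix \<epsilon> :: real assume \<epsilon>: "\<epsilon> > 0"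
    then obtain \<delta> :: real where \<delta>: "\<delta> > 0" and "\<forall>R\<in>\<R>. \<forall>y\<in>R. \<forall>z\<in>R. seq_dist y z < \<delta> \<longrightarrow>
        (\<forall>Y\<in>borel_subsets (Ws_rect X R y).
            ennreal (exp (- \<epsilon>)) * ms X \<phi> z (hol_u y z ` Y) \<le> ms X \<phi> y Y \<and>
            ms X \<phi> y Y \<le> ennreal (exp \<epsilon>) * ms X \<phi> z (hol_u y z ` Y))"
      by (rule assms(6)[unfolded uniform_holonomies_s_def, rule_format, THEN exE]) (elim conjE)
    note hol = this(2)[rule_format, THEN conjunct2]
    show "\<exists>\<delta>::real. \<delta> > 0 \<and> (\<forall>R\<in>(`) flip ` \<R>. \<forall>y\<in>R. \<forall>z\<in>R. seq_dist y z < \<delta> \<longrightarrow>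
      (\<forall>Y\<in>borel_subsets (Wu_rect ?X' R y).
         leaf_outer ?X' ?\<phi>' ?P y Y \<le> ennreal (exp \<epsilon>) * leaf_outer ?X' ?\<phi>' ?P z (bracket z ` Y)))"
    proof (intro exI[of _ \<delta>] conjI \<delta> ballI impI)
      fix R' y' z' Y'
      assume *: "R' \<in> (`) flip ` \<R>" "y' \<in> R'" "z' \<in> R'" "seq_dist y' z' < \<delta>"
        "Y' \<in> borel_subsets (Wu_rect ?X' R' y')"
      then obtain R y z where R: "R \<in> \<R>" "R' = flip ` R" "y \<in> R" "y' = flip y" "z \<in> R" "z' = flip z" by blast
      have W: "Wu_rect ?X' R' y' = flip ` Ws_rect X R y" unfolding R Ws_rect_flip ..
      have Y: "flip ` Y' \<in> borel_subsets (Ws_rect X R y)"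
        using borel_subsets_flip[OF *(5)] unfolding W by simp
      \<comment> \<open>Reversal conjugates the stable holonomy to the bracket with the new base
        point, as points of a rectangle share position 0.\<close>
      have "flip ` hol_u y z ` flip ` Y' = bracket z' ` Y'"
        unfolding image_image
      proof (rule image_cong[OF refl])
        fix x' assume "x' \<in> Y'"
        then obtain x where x: "x \<in> R" "x' = flip x"
          using borel_subsets_subset[OF *(5)] unfolding W by (auto simp: Ws_rect_def)
        have "z 0 = x 0" using assms(3) R(1,5) x(1) unfolding rectangle_def by blast
        then show "flip (hol_u y z (flip x')) = bracket z' x'"
          unfolding R x hol_u_def flip_flip by (rule bracket_flip[symmetric])
      qed
      with hol[OF R(1,3,5) _ Y] *(4)
      show "leaf_outer ?X' ?\<phi>' ?P y' Y' \<le> ennreal (exp \<epsilon>) * leaf_outer ?X' ?\<phi>' ?P z' (bracket z' ` Y')"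
        unfolding R ms_eq_leaf_outer by simp
    qed
  qed
  interpret product_family X \<phi> \<R>
    by (intro product_family.intro product_family_axioms.intro u s sf_s)
  show ?thesis
    using measure_space_lambda lambda_measure_independent lambda_measure_nonzero by blast
qed

end
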